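(* Let $\mathcal{C},\mathcal{D}$ be triangulated categories and let $S : \mathcal{C} \to \mathcal{D}$ be a spherical functor with right adjoint functor $R : \mathcal{D}\to\mathcal{C}$, twist functor $T_S$ and cotwist functor $C_S$. Let $t\in\mathbb{R}$. (1) Assume that the essential image of $R : \mathcal{D} \to \mathcal{C}$ contains a split-generator of $\mathcal{C}$. Then $h_t(T_S) \geq h_t(C_S[2])$. (2) Assume that $\mathrm{Ker}\, SR \neq 0$, i.e. there is a nonzero object $E$ of $\mathcal{D}$ with $SRE\cong 0$. Then $h_t(T_S) \geq 0$.
   Context: Standing assumptions: all triangulated categories are linear over a field $\mathbb{K}$, admit a dg enhancement (i.e. are equivalent, as triangulated categories, to $H^0(\mathcal{A})$ for a pretriangulated dg category $\mathcal{A}$), and all exact functors between them admit dg lifts; cones of natural transformations are formed functorially via these. A triangulated category is assumed to have a split-generator whenever the categorical entropy of one of its endofunctors is considered. Split-generator: an object $G$ of a triangulated category $\mathcal{D}$ such that the smallest full triangulated subcategory containing $G$ and closed under taking direct summands is $\mathcal{D}$. Categorical complexity: for objects $E,F$ of $\mathcal{D}$ and $t \in \mathbb{R}$, $\delta_t(E,F)=0$ if $F\cong 0$; otherwise $\delta_t(E,F) \in [0,\infty]$ is the infimum of $\sum_{i=1}^k e^{n_i t}$ over all sequences of integers $(n_1,\dots,n_k)$ for which there exist an object $F'$ and objects $0=A_0,A_1,\dots,A_k = F\oplus F'$ with exact triangles $A_{i-1}\to A_i \to E[n_i] \to A_{i-1}[1]$ for $i=1,\dots,k$. Categorical entropy of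 an exact endofunctor $\Phi$ of $\mathcal{D}$: $h_t(\Phi) = \lim_{n\to\infty}\frac1n\log\delta_t(G,\Phi^nG) \in [-\infty,\infty)$ for a split-generator $G$ (the limit exists and is independent of $G$). Spherical functor: an exact functor $S:\mathcal{C}\to\mathcal{D}$ with right and left adjoints $R,L$ such that (1) the twist functor $T_S=\mathrm{Cone}(SR\xrightarrow{\varepsilon}\mathrm{Id}_\mathcal{D})$ ($\varepsilon$ the counit of $S\dashv R$) is an exact autoequivalence of $\mathcal{D}$; (2) the cotwist functor $C_S=\mathrm{Cone}(\mathrm{Id}_\mathcal{C}\xrightarrow{\eta}RS)[-1]$ ($\eta$ the unit of $S\dashv R$) is an exact autoequivalence of $\mathcal{C}$; (3) $R\cong LT_S[-1]$; (4) $R\cong C_SL[1]$. Here $C_S[2]$ is the composition of $C_S$ with the shift $[2]$.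
   Formalization: In (2) the nonzero E with SRE≅0 must also satisfy δ_t(G,E)≠0 for some split-generator G of D (automatic for t=0); otherwise (2) fails for t≠0, e.g. C=0, D=Perf K[u,u⁻¹] with |u|=2, where T_S=Id and h_t(T_S)=−∞. *)

theory Defs
  imports "HOL-Algebra.Module" "HOL-Library.Extended_Nonnegative_Real"
begin

section \<open>Linear categories and functors\<close>

text \<open>
  The ground field is a HOL-Algebra field \<open>K\<close>.  A category has a carrier of objects and a carrier of
  arrows; each hom-set is turned into a HOL-Algebra module over \<open>K\<close> by \<open>hom_space\<close>.  Only
  values on the carriers are ever constrained.
\<close>

record ('o, 'm, 'k) linear_cat =
  Ob :: "'o set"
  Arr :: "'m set"
  Dom :: "'m \<Rightarrow> 'o"
  Cod :: "'m \<Rightarrow> 'o"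
  Ident :: "'o \<Rightarrow> 'm"
  Comp :: "'m \<Rightarrow> 'm \<Rightarrow> 'm" (infixr \<open>\<cdot>\<index>\<close> 70)
  Null :: "'o \<Rightarrow> 'o \<Rightarrow> 'm"
  Plus :: "'m \<Rightarrow> 'm \<Rightarrow> 'm"
  Scal :: "'k \<Rightarrow> 'm \<Rightarrow> 'm"

definition Hom :: "('o, 'm, 'k, 'z) linear_cat_scheme \<Rightarrow> 'o \<Rightarrow> 'o \<Rightarrow> 'm set" where
  "Hom C X Y = {f \<in> Arr C. Dom C f = X \<and> Cod C f = Y}"

definition hom_space ::
  "('o, 'm, 'k, 'z) linear_cat_scheme \<Rightarrow> 'o \<Rightarrow> 'o \<Rightarrow> ('k, 'm) module" where
  "hom_space C X Y = \<lparr>carrier = Hom C X Y, mult = undefined, one = undefined,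
     zero = Null C X Y, add = Plus C, smult = Scal C\<rparr>"

definition neg :: "('o, 'm, 'k, 'z) linear_cat_scheme \<Rightarrow> 'm \<Rightarrow> 'm" where
  "neg C f = a_inv (hom_space C (Dom C f) (Cod C f)) f"

locale linear_category =
  fixes K :: "('k, 'r) ring_scheme" and C :: "('o, 'm, 'k, 'z) linear_cat_scheme"
  assumes ground_field: "field K"
    and arrow_ends: "f \<in> Arr C \<Longrightarrow> Dom C f \<in> Ob C \<and> Cod C f \<in> Ob C"
    and hom_module: "\<lbrakk>X \<in> Ob C; Y \<in> Ob C\<rbrakk> \<Longrightarrow> Module.module K (hom_space C X Y)"
    and ident_hom: "X \<in> Ob C \<Longrightarrow> Ident C X \<in> Hom C X X"
    and comp_hom: "\<lbrakk>f \<in> Hom C X Y; g \<in> Hom C Y Z\<rbrakk> \<Longrightarrow> g \<cdot>\<^bsub>C\<^esub> f \<in> Hom C X Z"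
    and comp_assoc: "\<lbrakk>f \<in> Hom C W X; g \<in> Hom C X Y; h \<in> Hom C Y Z\<rbrakk>
      \<Longrightarrow> (h \<cdot>\<^bsub>C\<^esub> g) \<cdot>\<^bsub>C\<^esub> f = h \<cdot>\<^bsub>C\<^esub> (g \<cdot>\<^bsub>C\<^esub> f)"
    and ident_right: "f \<in> Hom C X Y \<Longrightarrow> f \<cdot>\<^bsub>C\<^esub> Ident C X = f"
    and ident_left: "f \<in> Hom C X Y \<Longrightarrow> Ident C Y \<cdot>\<^bsub>C\<^esub> f = f"
    and comp_plus_left: "\<lbrakk>f \<in> Hom C X Y; g \<in> Hom C Y Z; g' \<in> Hom C Y Z\<rbrakk>
      \<Longrightarrow> Plus C g g' \<cdot>\<^bsub>C\<^esub> f = Plus C (g \<cdot>\<^bsub>C\<^esub> f) (g' \<cdot>\<^bsub>C\<^esub> f)"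
    and comp_plus_right: "\<lbrakk>f \<in> Hom C X Y; f' \<in> Hom C X Y; g \<in> Hom C Y Z\<rbrakk>
      \<Longrightarrow> g \<cdot>\<^bsub>C\<^esub> Plus C f f' = Plus C (g \<cdot>\<^bsub>C\<^esub> f) (g \<cdot>\<^bsub>C\<^esub> f')"
    and comp_scal_left: "\<lbrakk>a \<in> carrier K; f \<in> Hom C X Y; g \<in> Hom C Y Z\<rbrakk>
      \<Longrightarrow> Scal C a g \<cdot>\<^bsub>C\<^esub> f = Scal C a (g \<cdot>\<^bsub>C\<^esub> f)"
    and comp_scal_right: "\<lbrakk>a \<in> carrier K; f \<in> Hom C X Y; g \<in> Hom C Y Z\<rbrakk>
      \<Longrightarrow> g \<cdot>\<^bsub>C\<^esub> Scal C a f = Scal C a (g \<cdot>\<^bsub>C\<^esub> f)"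

definition is_iso :: "('o, 'm, 'k, 'z) linear_cat_scheme \<Rightarrow> 'm \<Rightarrow> bool" where
  "is_iso C f \<longleftrightarrow> f \<in> Arr C \<and> (\<exists>g \<in> Hom C (Cod C f) (Dom C f).
     g \<cdot>\<^bsub>C\<^esub> f = Ident C (Dom C f) \<and> f \<cdot>\<^bsub>C\<^esub> g = Ident C (Cod C f))"

definition isomorphic :: "('o, 'm, 'k, 'z) linear_cat_scheme \<Rightarrow> 'o \<Rightarrow> 'o \<Rightarrow> bool" where
  "isomorphic C X Y \<longleftrightarrow> (\<exists>f \<in> Hom C X Y. is_iso C f)"

definition is_zero :: "('o, 'm, 'k, 'z) linear_cat_scheme \<Rightarrow> 'o \<Rightarrow> bool" where
  "is_zero C X \<longleftrightarrow> X \<in> Ob C \<and>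
     (\<forall>Y \<in> Ob C. (\<exists>!f. f \<in> Hom C X Y) \<and> (\<exists>!f. f \<in> Hom C Y X))"

text \<open>\<open>is_direct_sum C X Y Z\<close>: \<open>Z\<close> is (isomorphic to) \<open>X \<oplus> Y\<close>.\<close>

definition is_direct_sum :: "('o, 'm, 'k, 'z) linear_cat_scheme \<Rightarrow> 'o \<Rightarrow> 'o \<Rightarrow> 'o \<Rightarrow> bool" where
  "is_direct_sum C X Y Z \<longleftrightarrow> X \<in> Ob C \<and> Y \<in> Ob C \<and> Z \<in> Ob C \<and>
     (\<exists>i \<in> Hom C X Z. \<exists>j \<in> Hom C Y Z. \<exists>p \<in> Hom C Z X. \<exists>q \<in> Hom C Z Y.
        p \<cdot>\<^bsub>C\<^esub> i = Ident C X \<and> q \<cdot>\<^bsub>C\<^esub> j = Ident C Y \<and>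
        q \<cdot>\<^bsub>C\<^esub> i = Null C X Y \<and> p \<cdot>\<^bsub>C\<^esub> j = Null C Y X \<and>
        Plus C (i \<cdot>\<^bsub>C\<^esub> p) (j \<cdot>\<^bsub>C\<^esub> q) = Ident C Z)"

record ('o, 'm, 'p, 'n) ftor =
  fobj :: "'o \<Rightarrow> 'p"
  farr :: "'m \<Rightarrow> 'n"

definition id_ftor :: "('o, 'm, 'o, 'm) ftor" where
  "id_ftor = \<lparr>fobj = (\<lambda>X. X), farr = (\<lambda>f. f)\<rparr>"

definition comp_ftor ::
  "('p, 'n, 'q, 'l) ftor \<Rightarrow> ('o, 'm, 'p, 'n) ftor \<Rightarrow> ('o, 'm, 'q, 'l) ftor"
  (infixr \<open>\<odot>\<^sub>F\<close> 72) where
  "G \<odot>\<^sub>F F = \<lparr>fobj = (\<lambda>X. fobj G (fobj F X)), farr = (\<lambda>f. farr G (farr F f))\<rparr>"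

definition linear_functor :: "('k, 'r) ring_scheme \<Rightarrow> ('o, 'm, 'k, 'z) linear_cat_scheme
  \<Rightarrow> ('p, 'n, 'k, 'y) linear_cat_scheme \<Rightarrow> ('o, 'm, 'p, 'n) ftor \<Rightarrow> bool" where
  "linear_functor K C D F \<longleftrightarrow>
     (\<forall>X \<in> Ob C. fobj F X \<in> Ob D \<and> farr F (Ident C X) = Ident D (fobj F X)) \<and>
     (\<forall>X \<in> Ob C. \<forall>Y \<in> Ob C. \<forall>f \<in> Hom C X Y. farr F f \<in> Hom D (fobj F X) (fobj F Y)) \<and>
     (\<forall>X \<in> Ob C. \<forall>Y \<in> Ob C. \<forall>Z \<in> Ob C. \<forall>f \<in> Hom C X Y. \<forall>g \<in> Hom C Y Z.
        farr F (g \<cdot>\<^bsub>C\<^esub> f) = farr F g \<cdot>\<^bsub>D\<^esub> farr F f) \<and>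
     (\<forall>X \<in> Ob C. \<forall>Y \<in> Ob C. \<forall>f \<in> Hom C X Y. \<forall>g \<in> Hom C X Y.
        farr F (Plus C f g) = Plus D (farr F f) (farr F g)) \<and>
     (\<forall>X \<in> Ob C. \<forall>Y \<in> Ob C. \<forall>a \<in> carrier K. \<forall>f \<in> Hom C X Y.
        farr F (Scal C a f) = Scal D a (farr F f))"

definition nat_trans :: "('o, 'm, 'k, 'z) linear_cat_scheme \<Rightarrow> ('p, 'n, 'k, 'y) linear_cat_scheme
  \<Rightarrow> ('o, 'm, 'p, 'n) ftor \<Rightarrow> ('o, 'm, 'p, 'n) ftor \<Rightarrow> ('o \<Rightarrow> 'n) \<Rightarrow> bool" where
  "nat_trans C D F G \<tau> \<longleftrightarrow>
     (\<forall>X \<in> Ob C. \<tau> X \<in> Hom D (fobj F X) (fobj G X)) \<and>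
     (\<forall>f \<in> Arr C. farr G f \<cdot>\<^bsub>D\<^esub> \<tau> (Dom C f) = \<tau> (Cod C f) \<cdot>\<^bsub>D\<^esub> farr F f)"

definition nat_iso :: "('o, 'm, 'k, 'z) linear_cat_scheme \<Rightarrow> ('p, 'n, 'k, 'y) linear_cat_scheme
  \<Rightarrow> ('o, 'm, 'p, 'n) ftor \<Rightarrow> ('o, 'm, 'p, 'n) ftor \<Rightarrow> ('o \<Rightarrow> 'n) \<Rightarrow> bool" where
  "nat_iso C D F G \<tau> \<longleftrightarrow> nat_trans C D F G \<tau> \<and> (\<forall>X \<in> Ob C. is_iso D (\<tau> X))"

definition naturally_isomorphic ::
  "('o, 'm, 'k, 'z) linear_cat_scheme \<Rightarrow> ('p, 'n, 'k, 'y) linear_cat_scheme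
  \<Rightarrow> ('o, 'm, 'p, 'n) ftor \<Rightarrow> ('o, 'm, 'p, 'n) ftor \<Rightarrow> bool" where
  "naturally_isomorphic C D F G \<longleftrightarrow> (\<exists>\<tau>. nat_iso C D F G \<tau>)"

definition quasi_inverse :: "('o, 'm, 'k, 'z) linear_cat_scheme
  \<Rightarrow> ('p, 'n, 'k, 'y) linear_cat_scheme \<Rightarrow> ('o, 'm, 'p, 'n) ftor \<Rightarrow> ('p, 'n, 'o, 'm) ftor \<Rightarrow> bool" where
  "quasi_inverse C D F G \<longleftrightarrow>
     naturally_isomorphic C C (G \<odot>\<^sub>F F) id_ftor \<and> naturally_isomorphic D D (F \<odot>\<^sub>F G) id_ftor"

definition is_equivalence :: "('k, 'r) ring_scheme \<Rightarrow> ('o, 'm, 'k, 'z) linear_cat_scheme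
  \<Rightarrow> ('p, 'n, 'k, 'y) linear_cat_scheme \<Rightarrow> ('o, 'm, 'p, 'n) ftor \<Rightarrow> bool" where
  "is_equivalence K C D F \<longleftrightarrow> linear_functor K C D F \<and>
     (\<exists>G. linear_functor K D C G \<and> quasi_inverse C D F G)"

definition in_essential_image :: "('o, 'm, 'k, 'z) linear_cat_scheme
  \<Rightarrow> ('p, 'n, 'k, 'y) linear_cat_scheme \<Rightarrow> ('o, 'm, 'p, 'n) ftor \<Rightarrow> 'p \<Rightarrow> bool" where
  "in_essential_image C D F Y \<longleftrightarrow> Y \<in> Ob D \<and> (\<exists>X \<in> Ob C. isomorphic D (fobj F X) Y)"

text \<open>\<open>adjunction C D S R \<eta> \<epsilon>\<close>: \<open>S : C \<rightarrow> D\<close> is left adjoint to \<open>R\<close>, with unit \<open>\<eta>\<close> and counit \<open>\<epsilon>\<close>.\<close>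

definition adjunction :: "('o, 'm, 'k, 'z) linear_cat_scheme
  \<Rightarrow> ('p, 'n, 'k, 'y) linear_cat_scheme \<Rightarrow> ('o, 'm, 'p, 'n) ftor \<Rightarrow> ('p, 'n, 'o, 'm) ftor
  \<Rightarrow> ('o \<Rightarrow> 'm) \<Rightarrow> ('p \<Rightarrow> 'n) \<Rightarrow> bool" where
  "adjunction C D S R \<eta> \<epsilon> \<longleftrightarrow>
     nat_trans C C id_ftor (R \<odot>\<^sub>F S) \<eta> \<and> nat_trans D D (S \<odot>\<^sub>F R) id_ftor \<epsilon> \<and>
     (\<forall>X \<in> Ob C. \<epsilon> (fobj S X) \<cdot>\<^bsub>D\<^esub> farr S (\<eta> X) = Ident D (fobj S X)) \<and>
     (\<forall>Y \<in> Ob D. farr R (\<epsilon> Y) \<cdot>\<^bsub>C\<^esub> \<eta> (fobj R Y) = Ident C (fobj R Y))"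


section \<open>Triangulated categories\<close>

text \<open>
  The shift \<open>[1]\<close> is an autoequivalence, not necessarily an automorphism; a quasi-inverse \<open>[-1]\<close>
  is part of the data.
\<close>

record ('o, 'm, 'k) tri_cat = "('o, 'm, 'k) linear_cat" +
  Shift :: "('o, 'm, 'o, 'm) ftor"
  Unshift :: "('o, 'm, 'o, 'm) ftor"
  Triangles :: "('m \<times> 'm \<times> 'm) set"

definition triangle_shape :: "('o, 'm, 'k) tri_cat \<Rightarrow> 'm \<Rightarrow> 'm \<Rightarrow> 'm \<Rightarrow> 'o \<Rightarrow> 'o \<Rightarrow> 'o \<Rightarrow> bool" where
  "triangle_shape D f g h X Y Z \<longleftrightarrow> X \<in> Ob D \<and> Y \<in> Ob D \<and> Z \<in> Ob D \<and>
     f \<in> Hom D X Y \<and> g \<in> Hom D Y Z \<and> h \<in> Hom D Z (fobj (Shift D) X)"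

definition exact_triangle :: "('o, 'm, 'k) tri_cat \<Rightarrow> 'm \<Rightarrow> 'm \<Rightarrow> 'm \<Rightarrow> 'o \<Rightarrow> 'o \<Rightarrow> 'o \<Rightarrow> bool" where
  "exact_triangle D f g h X Y Z \<longleftrightarrow> triangle_shape D f g h X Y Z \<and> (f, g, h) \<in> Triangles D"

definition triangle_map :: "('o, 'm, 'k) tri_cat \<Rightarrow> 'm \<times> 'm \<times> 'm \<Rightarrow> 'm \<times> 'm \<times> 'm
  \<Rightarrow> 'm \<Rightarrow> 'm \<Rightarrow> 'm \<Rightarrow> bool" where
  "triangle_map D T T' a b c \<longleftrightarrow> (case (T, T') of ((f, g, h), (f', g', h')) \<Rightarrow>
     a \<in> Hom D (Dom D f) (Dom D f') \<and> b \<in> Hom D (Dom D g) (Dom D g') \<and>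
     c \<in> Hom D (Dom D h) (Dom D h') \<and>
     b \<cdot>\<^bsub>D\<^esub> f = f' \<cdot>\<^bsub>D\<^esub> a \<and> c \<cdot>\<^bsub>D\<^esub> g = g' \<cdot>\<^bsub>D\<^esub> b \<and> farr (Shift D) a \<cdot>\<^bsub>D\<^esub> h = h' \<cdot>\<^bsub>D\<^esub> c)"

definition iso_closure :: "('o, 'm, 'k) tri_cat \<Rightarrow> ('m \<times> 'm \<times> 'm) set \<Rightarrow> ('m \<times> 'm \<times> 'm) set" where
  "iso_closure D \<T> = {(f, g, h). (\<exists>X Y Z. triangle_shape D f g h X Y Z) \<and>
     (\<exists>T \<in> \<T>. \<exists>a b c. triangle_map D T (f, g, h) a b c \<and> is_iso D a \<and> is_iso D b \<and> is_iso D c)}"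

locale triangulated_category = linear_category K D
  for K :: "('k, 'r) ring_scheme" and D :: "('o, 'm, 'k) tri_cat" +
  assumes zero_exists: "\<exists>X. is_zero D X"
    and direct_sum_exists: "\<lbrakk>X \<in> Ob D; Y \<in> Ob D\<rbrakk> \<Longrightarrow> \<exists>Z. is_direct_sum D X Y Z"
    and shift_functor: "linear_functor K D D (Shift D)"
    and unshift_functor: "linear_functor K D D (Unshift D)"
    and shift_unshift: "quasi_inverse D D (Shift D) (Unshift D)"
    and triangle_type: "(f, g, h) \<in> Triangles D \<Longrightarrow> \<exists>X Y Z. triangle_shape D f g h X Y Z"
    and TR1_ident: "\<lbrakk>X \<in> Ob D; is_zero D N\<rbrakk>
      \<Longrightarrow> exact_triangle D (Ident D X) (Null D X N) (Null D N (fobj (Shift D) X)) X X N"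
    and TR1_iso: "iso_closure D (Triangles D) \<subseteq> Triangles D"
    and TR1_complete: "\<lbrakk>X \<in> Ob D; Y \<in> Ob D; f \<in> Hom D X Y\<rbrakk>
      \<Longrightarrow> \<exists>g h Z. exact_triangle D f g h X Y Z"
    and TR2: "triangle_shape D f g h X Y Z \<Longrightarrow>
      exact_triangle D f g h X Y Z \<longleftrightarrow>
      exact_triangle D g h (neg D (farr (Shift D) f)) Y Z (fobj (Shift D) X)"
    and TR3: "\<lbrakk>exact_triangle D f g h X Y Z; exact_triangle D f' g' h' X' Y' Z';
        a \<in> Hom D X X'; b \<in> Hom D Y Y'; b \<cdot>\<^bsub>D\<^esub> f = f' \<cdot>\<^bsub>D\<^esub> a\<rbrakk>
      \<Longrightarrow> \<exists>c. triangle_map D (f, g, h) (f', g', h') a b c"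
    and TR4: "\<lbrakk>exact_triangle D f i i' X Y A; exact_triangle D g k k' Y Z B;
        exact_triangle D (g \<cdot>\<^bsub>D\<^esub> f) j j' X Z E\<rbrakk>
      \<Longrightarrow> \<exists>u v. exact_triangle D u v (farr (Shift D) i \<cdot>\<^bsub>D\<^esub> k') A E B \<and>
            u \<cdot>\<^bsub>D\<^esub> i = j \<cdot>\<^bsub>D\<^esub> g \<and> j' \<cdot>\<^bsub>D\<^esub> u = i' \<and>
            v \<cdot>\<^bsub>D\<^esub> j = k \<and> k' \<cdot>\<^bsub>D\<^esub> v = farr (Shift D) f \<cdot>\<^bsub>D\<^esub> j'"

definition shift_by :: "('o, 'm, 'k) tri_cat \<Rightarrow> int \<Rightarrow> ('o, 'm, 'o, 'm) ftor" where
  "shift_by D n = (if 0 \<le> n then ((\<lambda>F. Shift D \<odot>\<^sub>F F) ^^ nat n) id_ftor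
                   else ((\<lambda>F. Unshift D \<odot>\<^sub>F F) ^^ nat (- n)) id_ftor)"

text \<open>\<open>ftor_shift D F n\<close> is \<open>F[n]\<close> for a functor \<open>F\<close> with target \<open>D\<close>.\<close>

definition ftor_shift :: "('p, 'n, 'k) tri_cat \<Rightarrow> ('o, 'm, 'p, 'n) ftor \<Rightarrow> int
  \<Rightarrow> ('o, 'm, 'p, 'n) ftor" where
  "ftor_shift D F n = shift_by D n \<odot>\<^sub>F F"

definition exact_functor :: "('k, 'r) ring_scheme \<Rightarrow> ('o, 'm, 'k) tri_cat
  \<Rightarrow> ('p, 'n, 'k) tri_cat \<Rightarrow> ('o, 'm, 'p, 'n) ftor \<Rightarrow> bool" where
  "exact_functor K C D F \<longleftrightarrow> linear_functor K C D F \<and>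
     (\<exists>\<phi>. nat_iso C D (F \<odot>\<^sub>F Shift C) (Shift D \<odot>\<^sub>F F) \<phi> \<and>
        (\<forall>(f, g, h) \<in> Triangles C.
           (farr F f, farr F g, \<phi> (Dom C f) \<cdot>\<^bsub>D\<^esub> farr F h) \<in> Triangles D))"

definition exact_equivalence :: "('k, 'r) ring_scheme \<Rightarrow> ('o, 'm, 'k) tri_cat
  \<Rightarrow> ('p, 'n, 'k) tri_cat \<Rightarrow> ('o, 'm, 'p, 'n) ftor \<Rightarrow> bool" where
  "exact_equivalence K C D F \<longleftrightarrow> exact_functor K C D F \<and> is_equivalence K C D F"

text \<open>Full triangulated subcategories closed under direct summands, given by their objects.\<close>

definition thick_subcategory :: "('o, 'm, 'k) tri_cat \<Rightarrow> 'o set \<Rightarrow> bool" where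
  "thick_subcategory D P \<longleftrightarrow> P \<subseteq> Ob D \<and> {X. is_zero D X} \<subseteq> P \<and>
     (\<forall>X \<in> P. fobj (Shift D) X \<in> P \<and> fobj (Unshift D) X \<in> P) \<and>
     (\<forall>f g h X Y Z. exact_triangle D f g h X Y Z \<and> X \<in> P \<and> Y \<in> P \<longrightarrow> Z \<in> P) \<and>
     (\<forall>X Y Z. is_direct_sum D X Y Z \<and> Z \<in> P \<longrightarrow> X \<in> P)"

definition split_generator :: "('o, 'm, 'k) tri_cat \<Rightarrow> 'o \<Rightarrow> bool" where
  "split_generator D G \<longleftrightarrow> G \<in> Ob D \<and> \<Inter> {P. thick_subcategory D P \<and> G \<in> P} = Ob D"


section \<open>Categorical complexity and entropy\<close>

text \<open>\<open>built_from D E F ns\<close>: some \<open>F \<oplus> F'\<close> is an iterated extension of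
  \<open>E[n\<^sub>1], \<dots>, E[n\<^sub>k]\<close>, where \<open>ns = [n\<^sub>1, \<dots>, n\<^sub>k]\<close>.\<close>

definition built_from :: "('o, 'm, 'k) tri_cat \<Rightarrow> 'o \<Rightarrow> 'o \<Rightarrow> int list \<Rightarrow> bool" where
  "built_from D E F ns \<longleftrightarrow> (\<exists>F' A. is_zero D (A 0) \<and> is_direct_sum D F F' (A (length ns)) \<and>
     (\<forall>i < length ns. \<exists>f g h.
        exact_triangle D f g h (A i) (A (Suc i)) (fobj (shift_by D (ns ! i)) E)))"

definition complexity :: "('o, 'm, 'k) tri_cat \<Rightarrow> real \<Rightarrow> 'o \<Rightarrow> 'o \<Rightarrow> ennreal" where
  "complexity D t E F = (if is_zero D F then 0
     else Inf {ennreal (\<Sum>n\<leftarrow>ns. exp (real_of_int n * t)) | ns. built_from D E F ns})"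

definition log_ennreal :: "ennreal \<Rightarrow> ereal" where
  "log_ennreal x = (if x = 0 then - \<infinity> else if x = \<infinity> then \<infinity> else ereal (ln (enn2real x)))"

text \<open>The common value of the limits over all split-generators.\<close>

definition entropy :: "('o, 'm, 'k) tri_cat \<Rightarrow> real \<Rightarrow> ('o, 'm, 'o, 'm) ftor \<Rightarrow> ereal" where
  "entropy D t \<Phi> = (THE h. \<forall>G. split_generator D G \<longrightarrow>
     (\<lambda>n. ereal (1 / real n) * log_ennreal (complexity D t G ((fobj \<Phi> ^^ n) G))) \<longlonglongrightarrow> h)"


section \<open>Pretriangulated dg categories\<close>

text \<open>Arrows are homogeneous morphisms; gradings are cohomological.\<close>

record ('o, 'm, 'k) dg_cat =
  dOb :: "'o set"
  dArr :: "'m set"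
  dDom :: "'m \<Rightarrow> 'o"
  dCod :: "'m \<Rightarrow> 'o"
  dDeg :: "'m \<Rightarrow> int"
  dIdent :: "'o \<Rightarrow> 'm"
  dComp :: "'m \<Rightarrow> 'm \<Rightarrow> 'm" (infixr \<open>\<bullet>\<index>\<close> 70)
  dNull :: "'o \<Rightarrow> 'o \<Rightarrow> int \<Rightarrow> 'm"
  dPlus :: "'m \<Rightarrow> 'm \<Rightarrow> 'm"
  dScal :: "'k \<Rightarrow> 'm \<Rightarrow> 'm"
  Diff :: "'m \<Rightarrow> 'm"

definition dHom :: "('o, 'm, 'k) dg_cat \<Rightarrow> 'o \<Rightarrow> 'o \<Rightarrow> int \<Rightarrow> 'm set" where
  "dHom A X Y n = {f \<in> dArr A. dDom A f = X \<and> dCod A f = Y \<and> dDeg A f = n}"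

definition dhom_space :: "('o, 'm, 'k) dg_cat \<Rightarrow> 'o \<Rightarrow> 'o \<Rightarrow> int \<Rightarrow> ('k, 'm) module" where
  "dhom_space A X Y n = \<lparr>carrier = dHom A X Y n, mult = undefined, one = undefined,
     zero = dNull A X Y n, add = dPlus A, smult = dScal A\<rparr>"

text \<open>\<open>sgn_pow A n f\<close> is \<open>(-1)\<^sup>n f\<close>.\<close>

definition sgn_pow :: "('o, 'm, 'k) dg_cat \<Rightarrow> int \<Rightarrow> 'm \<Rightarrow> 'm" where
  "sgn_pow A n f =
     (if even n then f else a_inv (dhom_space A (dDom A f) (dCod A f) (dDeg A f)) f)"

locale dg_category =
  fixes K :: "('k, 'r) ring_scheme" and A :: "('o, 'm, 'k) dg_cat"
  assumes dg_ground_field: "field K"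
    and dg_arrow_ends: "f \<in> dArr A \<Longrightarrow> dDom A f \<in> dOb A \<and> dCod A f \<in> dOb A"
    and dg_hom_module: "\<lbrakk>X \<in> dOb A; Y \<in> dOb A\<rbrakk> \<Longrightarrow> Module.module K (dhom_space A X Y n)"
    and dg_ident_hom: "X \<in> dOb A \<Longrightarrow> dIdent A X \<in> dHom A X X 0"
    and dg_comp_hom: "\<lbrakk>f \<in> dHom A X Y m; g \<in> dHom A Y Z n\<rbrakk> \<Longrightarrow> g \<bullet>\<^bsub>A\<^esub> f \<in> dHom A X Z (m + n)"
    and dg_comp_assoc: "\<lbrakk>f \<in> dHom A W X l; g \<in> dHom A X Y m; h \<in> dHom A Y Z n\<rbrakk>
      \<Longrightarrow> (h \<bullet>\<^bsub>A\<^esub> g) \<bullet>\<^bsub>A\<^esub> f = h \<bullet>\<^bsub>A\<^esub> (g \<bullet>\<^bsub>A\<^esub> f)"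
    and dg_ident_right: "f \<in> dHom A X Y n \<Longrightarrow> f \<bullet>\<^bsub>A\<^esub> dIdent A X = f"
    and dg_ident_left: "f \<in> dHom A X Y n \<Longrightarrow> dIdent A Y \<bullet>\<^bsub>A\<^esub> f = f"
    and dg_comp_plus_left: "\<lbrakk>f \<in> dHom A X Y m; g \<in> dHom A Y Z n; g' \<in> dHom A Y Z n\<rbrakk>
      \<Longrightarrow> dPlus A g g' \<bullet>\<^bsub>A\<^esub> f = dPlus A (g \<bullet>\<^bsub>A\<^esub> f) (g' \<bullet>\<^bsub>A\<^esub> f)"
    and dg_comp_plus_right: "\<lbrakk>f \<in> dHom A X Y m; f' \<in> dHom A X Y m; g \<in> dHom A Y Z n\<rbrakk>
      \<Longrightarrow> g \<bullet>\<^bsub>A\<^esub> dPlus A f f' = dPlus A (g \<bullet>\<^bsub>A\<^esub> f) (g \<bullet>\<^bsub>A\<^esub> f')"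
    and dg_comp_scal_left: "\<lbrakk>a \<in> carrier K; f \<in> dHom A X Y m; g \<in> dHom A Y Z n\<rbrakk>
      \<Longrightarrow> dScal A a g \<bullet>\<^bsub>A\<^esub> f = dScal A a (g \<bullet>\<^bsub>A\<^esub> f)"
    and dg_comp_scal_right: "\<lbrakk>a \<in> carrier K; f \<in> dHom A X Y m; g \<in> dHom A Y Z n\<rbrakk>
      \<Longrightarrow> g \<bullet>\<^bsub>A\<^esub> dScal A a f = dScal A a (g \<bullet>\<^bsub>A\<^esub> f)"
    and diff_hom: "f \<in> dHom A X Y n \<Longrightarrow> Diff A f \<in> dHom A X Y (n + 1)"
    and diff_plus: "\<lbrakk>f \<in> dHom A X Y n; g \<in> dHom A X Y n\<rbrakk>
      \<Longrightarrow> Diff A (dPlus A f g) = dPlus A (Diff A f) (Diff A g)"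
    and diff_scal: "\<lbrakk>a \<in> carrier K; f \<in> dHom A X Y n\<rbrakk>
      \<Longrightarrow> Diff A (dScal A a f) = dScal A a (Diff A f)"
    and diff_diff: "f \<in> dHom A X Y n \<Longrightarrow> Diff A (Diff A f) = dNull A X Y (n + 2)"
    and leibniz: "\<lbrakk>f \<in> dHom A X Y m; g \<in> dHom A Y Z n\<rbrakk>
      \<Longrightarrow> Diff A (g \<bullet>\<^bsub>A\<^esub> f) = dPlus A (Diff A g \<bullet>\<^bsub>A\<^esub> f) (sgn_pow A n (g \<bullet>\<^bsub>A\<^esub> Diff A f))"

definition closed0 :: "('o, 'm, 'k) dg_cat \<Rightarrow> 'o \<Rightarrow> 'o \<Rightarrow> 'm set" where
  "closed0 A X Y = {f \<in> dHom A X Y 0. Diff A f = dNull A X Y 1}"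

text \<open>\<open>s\<close> and \<open>s'\<close> are the mutually inverse closed morphisms \<open>X \<rightarrow> X[1]\<close> and \<open>X[1] \<rightarrow> X\<close> of
  degrees \<open>-1\<close> and \<open>1\<close> which exhibit \<open>Y\<close> as the shift \<open>X[1]\<close>.\<close>

definition is_dg_shift :: "('o, 'm, 'k) dg_cat \<Rightarrow> 'o \<Rightarrow> 'o \<Rightarrow> 'm \<Rightarrow> 'm \<Rightarrow> bool" where
  "is_dg_shift A X Y s s' \<longleftrightarrow> X \<in> dOb A \<and> Y \<in> dOb A \<and> s \<in> dHom A X Y (-1) \<and> s' \<in> dHom A Y X 1 \<and>
     Diff A s = dNull A X Y 0 \<and> Diff A s' = dNull A Y X 2 \<and>
     s' \<bullet>\<^bsub>A\<^esub> s = dIdent A X \<and> s \<bullet>\<^bsub>A\<^esub> s' = dIdent A Y"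

text \<open>\<open>Z\<close> is the cone of the closed morphism \<open>f : X \<rightarrow> Y\<close> of degree \<open>0\<close>: as a graded object it is
  \<open>X[1] \<oplus> Y\<close>, with inclusions \<open>i\<close> (of degree \<open>-1\<close>), \<open>j\<close> and projections \<open>p\<close> (of degree \<open>1\<close>), \<open>q\<close>.  The equations
  \<open>d j = 0\<close>, \<open>d p = 0\<close>, \<open>d i = j f\<close> say that the differential of the sum is twisted by \<open>f\<close>; they
  force \<open>d q = - f p\<close>.\<close>

definition is_dg_cone ::
  "('o, 'm, 'k) dg_cat \<Rightarrow> 'o \<Rightarrow> 'o \<Rightarrow> 'm \<Rightarrow> 'o \<Rightarrow> 'm \<Rightarrow> 'm \<Rightarrow> 'm \<Rightarrow> 'm \<Rightarrow> bool" where
  "is_dg_cone A X Y f Z i j p q \<longleftrightarrow> X \<in> dOb A \<and> Y \<in> dOb A \<and> Z \<in> dOb A \<and> f \<in> closed0 A X Y \<and>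
     i \<in> dHom A X Z (-1) \<and> j \<in> dHom A Y Z 0 \<and> p \<in> dHom A Z X 1 \<and> q \<in> dHom A Z Y 0 \<and>
     p \<bullet>\<^bsub>A\<^esub> i = dIdent A X \<and> q \<bullet>\<^bsub>A\<^esub> j = dIdent A Y \<and>
     q \<bullet>\<^bsub>A\<^esub> i = dNull A X Y (-1) \<and> p \<bullet>\<^bsub>A\<^esub> j = dNull A Y X 1 \<and>
     dPlus A (i \<bullet>\<^bsub>A\<^esub> p) (j \<bullet>\<^bsub>A\<^esub> q) = dIdent A Z \<and>
     Diff A j = dNull A Y Z 1 \<and> Diff A p = dNull A Z X 2 \<and> Diff A i = j \<bullet>\<^bsub>A\<^esub> f"

text \<open>Pretriangulated in the strong sense: shifts in both directions and cones of closed morphisms of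
  degree \<open>0\<close> exist in \<open>A\<close> itself; the cone of an identity is a zero object of the homotopy category.\<close>

locale pretriangulated_dg_category = dg_category K A
  for K :: "('k, 'r) ring_scheme" and A :: "('o, 'm, 'k) dg_cat" +
  assumes dg_nonempty: "dOb A \<noteq> {}"
    and dg_shift_exists: "X \<in> dOb A \<Longrightarrow> \<exists>Y s s'. is_dg_shift A X Y s s'"
    and dg_unshift_exists: "X \<in> dOb A \<Longrightarrow> \<exists>Y s s'. is_dg_shift A Y X s s'"
    and dg_cone_exists: "\<lbrakk>X \<in> dOb A; Y \<in> dOb A; f \<in> closed0 A X Y\<rbrakk>
      \<Longrightarrow> \<exists>Z i j p q. is_dg_cone A X Y f Z i j p q"


section \<open>The homotopy category\<close>

text \<open>The arrows of \<open>H\<^sup>0(A)\<close> are the cosets \<open>f + d (Hom\<^sup>-\<^sup>1)\<close> of closed morphisms \<open>f\<close> of degree \<open>0\<close>.\<close>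

definition cls :: "('o, 'm, 'k) dg_cat \<Rightarrow> 'm \<Rightarrow> 'm set" where
  "cls A f = (\<lambda>h. dPlus A f (Diff A h)) ` dHom A (dDom A f) (dCod A f) (-1)"

definition rep :: "'m set \<Rightarrow> 'm" where
  "rep c = (SOME f. f \<in> c)"

definition dg_shift_of :: "('o, 'm, 'k) dg_cat \<Rightarrow> 'o \<Rightarrow> 'o \<times> 'm \<times> 'm" where
  "dg_shift_of A X = (SOME (Y, s, s'). is_dg_shift A X Y s s')"

definition dg_unshift_of :: "('o, 'm, 'k) dg_cat \<Rightarrow> 'o \<Rightarrow> 'o \<times> 'm \<times> 'm" where
  "dg_unshift_of A X = (SOME (Y, s, s'). is_dg_shift A Y X s s')"

definition H0_shift :: "('o, 'm, 'k) dg_cat \<Rightarrow> ('o, 'm set, 'o, 'm set) ftor" where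
  "H0_shift A = \<lparr>fobj = (\<lambda>X. fst (dg_shift_of A X)),
     farr = (\<lambda>c. let f = rep c; s = fst (snd (dg_shift_of A (dCod A f)));
                   s' = snd (snd (dg_shift_of A (dDom A f))) in cls A (s \<bullet>\<^bsub>A\<^esub> f \<bullet>\<^bsub>A\<^esub> s'))\<rparr>"

definition H0_unshift :: "('o, 'm, 'k) dg_cat \<Rightarrow> ('o, 'm set, 'o, 'm set) ftor" where
  "H0_unshift A = \<lparr>fobj = (\<lambda>X. fst (dg_unshift_of A X)),
     farr = (\<lambda>c. let f = rep c; s = fst (snd (dg_unshift_of A (dDom A f)));
                   s' = snd (snd (dg_unshift_of A (dCod A f))) in cls A (s' \<bullet>\<^bsub>A\<^esub> f \<bullet>\<^bsub>A\<^esub> s))\<rparr>"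

text \<open>The standard triangles \<open>X \<rightarrow> Y \<rightarrow> Cone f \<rightarrow> X[1]\<close>; the last arrow is the projection \<open>p\<close>
  followed by \<open>X \<rightarrow> X[1]\<close>.\<close>

definition cone_triangles :: "('o, 'm, 'k) dg_cat \<Rightarrow> ('m set \<times> 'm set \<times> 'm set) set" where
  "cone_triangles A =
     {(cls A f, cls A j, cls A (fst (snd (dg_shift_of A X)) \<bullet>\<^bsub>A\<^esub> p)) | X Y f Z i j p q.
        is_dg_cone A X Y f Z i j p q}"

definition H0_pre :: "('o, 'm, 'k) dg_cat \<Rightarrow> ('o, 'm set, 'k) tri_cat" where
  "H0_pre A = \<lparr>Ob = dOb A,
     Arr = {cls A f | f X Y. X \<in> dOb A \<and> Y \<in> dOb A \<and> f \<in> closed0 A X Y},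
     Dom = (\<lambda>c. dDom A (rep c)), Cod = (\<lambda>c. dCod A (rep c)),
     Ident = (\<lambda>X. cls A (dIdent A X)), Comp = (\<lambda>c c'. cls A (rep c \<bullet>\<^bsub>A\<^esub> rep c')),
     Null = (\<lambda>X Y. cls A (dNull A X Y 0)), Plus = (\<lambda>c c'. cls A (dPlus A (rep c) (rep c'))),
     Scal = (\<lambda>a c. cls A (dScal A a (rep c))),
     Shift = H0_shift A, Unshift = H0_unshift A, Triangles = {}\<rparr>"

definition H0 :: "('o, 'm, 'k) dg_cat \<Rightarrow> ('o, 'm set, 'k) tri_cat" where
  "H0 A = (H0_pre A)\<lparr>Triangles := iso_closure (H0_pre A) (cone_triangles A)\<rparr>"

text \<open>A triangulated category \<open>D\<close> with a dg enhancement: an exact equivalence \<open>e : H\<^sup>0(A) \<rightarrow> D\<close>.\<close>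

locale enhanced_triangulated_category =
  triangulated_category K D + pretriangulated_dg_category K A
  for K :: "('k, 'r) ring_scheme" and D :: "('o, 'm, 'k) tri_cat"
    and A :: "('a, 'b, 'k) dg_cat" and e :: "('a, 'b set, 'o, 'm) ftor" +
  assumes enhancement: "exact_equivalence K (H0 A) D e"


section \<open>Dg lifts and functorial cones\<close>

definition dg_functor :: "('k, 'r) ring_scheme \<Rightarrow> ('a, 'b, 'k) dg_cat \<Rightarrow> ('c, 'd, 'k) dg_cat
  \<Rightarrow> ('a, 'b, 'c, 'd) ftor \<Rightarrow> bool" where
  "dg_functor K A B F \<longleftrightarrow>
     (\<forall>X \<in> dOb A. fobj F X \<in> dOb B \<and> farr F (dIdent A X) = dIdent B (fobj F X)) \<and>
     (\<forall>X \<in> dOb A. \<forall>Y \<in> dOb A. \<forall>n. \<forall>f \<in> dHom A X Y n.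
        farr F f \<in> dHom B (fobj F X) (fobj F Y) n \<and> farr F (Diff A f) = Diff B (farr F f) \<and>
        (\<forall>g \<in> dHom A X Y n. farr F (dPlus A f g) = dPlus B (farr F f) (farr F g)) \<and>
        (\<forall>a \<in> carrier K. farr F (dScal A a f) = dScal B a (farr F f)) \<and>
        (\<forall>Z \<in> dOb A. \<forall>m. \<forall>g \<in> dHom A Y Z m. farr F (g \<bullet>\<^bsub>A\<^esub> f) = farr F g \<bullet>\<^bsub>B\<^esub> farr F f))"

definition H0_ftor :: "('c, 'd, 'k) dg_cat \<Rightarrow> ('a, 'b, 'c, 'd) ftor
  \<Rightarrow> ('a, 'b set, 'c, 'd set) ftor" where
  "H0_ftor B F = \<lparr>fobj = fobj F, farr = (\<lambda>c. cls B (farr F (rep c)))\<rparr>"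

text \<open>A dg lift of a functor \<open>\<Phi> : C \<rightarrow> D\<close> is a dg functor \<open>F : A \<rightarrow> B\<close> between the enhancements
  \<open>(A, e)\<close> of \<open>C\<close> and \<open>(B, e')\<close> of \<open>D\<close> together with a natural isomorphism
  \<open>\<theta> : e' \<circ> H\<^sup>0(F) \<rightarrow> \<Phi> \<circ> e\<close>.\<close>

definition is_dg_lift :: "('k, 'r) ring_scheme
  \<Rightarrow> ('a, 'b, 'k) dg_cat \<Rightarrow> ('a, 'b set, 'o, 'm) ftor
  \<Rightarrow> ('p, 'n, 'k) tri_cat \<Rightarrow> ('c, 'd, 'k) dg_cat \<Rightarrow> ('c, 'd set, 'p, 'n) ftor
  \<Rightarrow> ('o, 'm, 'p, 'n) ftor \<Rightarrow> ('a, 'b, 'c, 'd) ftor \<Rightarrow> ('a \<Rightarrow> 'n) \<Rightarrow> bool" where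
  "is_dg_lift K A e D B e' \<Phi> F \<theta> \<longleftrightarrow> dg_functor K A B F \<and>
     nat_iso (H0 A) D (e' \<odot>\<^sub>F H0_ftor B F) (\<Phi> \<odot>\<^sub>F e) \<theta>"

definition has_dg_lift :: "('k, 'r) ring_scheme
  \<Rightarrow> ('a, 'b, 'k) dg_cat \<Rightarrow> ('a, 'b set, 'o, 'm) ftor
  \<Rightarrow> ('p, 'n, 'k) tri_cat \<Rightarrow> ('c, 'd, 'k) dg_cat \<Rightarrow> ('c, 'd set, 'p, 'n) ftor
  \<Rightarrow> ('o, 'm, 'p, 'n) ftor \<Rightarrow> bool" where
  "has_dg_lift K A e D B e' \<Phi> \<longleftrightarrow> (\<exists>F \<theta>. is_dg_lift K A e D B e' \<Phi> F \<theta>)"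

definition dg_nat_trans :: "('a, 'b, 'k) dg_cat \<Rightarrow> ('c, 'd, 'k) dg_cat
  \<Rightarrow> ('a, 'b, 'c, 'd) ftor \<Rightarrow> ('a, 'b, 'c, 'd) ftor \<Rightarrow> ('a \<Rightarrow> 'd) \<Rightarrow> bool" where
  "dg_nat_trans A B F G \<alpha> \<longleftrightarrow>
     (\<forall>X \<in> dOb A. \<alpha> X \<in> closed0 B (fobj F X) (fobj G X)) \<and>
     (\<forall>f \<in> dArr A. farr G f \<bullet>\<^bsub>B\<^esub> \<alpha> (dDom A f) = \<alpha> (dCod A f) \<bullet>\<^bsub>B\<^esub> farr F f)"

text \<open>\<open>Q\<close> is the dg functor \<open>Cone \<alpha>\<close>: objectwise the cone of \<open>\<alpha>\<^sub>X\<close>, and diagonal on arrows with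
  respect to \<open>F(X)[1] \<oplus> G(X)\<close>.  The sign is the one of the shift functor on morphisms of
  degree \<open>n\<close>.\<close>

definition is_dg_cone_functor :: "('a, 'b, 'k) dg_cat \<Rightarrow> ('c, 'd, 'k) dg_cat
  \<Rightarrow> ('a, 'b, 'c, 'd) ftor \<Rightarrow> ('a, 'b, 'c, 'd) ftor \<Rightarrow> ('a \<Rightarrow> 'd)
  \<Rightarrow> ('a, 'b, 'c, 'd) ftor \<Rightarrow> bool" where
  "is_dg_cone_functor A B F G \<alpha> Q \<longleftrightarrow> (\<exists>i j p q.
     (\<forall>X \<in> dOb A. is_dg_cone B (fobj F X) (fobj G X) (\<alpha> X) (fobj Q X) (i X) (j X) (p X) (q X)) \<and>
     (\<forall>X \<in> dOb A. \<forall>Y \<in> dOb A. \<forall>n. \<forall>f \<in> dHom A X Y n.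
        farr Q f = dPlus B (sgn_pow B n (i Y \<bullet>\<^bsub>B\<^esub> farr F f \<bullet>\<^bsub>B\<^esub> p X))
                           (j Y \<bullet>\<^bsub>B\<^esub> farr G f \<bullet>\<^bsub>B\<^esub> q X)))"

text \<open>\<open>T\<close> is the functorial cone of a natural transformation \<open>\<tau> : \<Phi> \<rightarrow> \<Psi>\<close> of endofunctors of \<open>D\<close>: there are
  dg lifts \<open>F, G\<close> of \<open>\<Phi>, \<Psi>\<close> and a closed dg natural transformation \<open>\<alpha> : F \<rightarrow> G\<close> inducing \<open>\<tau>\<close>, and
  \<open>Cone \<alpha>\<close> lifts \<open>T\<close>.\<close>

definition is_functorial_cone :: "('k, 'r) ring_scheme \<Rightarrow> ('o, 'm, 'k) tri_cat
  \<Rightarrow> ('a, 'b, 'k) dg_cat \<Rightarrow> ('a, 'b set, 'o, 'm) ftor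
  \<Rightarrow> ('o, 'm, 'o, 'm) ftor \<Rightarrow> ('o, 'm, 'o, 'm) ftor \<Rightarrow> ('o \<Rightarrow> 'm)
  \<Rightarrow> ('o, 'm, 'o, 'm) ftor \<Rightarrow> bool" where
  "is_functorial_cone K D A e \<Phi> \<Psi> \<tau> T \<longleftrightarrow> (\<exists>F \<theta>\<^sub>F G \<theta>\<^sub>G \<alpha> Q \<theta>\<^sub>Q.
     is_dg_lift K A e D A e \<Phi> F \<theta>\<^sub>F \<and> is_dg_lift K A e D A e \<Psi> G \<theta>\<^sub>G \<and>
     dg_nat_trans A A F G \<alpha> \<and>
     (\<forall>X \<in> dOb A. \<theta>\<^sub>G X \<cdot>\<^bsub>D\<^esub> farr e (cls A (\<alpha> X)) = \<tau> (fobj e X) \<cdot>\<^bsub>D\<^esub> \<theta>\<^sub>F X) \<and>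
     is_dg_cone_functor A A F G \<alpha> Q \<and> is_dg_lift K A e D A e T Q \<theta>\<^sub>Q)"


section \<open>Spherical functors\<close>

text \<open>\<open>S : C \<rightarrow> D\<close> is spherical with right adjoint \<open>R\<close> (unit \<open>\<eta>\<close>, counit \<open>\<epsilon>\<close>), left adjoint \<open>L\<close>,
  twist \<open>T\<close> and cotwist \<open>W\<close>; \<open>(A, a)\<close> and \<open>(B, b)\<close> are the dg enhancements of \<open>C\<close> and \<open>D\<close>.\<close>

locale spherical_functor =
  dom_cat: enhanced_triangulated_category K C A a + cod_cat: enhanced_triangulated_category K D B b
  for K :: "('k, 'r) ring_scheme"
    and C :: "('o, 'm, 'k) tri_cat"
    and A :: "('a1, 'a2, 'k) dg_cat" and a :: "('a1, 'a2 set, 'o, 'm) ftor"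
    and D :: "('p, 'n, 'k) tri_cat"
    and B :: "('b1, 'b2, 'k) dg_cat" and b :: "('b1, 'b2 set, 'p, 'n) ftor" +
  fixes S :: "('o, 'm, 'p, 'n) ftor" and R L :: "('p, 'n, 'o, 'm) ftor"
    and \<eta> :: "'o \<Rightarrow> 'm" and \<epsilon> :: "'p \<Rightarrow> 'n"
    and T :: "('p, 'n, 'p, 'n) ftor" and W :: "('o, 'm, 'o, 'm) ftor"
  assumes S_exact: "exact_functor K C D S" and S_lift: "has_dg_lift K A a D B b S"
    and R_exact: "exact_functor K D C R" and R_lift: "has_dg_lift K B b C A a R"
    and L_exact: "exact_functor K D C L" and L_lift: "has_dg_lift K B b C A a L"
    and right_adjoint: "adjunction C D S R \<eta> \<epsilon>"
    and left_adjoint: "\<exists>\<eta>' \<epsilon>'. adjunction D C L S \<eta>' \<epsilon>'"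
    and twist: "is_functorial_cone K D B b (S \<odot>\<^sub>F R) id_ftor \<epsilon> T"
    and twist_equivalence: "exact_equivalence K D D T"
    and cotwist: "\<exists>Q. is_functorial_cone K C A a id_ftor (R \<odot>\<^sub>F S) \<eta> Q \<and>
                     exact_functor K C C Q \<and> naturally_isomorphic C C W (ftor_shift C Q (-1))"
    and cotwist_equivalence: "exact_equivalence K C C W"
    and R_iso_L_twist: "naturally_isomorphic D C R (ftor_shift C (L \<odot>\<^sub>F T) (-1))"
    and R_iso_cotwist_L: "naturally_isomorphic D C R (ftor_shift C (W \<odot>\<^sub>F L) 1)"

end

theory Submission
  imports Defs
begin

text \<open>
  An exact functor does not increase complexity, and complexity is submultiplicative, so the growth
  rate of \<open>\<delta>\<^sub>t(G, \<Phi>\<^sup>nG)\<close> exists by Fekete's lemma (it is \<open>-\<infinity>\<close> as soon as one term vanishes) and is the same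
  for all split-generators.  The two isomorphisms relating \<open>R\<close> and \<open>L\<close> give \<open>R T \<cong> W[2] R\<close>.  If \<open>R H\<close> is a
  split-generator, enlarge \<open>H\<close> to a split-generator \<open>G\<close> of \<open>D\<close>; applying \<open>R\<close> to \<open>T\<^sup>nG\<close> compares the growth
  rates of \<open>T\<close> and \<open>W[2]\<close>.  If \<open>S R E \<cong> 0\<close> then \<open>T\<close> fixes \<open>E\<close>, so the constant sequence \<open>\<delta>\<^sub>t(G, E)\<close> bounds
  the one of \<open>T\<close> from below once \<open>E\<close> is a summand of \<open>G\<close>.
\<close>


section \<open>Linear categories\<close>

text \<open>Complexity and entropy see only isomorphism classes of objects and the existence of
  triangles. After the basic lemmas, morphisms, signs and natural transformations are therefore
  forgotten: \<open>distinguished\<close> and \<open>exact_on_objects\<close> keep just what towers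
  need. The dg enhancement enters at a single point, to see that the functorial cone of the counit,
  evaluated at \<open>X\<close>, fits into a triangle \<open>S R X, X, T X\<close>. The main
  obstacle is submultiplicativity. An object is built only up to a direct summand, so replacing each
  piece \<open>F[m]\<close> of a tower by a tower for \<open>F\<close> needs complements of
  summands, which come from split triangles, and concatenation of towers along a triangle, which
  comes from the octahedral axiom. The same concatenation shows that the objects built from
  \<open>E\<close> form a thick subcategory, so a split-generator builds everything and all
  complexities from it are finite. Complexity is an infimum and may vanish on nonzero objects; this
  is why the argument for a kernel object \<open>E\<close> starts from a generator with nonzero
  complexity to \<open>E\<close>.\<close>

definition retract_of :: "('o, 'm, 'k, 'z) linear_cat_scheme \<Rightarrow> 'o \<Rightarrow> 'o \<Rightarrow> bool" where
  "retract_of C X Y \<longleftrightarrow> (\<exists>i \<in> Hom C X Y. \<exists>p \<in> Hom C Y X. p \<cdot>\<^bsub>C\<^esub> i = Ident C X)"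

context linear_category
begin

lemma hom_objects:
  assumes "f \<in> Hom C X Y"
  shows "X \<in> Ob C" "Y \<in> Ob C"
  using assms arrow_ends unfolding Hom_def by auto

lemma dom_cod:
  assumes "f \<in> Hom C X Y"
  shows "Dom C f = X" "Cod C f = Y" "f \<in> Arr C"
  using assms unfolding Hom_def by auto

section \<open>Additive structure of the hom-sets\<close>

lemma hom_group: "X \<in> Ob C \<Longrightarrow> Y \<in> Ob C \<Longrightarrow> abelian_group (hom_space C X Y)"
  by (rule Module.module.axioms(2)[OF hom_module])

lemma null_hom: "X \<in> Ob C \<Longrightarrow> Y \<in> Ob C \<Longrightarrow> Null C X Y \<in> Hom C X Y"
  using abelian_monoid.zero_closed[OF abelian_group.axioms(1)[OF hom_group], of X Y]
  by (simp add: hom_space_def)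

lemma plus_hom: "f \<in> Hom C X Y \<Longrightarrow> g \<in> Hom C X Y \<Longrightarrow> Plus C f g \<in> Hom C X Y"
  using abelian_monoid.a_closed[OF abelian_group.axioms(1)[OF hom_group], of X Y f g] hom_objects
  by (fastforce simp add: hom_space_def)

lemma plus_assoc: "f \<in> Hom C X Y \<Longrightarrow> g \<in> Hom C X Y \<Longrightarrow> h \<in> Hom C X Y
   \<Longrightarrow> Plus C (Plus C f g) h = Plus C f (Plus C g h)"
  using abelian_monoid.a_assoc[OF abelian_group.axioms(1)[OF hom_group], of X Y f g h] hom_objects
  by (fastforce simp add: hom_space_def)

lemma plus_commute: "f \<in> Hom C X Y \<Longrightarrow> g \<in> Hom C X Y \<Longrightarrow> Plus C f g = Plus C g f"
  using abelian_monoid.a_comm[OF abelian_group.axioms(1)[OF hom_group], of X Y f g] hom_objects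
  by (fastforce simp add: hom_space_def)

lemma null_plus: "f \<in> Hom C X Y \<Longrightarrow> Plus C (Null C X Y) f = f"
  using abelian_monoid.l_zero[OF abelian_group.axioms(1)[OF hom_group], of X Y f] hom_objects
  by (fastforce simp add: hom_space_def)

lemma plus_null: "f \<in> Hom C X Y \<Longrightarrow> Plus C f (Null C X Y) = f"
  by (metis null_plus plus_commute null_hom hom_objects)

lemma neg_hom: "f \<in> Hom C X Y \<Longrightarrow> neg C f \<in> Hom C X Y"
  using abelian_group.a_inv_closed[OF hom_group, of X Y f] hom_objects[of f X Y] dom_cod[of f X Y]
  by (simp add: neg_def hom_space_def)

lemma plus_neg: "f \<in> Hom C X Y \<Longrightarrow> Plus C f (neg C f) = Null C X Y"
  using abelian_group.r_neg[OF hom_group, of X Y f] hom_objects[of f X Y] dom_cod[of f X Y]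
  by (simp add: neg_def hom_space_def)

lemma plus_left_cancel:
  assumes "f \<in> Hom C X Y" "g \<in> Hom C X Y" "h \<in> Hom C X Y" "Plus C f g = Plus C f h"
  shows "g = h"
proof -
  have "Plus C (Plus C (neg C f) f) g = Plus C (Plus C (neg C f) f) h"
    using assms by (simp add: plus_assoc[OF neg_hom, where X=X and Y=Y])
  moreover have "Plus C (neg C f) f = Null C X Y"
    using plus_commute[OF neg_hom] plus_neg assms(1) by metis
  ultimately show ?thesis
    using assms by (simp add: null_plus)
qed

text \<open>An additive map sends zero to a morphism equal to its own double, which cancellation
  identifies with zero. Preservation of zero by composition and by functors is derived this
  way.\<close>

lemma idem_null:
  assumes "f \<in> Hom C X Y" "Plus C f f = f"
  shows "f = Null C X Y"
  using assms plus_left_cancel[of f X Y f "Null C X Y"] plus_null null_hom hom_objects by metis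

lemma neg_unique:
  assumes "f \<in> Hom C X Y" "g \<in> Hom C X Y" "Plus C f g = Null C X Y"
  shows "g = neg C f"
  using plus_left_cancel[OF assms(1,2) neg_hom[OF assms(1)]] plus_neg[OF assms(1)] assms(3) by simp

lemma neg_neg: "f \<in> Hom C X Y \<Longrightarrow> neg C (neg C f) = f"
  using neg_unique[OF neg_hom, of f X Y f] plus_commute[OF neg_hom, of f X Y f] plus_neg by simp

lemma neg_null: "X \<in> Ob C \<Longrightarrow> Y \<in> Ob C \<Longrightarrow> neg C (Null C X Y) = Null C X Y"
  using neg_unique[of "Null C X Y" X Y "Null C X Y"] null_hom null_plus by simp

lemma comp_null: "g \<in> Hom C Y Z \<Longrightarrow> X \<in> Ob C \<Longrightarrow> g \<cdot>\<^bsub>C\<^esub> Null C X Y = Null C X Z"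
  using idem_null[OF comp_hom[OF null_hom], of X Y g Z] comp_plus_right[OF null_hom null_hom, of X Y g Z]
    null_plus[OF null_hom, of X Y] hom_objects(1)[of g Y Z] by simp

lemma null_comp: "f \<in> Hom C X Y \<Longrightarrow> Z \<in> Ob C \<Longrightarrow> Null C Y Z \<cdot>\<^bsub>C\<^esub> f = Null C X Z"
  using idem_null[OF comp_hom[OF _ null_hom], of f X Y Z] comp_plus_left[OF _ null_hom null_hom, of f X Y Z]
    null_plus[OF null_hom, of Y Z] hom_objects(2)[of f X Y] by simp

lemma neg_comp:
  assumes "f \<in> Hom C X Y" "g \<in> Hom C Y Z"
  shows "neg C g \<cdot>\<^bsub>C\<^esub> f = neg C (g \<cdot>\<^bsub>C\<^esub> f)"
proof (rule neg_unique)
  show "Plus C (g \<cdot>\<^bsub>C\<^esub> f) (neg C g \<cdot>\<^bsub>C\<^esub> f) = Null C X Z"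
    using comp_plus_left[OF assms neg_hom[OF assms(2)]] plus_neg[OF assms(2)]
      null_comp[OF assms(1) hom_objects(2)[OF assms(2)]] by simp
qed (use assms in \<open>auto intro: comp_hom neg_hom\<close>)

lemma comp_neg:
  assumes "f \<in> Hom C X Y" "g \<in> Hom C Y Z"
  shows "g \<cdot>\<^bsub>C\<^esub> neg C f = neg C (g \<cdot>\<^bsub>C\<^esub> f)"
proof (rule neg_unique)
  show "Plus C (g \<cdot>\<^bsub>C\<^esub> f) (g \<cdot>\<^bsub>C\<^esub> neg C f) = Null C X Z"
    using comp_plus_right[OF assms(1) neg_hom[OF assms(1)] assms(2)] plus_neg[OF assms(1)]
      comp_null[OF assms(2) hom_objects(1)[OF assms(1)]] by simp
qed (use assms in \<open>auto intro: comp_hom neg_hom\<close>)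

lemma eq_if_plus_neg_null:
  assumes "f \<in> Hom C X Y" "g \<in> Hom C X Y" "Plus C f (neg C g) = Null C X Y"
  shows "f = g"
  using neg_unique[OF neg_hom[OF assms(2)] assms(1)] plus_commute[OF assms(1) neg_hom[OF assms(2)]]
    neg_neg[OF assms(2)] assms(3) by simp

section \<open>Isomorphisms, retracts and zero objects\<close>

lemma isomorphic_iff: "isomorphic C X Y \<longleftrightarrow> (\<exists>f \<in> Hom C X Y. \<exists>g \<in> Hom C Y X.
    g \<cdot>\<^bsub>C\<^esub> f = Ident C X \<and> f \<cdot>\<^bsub>C\<^esub> g = Ident C Y)"
  unfolding isomorphic_def is_iso_def Hom_def by auto

lemma is_isoI:
  assumes "f \<in> Hom C X Y" "g \<in> Hom C Y X" "g \<cdot>\<^bsub>C\<^esub> f = Ident C X" "f \<cdot>\<^bsub>C\<^esub> g = Ident C Y"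
  shows "is_iso C f"
  using assms unfolding is_iso_def Hom_def by auto

lemma is_isoE:
  assumes "is_iso C f" "f \<in> Hom C X Y"
  obtains g where "g \<in> Hom C Y X" "g \<cdot>\<^bsub>C\<^esub> f = Ident C X" "f \<cdot>\<^bsub>C\<^esub> g = Ident C Y"
  using assms unfolding is_iso_def Hom_def by auto

lemma is_iso_ident: "X \<in> Ob C \<Longrightarrow> is_iso C (Ident C X)"
  by (meson ident_hom ident_left is_isoI)

lemma isomorphic_refl: "X \<in> Ob C \<Longrightarrow> isomorphic C X X"
  using ident_hom is_iso_ident unfolding isomorphic_def by blast

lemma isomorphic_sym: "isomorphic C X Y \<Longrightarrow> isomorphic C Y X"
  unfolding isomorphic_iff by blast

lemma isomorphic_objects:
  assumes "isomorphic C X Y"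
  shows "X \<in> Ob C" "Y \<in> Ob C"
  using assms hom_objects unfolding isomorphic_def by blast+

lemma comp_middle_cancel:
  assumes "a \<in> Hom C W X" "b \<in> Hom C X Y" "c \<in> Hom C Y X" "d \<in> Hom C X Z" "c \<cdot>\<^bsub>C\<^esub> b = Ident C X"
  shows "(d \<cdot>\<^bsub>C\<^esub> c) \<cdot>\<^bsub>C\<^esub> (b \<cdot>\<^bsub>C\<^esub> a) = d \<cdot>\<^bsub>C\<^esub> a"
proof -
  have "c \<cdot>\<^bsub>C\<^esub> (b \<cdot>\<^bsub>C\<^esub> a) = a"
    using assms comp_assoc[of a W X b Y c X] ident_left[of a W X] by simp
  then show ?thesis
    using assms comp_assoc[of "b \<cdot>\<^bsub>C\<^esub> a" W Y c X d Z] comp_hom[of a W X b Y] by simp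
qed

lemma retract_trans:
  assumes "retract_of C X Y" "retract_of C Y Z"
  shows "retract_of C X Z"
proof -
  obtain i p where ip: "i \<in> Hom C X Y" "p \<in> Hom C Y X" "p \<cdot>\<^bsub>C\<^esub> i = Ident C X"
    using assms(1) unfolding retract_of_def by blast
  obtain j q where jq: "j \<in> Hom C Y Z" "q \<in> Hom C Z Y" "q \<cdot>\<^bsub>C\<^esub> j = Ident C Y"
    using assms(2) unfolding retract_of_def by blast
  have "(p \<cdot>\<^bsub>C\<^esub> q) \<cdot>\<^bsub>C\<^esub> (j \<cdot>\<^bsub>C\<^esub> i) = Ident C X"
    using comp_middle_cancel[OF ip(1) jq(1,2) ip(2) jq(3)] ip(3) by simp
  then show ?thesis
    using comp_hom ip jq unfolding retract_of_def by blast
qed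

lemma isomorphic_trans:
  assumes "isomorphic C X Y" "isomorphic C Y Z"
  shows "isomorphic C X Z"
proof -
  obtain i p where ip: "i \<in> Hom C X Y" "p \<in> Hom C Y X" "p \<cdot>\<^bsub>C\<^esub> i = Ident C X" "i \<cdot>\<^bsub>C\<^esub> p = Ident C Y"
    using assms(1) unfolding isomorphic_iff by blast
  obtain j q where jq: "j \<in> Hom C Y Z" "q \<in> Hom C Z Y" "q \<cdot>\<^bsub>C\<^esub> j = Ident C Y" "j \<cdot>\<^bsub>C\<^esub> q = Ident C Z"
    using assms(2) unfolding isomorphic_iff by blast
  have "(p \<cdot>\<^bsub>C\<^esub> q) \<cdot>\<^bsub>C\<^esub> (j \<cdot>\<^bsub>C\<^esub> i) = Ident C X" "(j \<cdot>\<^bsub>C\<^esub> i) \<cdot>\<^bsub>C\<^esub> (p \<cdot>\<^bsub>C\<^esub> q) = Ident C Z"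
    using comp_middle_cancel[OF ip(1) jq(1,2) ip(2) jq(3)] ip(3)
      comp_middle_cancel[OF jq(2) ip(2,1) jq(1) ip(4)] jq(4) by simp_all
  then show ?thesis
    using comp_hom ip jq unfolding isomorphic_iff by blast
qed

lemma isomorphic_retract: "isomorphic C X Y \<Longrightarrow> retract_of C X Y"
  unfolding isomorphic_iff retract_of_def by blast

lemma retract_objects:
  assumes "retract_of C X Y"
  shows "X \<in> Ob C" "Y \<in> Ob C"
  using assms hom_objects unfolding retract_of_def by blast+

lemma direct_sum_retract: "is_direct_sum C X Y Z \<Longrightarrow> retract_of C X Z"
  unfolding is_direct_sum_def retract_of_def by blast

lemma is_zero_iff: "is_zero C X \<longleftrightarrow> X \<in> Ob C \<and> Ident C X = Null C X X"
proof
  assume "is_zero C X"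
  then show "X \<in> Ob C \<and> Ident C X = Null C X X"
    unfolding is_zero_def using ident_hom null_hom by blast
next
  assume X: "X \<in> Ob C \<and> Ident C X = Null C X X"
  have "f = Null C X Y" if "f \<in> Hom C X Y" for f Y
    using that X comp_null ident_right by metis
  moreover have "f = Null C Y X" if "f \<in> Hom C Y X" for f Y
    using that X null_comp ident_left by metis
  ultimately show "is_zero C X"
    using X null_hom unfolding is_zero_def by metis
qed

lemma zero_object: "is_zero C N \<Longrightarrow> N \<in> Ob C"
  unfolding is_zero_def by blast

lemma hom_from_zero: "is_zero C N \<Longrightarrow> f \<in> Hom C N X \<Longrightarrow> f = Null C N X"
  unfolding is_zero_def using null_hom hom_objects by metis

lemma hom_to_zero: "is_zero C N \<Longrightarrow> f \<in> Hom C X N \<Longrightarrow> f = Null C X N"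
  unfolding is_zero_def using null_hom hom_objects by metis

lemma retract_zero:
  assumes "retract_of C X N" "is_zero C N"
  shows "is_zero C X"
proof -
  obtain i p where ip: "i \<in> Hom C X N" "p \<in> Hom C N X" "p \<cdot>\<^bsub>C\<^esub> i = Ident C X"
    using assms(1) unfolding retract_of_def by blast
  then show ?thesis
    using hom_to_zero[OF assms(2) ip(1)] comp_null[OF ip(2) hom_objects(1)[OF ip(1)]]
      hom_objects(1)[OF ip(1)] is_zero_iff by simp
qed

section \<open>Direct sums\<close>

lemma direct_sumI:
  assumes "i \<in> Hom C X Z" "j \<in> Hom C Y Z" "p \<in> Hom C Z X" "q \<in> Hom C Z Y"
    "p \<cdot>\<^bsub>C\<^esub> i = Ident C X" "q \<cdot>\<^bsub>C\<^esub> j = Ident C Y" "q \<cdot>\<^bsub>C\<^esub> i = Null C X Y" "p \<cdot>\<^bsub>C\<^esub> j = Null C Y X"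
    "Plus C (i \<cdot>\<^bsub>C\<^esub> p) (j \<cdot>\<^bsub>C\<^esub> q) = Ident C Z"
  shows "is_direct_sum C X Y Z"
  unfolding is_direct_sum_def using assms hom_objects[OF assms(1)] hom_objects[OF assms(2)] by blast

lemma direct_sumE:
  assumes "is_direct_sum C X Y Z"
  obtains i j p q where "i \<in> Hom C X Z" "j \<in> Hom C Y Z" "p \<in> Hom C Z X" "q \<in> Hom C Z Y"
    "p \<cdot>\<^bsub>C\<^esub> i = Ident C X" "q \<cdot>\<^bsub>C\<^esub> j = Ident C Y" "q \<cdot>\<^bsub>C\<^esub> i = Null C X Y" "p \<cdot>\<^bsub>C\<^esub> j = Null C Y X"
    "Plus C (i \<cdot>\<^bsub>C\<^esub> p) (j \<cdot>\<^bsub>C\<^esub> q) = Ident C Z"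
  using assms unfolding is_direct_sum_def by blast

lemma direct_sum_objects:
  assumes "is_direct_sum C X Y Z"
  shows "X \<in> Ob C" "Y \<in> Ob C" "Z \<in> Ob C"
  using assms unfolding is_direct_sum_def by blast+

lemma direct_sum_commute:
  assumes "is_direct_sum C X Y Z"
  shows "is_direct_sum C Y X Z"
proof -
  obtain i j p q where "X \<in> Ob C" "Y \<in> Ob C" "Z \<in> Ob C"
    "i \<in> Hom C X Z" "j \<in> Hom C Y Z" "p \<in> Hom C Z X" "q \<in> Hom C Z Y"
    "p \<cdot>\<^bsub>C\<^esub> i = Ident C X" "q \<cdot>\<^bsub>C\<^esub> j = Ident C Y" "q \<cdot>\<^bsub>C\<^esub> i = Null C X Y" "p \<cdot>\<^bsub>C\<^esub> j = Null C Y X"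
    "Plus C (i \<cdot>\<^bsub>C\<^esub> p) (j \<cdot>\<^bsub>C\<^esub> q) = Ident C Z"
    using assms unfolding is_direct_sum_def by blast
  moreover from this have "Plus C (j \<cdot>\<^bsub>C\<^esub> q) (i \<cdot>\<^bsub>C\<^esub> p) = Ident C Z"
    using plus_commute[OF comp_hom comp_hom] by simp
  ultimately show ?thesis
    unfolding is_direct_sum_def by blast
qed

lemma direct_sum_iso_left:
  assumes "is_direct_sum C X Y Z" "isomorphic C X X'"
  shows "is_direct_sum C X' Y Z"
proof -
  obtain i j p q where s: "X \<in> Ob C" "Y \<in> Ob C" "Z \<in> Ob C"
    "i \<in> Hom C X Z" "j \<in> Hom C Y Z" "p \<in> Hom C Z X" "q \<in> Hom C Z Y"
    "p \<cdot>\<^bsub>C\<^esub> i = Ident C X" "q \<cdot>\<^bsub>C\<^esub> j = Ident C Y" "q \<cdot>\<^bsub>C\<^esub> i = Null C X Y" "p \<cdot>\<^bsub>C\<^esub> j = Null C Y X"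
    "Plus C (i \<cdot>\<^bsub>C\<^esub> p) (j \<cdot>\<^bsub>C\<^esub> q) = Ident C Z"
    using assms unfolding is_direct_sum_def by blast
  obtain u v where uv: "u \<in> Hom C X X'" "v \<in> Hom C X' X" "v \<cdot>\<^bsub>C\<^esub> u = Ident C X" "u \<cdot>\<^bsub>C\<^esub> v = Ident C X'"
    using assms(2) unfolding isomorphic_iff by blast
  have "(u \<cdot>\<^bsub>C\<^esub> p) \<cdot>\<^bsub>C\<^esub> (i \<cdot>\<^bsub>C\<^esub> v) = Ident C X'"
    using comp_middle_cancel[OF uv(2) s(4,6) uv(1) s(8)] uv(4) by simp
  moreover have "(i \<cdot>\<^bsub>C\<^esub> v) \<cdot>\<^bsub>C\<^esub> (u \<cdot>\<^bsub>C\<^esub> p) = i \<cdot>\<^bsub>C\<^esub> p"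
    using comp_middle_cancel[OF s(6) uv(1,2) s(4) uv(3)] .
  moreover have "q \<cdot>\<^bsub>C\<^esub> (i \<cdot>\<^bsub>C\<^esub> v) = Null C X' Y"
    using comp_assoc[OF uv(2) s(4,7)] null_comp[OF uv(2) s(2)] s(10) by simp
  moreover have "(u \<cdot>\<^bsub>C\<^esub> p) \<cdot>\<^bsub>C\<^esub> j = Null C Y X'"
    using comp_assoc[OF s(5,6) uv(1)] comp_null[OF uv(1) s(2)] s(11) by simp
  moreover have "i \<cdot>\<^bsub>C\<^esub> v \<in> Hom C X' Z" "u \<cdot>\<^bsub>C\<^esub> p \<in> Hom C Z X'"
    using s uv comp_hom by blast+
  ultimately show ?thesis
    using direct_sumI[of "i \<cdot>\<^bsub>C\<^esub> v" X' Z j Y "u \<cdot>\<^bsub>C\<^esub> p" q] s(5,7,9,12) by simp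
qed

lemma direct_sum_iso_right:
  "is_direct_sum C X Y Z \<Longrightarrow> isomorphic C Y Y' \<Longrightarrow> is_direct_sum C X Y' Z"
  using direct_sum_commute direct_sum_iso_left by blast

lemma direct_sum_unique:
  assumes "is_direct_sum C X Y Z" "is_direct_sum C X Y Z'"
  shows "isomorphic C Z Z'"
proof -
  \<comment> \<open>Matrix product of the two comparison maps: the diagonal terms add up to the
    identity, the mixed terms vanish. \<open>Z\<close> and \<open>Z'\<close> are generalised so that
    the same computation with exchanged roles gives the other composite.\<close>
  have inv: "Plus C (i' \<cdot>\<^bsub>C\<^esub> p) (j' \<cdot>\<^bsub>C\<^esub> q) \<cdot>\<^bsub>C\<^esub> Plus C (i \<cdot>\<^bsub>C\<^esub> p') (j \<cdot>\<^bsub>C\<^esub> q') = Ident C Z'"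
    if "X \<in> Ob C" "Y \<in> Ob C" and h: "i \<in> Hom C X Z" "j \<in> Hom C Y Z" "p \<in> Hom C Z X" "q \<in> Hom C Z Y"
      "p \<cdot>\<^bsub>C\<^esub> i = Ident C X" "q \<cdot>\<^bsub>C\<^esub> j = Ident C Y" "q \<cdot>\<^bsub>C\<^esub> i = Null C X Y" "p \<cdot>\<^bsub>C\<^esub> j = Null C Y X"
      "i' \<in> Hom C X Z'" "j' \<in> Hom C Y Z'" "p' \<in> Hom C Z' X" "q' \<in> Hom C Z' Y"
      "Plus C (i' \<cdot>\<^bsub>C\<^esub> p') (j' \<cdot>\<^bsub>C\<^esub> q') = Ident C Z'"
    for i j p q i' j' p' q' Z Z'
  proof -
    have t: "i' \<cdot>\<^bsub>C\<^esub> p \<in> Hom C Z Z'" "j' \<cdot>\<^bsub>C\<^esub> q \<in> Hom C Z Z'"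
      "i \<cdot>\<^bsub>C\<^esub> p' \<in> Hom C Z' Z" "j \<cdot>\<^bsub>C\<^esub> q' \<in> Hom C Z' Z" "i' \<cdot>\<^bsub>C\<^esub> p' \<in> Hom C Z' Z'" "j' \<cdot>\<^bsub>C\<^esub> q' \<in> Hom C Z' Z'"
      using h comp_hom by blast+
    have "(i' \<cdot>\<^bsub>C\<^esub> p) \<cdot>\<^bsub>C\<^esub> (i \<cdot>\<^bsub>C\<^esub> p') = i' \<cdot>\<^bsub>C\<^esub> p'" "(j' \<cdot>\<^bsub>C\<^esub> q) \<cdot>\<^bsub>C\<^esub> (j \<cdot>\<^bsub>C\<^esub> q') = j' \<cdot>\<^bsub>C\<^esub> q'"
      using comp_middle_cancel h by blast+
    moreover have "(i' \<cdot>\<^bsub>C\<^esub> p) \<cdot>\<^bsub>C\<^esub> (j \<cdot>\<^bsub>C\<^esub> q') = Null C Z' Z'"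
    proof -
      have "p \<cdot>\<^bsub>C\<^esub> (j \<cdot>\<^bsub>C\<^esub> q') = Null C Z' X"
        using comp_assoc[OF h(12,2,3)] null_comp[OF h(12) that(1)] h(8) by simp
      then show ?thesis
        using comp_assoc[OF t(4) h(3) h(9)] comp_null[OF h(9)] hom_objects(2)[OF h(9)] by simp
    qed
    moreover have "(j' \<cdot>\<^bsub>C\<^esub> q) \<cdot>\<^bsub>C\<^esub> (i \<cdot>\<^bsub>C\<^esub> p') = Null C Z' Z'"
    proof -
      have "q \<cdot>\<^bsub>C\<^esub> (i \<cdot>\<^bsub>C\<^esub> p') = Null C Z' Y"
        using comp_assoc[OF h(11,1,4)] null_comp[OF h(11) that(2)] h(7) by simp
      then show ?thesis
        using comp_assoc[OF t(3) h(4) h(10)] comp_null[OF h(10)] hom_objects(2)[OF h(9)] by simp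
    qed
    moreover have "Plus C (i \<cdot>\<^bsub>C\<^esub> p') (j \<cdot>\<^bsub>C\<^esub> q') \<in> Hom C Z' Z"
      using t plus_hom by blast
    ultimately show ?thesis
      using t by (simp add: comp_plus_left[where X=Z' and Y=Z and Z=Z'] comp_plus_right[where X=Z' and Y=Z and Z=Z']
          plus_null null_plus h(13))
  qed
  obtain i j p q where s: "X \<in> Ob C" "Y \<in> Ob C"
    "i \<in> Hom C X Z" "j \<in> Hom C Y Z" "p \<in> Hom C Z X" "q \<in> Hom C Z Y"
    "p \<cdot>\<^bsub>C\<^esub> i = Ident C X" "q \<cdot>\<^bsub>C\<^esub> j = Ident C Y" "q \<cdot>\<^bsub>C\<^esub> i = Null C X Y" "p \<cdot>\<^bsub>C\<^esub> j = Null C Y X"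
    "Plus C (i \<cdot>\<^bsub>C\<^esub> p) (j \<cdot>\<^bsub>C\<^esub> q) = Ident C Z"
    using assms(1) unfolding is_direct_sum_def by blast
  obtain i' j' p' q' where s':
    "i' \<in> Hom C X Z'" "j' \<in> Hom C Y Z'" "p' \<in> Hom C Z' X" "q' \<in> Hom C Z' Y"
    "p' \<cdot>\<^bsub>C\<^esub> i' = Ident C X" "q' \<cdot>\<^bsub>C\<^esub> j' = Ident C Y" "q' \<cdot>\<^bsub>C\<^esub> i' = Null C X Y" "p' \<cdot>\<^bsub>C\<^esub> j' = Null C Y X"
    "Plus C (i' \<cdot>\<^bsub>C\<^esub> p') (j' \<cdot>\<^bsub>C\<^esub> q') = Ident C Z'"
    using assms(2) unfolding is_direct_sum_def by blast
  have "Plus C (i' \<cdot>\<^bsub>C\<^esub> p) (j' \<cdot>\<^bsub>C\<^esub> q) \<in> Hom C Z Z'" "Plus C (i \<cdot>\<^bsub>C\<^esub> p') (j \<cdot>\<^bsub>C\<^esub> q') \<in> Hom C Z' Z"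
    using s s' comp_hom plus_hom by blast+
  then show ?thesis
    unfolding isomorphic_iff using inv[OF s(1,2) s(3-10) s'(1-4) s'(9)] inv[OF s(1,2) s'(1-8) s(3-6) s(11)] by blast
qed

end


section \<open>Linear functors\<close>

lemma nat_iso_component:
  assumes "nat_iso C D F G \<tau>" "X \<in> Ob C"
  shows "\<tau> X \<in> Hom D (fobj F X) (fobj G X)" "is_iso D (\<tau> X)"
  using assms unfolding nat_iso_def nat_trans_def by auto

lemma naturally_isomorphic_objects:
  assumes "naturally_isomorphic C D F G" "X \<in> Ob C"
  shows "isomorphic D (fobj F X) (fobj G X)"
proof -
  obtain \<tau> where "nat_iso C D F G \<tau>"
    using assms(1) unfolding naturally_isomorphic_def by blast
  from nat_iso_component[OF this assms(2)] show ?thesis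
    unfolding isomorphic_def by (rule bexI[rotated])
qed

lemma fobj_comp [simp]: "fobj (G \<odot>\<^sub>F F) X = fobj G (fobj F X)"
  by (simp add: comp_ftor_def)

lemma farr_comp [simp]: "farr (G \<odot>\<^sub>F F) f = farr G (farr F f)"
  by (simp add: comp_ftor_def)

lemma id_ftor_simps [simp]: "fobj id_ftor X = X" "farr id_ftor f = f"
  by (simp_all add: id_ftor_def)

locale functor_between = dom: linear_category K C + cod: linear_category K D
  for K :: "('k, 'r) ring_scheme"
    and C :: "('o, 'm, 'k, 'z) linear_cat_scheme" and D :: "('p, 'n, 'k, 'y) linear_cat_scheme" +
  fixes F :: "('o, 'm, 'p, 'n) ftor"
  assumes linear: "linear_functor K C D F"
begin

lemma map_object: "X \<in> Ob C \<Longrightarrow> fobj F X \<in> Ob D"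
  using linear unfolding linear_functor_def by blast

lemma map_ident: "X \<in> Ob C \<Longrightarrow> farr F (Ident C X) = Ident D (fobj F X)"
  using linear unfolding linear_functor_def by blast

lemma map_hom: "f \<in> Hom C X Y \<Longrightarrow> farr F f \<in> Hom D (fobj F X) (fobj F Y)"
  using linear dom.hom_objects[of f X Y] unfolding linear_functor_def by blast

lemma map_comp:
  "f \<in> Hom C X Y \<Longrightarrow> g \<in> Hom C Y Z \<Longrightarrow> farr F (g \<cdot>\<^bsub>C\<^esub> f) = farr F g \<cdot>\<^bsub>D\<^esub> farr F f"
  using linear dom.hom_objects[of f X Y] dom.hom_objects[of g Y Z] unfolding linear_functor_def by blast

lemma map_plus:
  "f \<in> Hom C X Y \<Longrightarrow> g \<in> Hom C X Y \<Longrightarrow> farr F (Plus C f g) = Plus D (farr F f) (farr F g)"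
  using linear dom.hom_objects[of f X Y] unfolding linear_functor_def by blast

lemma map_null:
  assumes "X \<in> Ob C" "Y \<in> Ob C"
  shows "farr F (Null C X Y) = Null D (fobj F X) (fobj F Y)"
proof -
  note n = dom.null_hom[OF assms]
  show ?thesis
    using cod.idem_null[OF map_hom[OF n]] map_plus[OF n n] dom.null_plus[OF n] by simp
qed

lemma map_isomorphic:
  assumes "isomorphic C X Y"
  shows "isomorphic D (fobj F X) (fobj F Y)"
proof -
  obtain f g where fg: "f \<in> Hom C X Y" "g \<in> Hom C Y X" "g \<cdot>\<^bsub>C\<^esub> f = Ident C X" "f \<cdot>\<^bsub>C\<^esub> g = Ident C Y"
    using assms unfolding dom.isomorphic_iff by blast
  have "farr F g \<cdot>\<^bsub>D\<^esub> farr F f = Ident D (fobj F X)" "farr F f \<cdot>\<^bsub>D\<^esub> farr F g = Ident D (fobj F Y)"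
    using map_comp[OF fg(1,2)] map_comp[OF fg(2,1)] fg(3,4) map_ident dom.hom_objects[OF fg(1)]
    by simp_all
  then show ?thesis
    unfolding cod.isomorphic_iff using map_hom fg(1,2) by blast
qed

lemma map_retract:
  assumes "retract_of C X Y"
  shows "retract_of D (fobj F X) (fobj F Y)"
proof -
  obtain f g where fg: "f \<in> Hom C X Y" "g \<in> Hom C Y X" "g \<cdot>\<^bsub>C\<^esub> f = Ident C X"
    using assms unfolding retract_of_def by blast
  have "farr F g \<cdot>\<^bsub>D\<^esub> farr F f = Ident D (fobj F X)"
    using map_comp[OF fg(1,2)] fg(3) map_ident dom.hom_objects[OF fg(1)] by simp
  then show ?thesis
    unfolding retract_of_def using map_hom fg(1,2) by blast
qed

lemma map_zero: "is_zero C X \<Longrightarrow> is_zero D (fobj F X)"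
  using map_object map_null map_ident unfolding dom.is_zero_iff cod.is_zero_iff by metis

lemma map_direct_sum:
  assumes "is_direct_sum C X Y Z"
  shows "is_direct_sum D (fobj F X) (fobj F Y) (fobj F Z)"
proof -
  note ob = dom.direct_sum_objects[OF assms]
  obtain i j p q where s: "i \<in> Hom C X Z" "j \<in> Hom C Y Z" "p \<in> Hom C Z X" "q \<in> Hom C Z Y"
    "p \<cdot>\<^bsub>C\<^esub> i = Ident C X" "q \<cdot>\<^bsub>C\<^esub> j = Ident C Y" "q \<cdot>\<^bsub>C\<^esub> i = Null C X Y" "p \<cdot>\<^bsub>C\<^esub> j = Null C Y X"
    "Plus C (i \<cdot>\<^bsub>C\<^esub> p) (j \<cdot>\<^bsub>C\<^esub> q) = Ident C Z"
    using assms dom.direct_sumE by metis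
  show ?thesis
  proof (rule cod.direct_sumI[OF map_hom[OF s(1)] map_hom[OF s(2)] map_hom[OF s(3)] map_hom[OF s(4)]])
    show "Plus D (farr F i \<cdot>\<^bsub>D\<^esub> farr F p) (farr F j \<cdot>\<^bsub>D\<^esub> farr F q) = Ident D (fobj F Z)"
      using map_plus[OF dom.comp_hom[OF s(3,1)] dom.comp_hom[OF s(4,2)]] s(9)
        map_comp[OF s(3,1)] map_comp[OF s(4,2)] map_ident[OF ob(3)] by simp
  qed (use s(5-8) map_comp[OF s(1,3)] map_comp[OF s(2,4)] map_comp[OF s(1,4)] map_comp[OF s(2,3)]
      map_ident map_null ob in simp_all)
qed

text \<open>Naturality recovers \<open>f\<close> from \<open>farr F f\<close>: apply
  \<open>G\<close>, then conjugate with the components of \<open>\<tau>\<close>.\<close>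

lemma faithful:
  assumes G: "naturally_isomorphic C C (G \<odot>\<^sub>F F) id_ftor"
    and f: "f \<in> Hom C X Y" and g: "g \<in> Hom C X Y" and eq: "farr F f = farr F g"
  shows "f = g"
proof -
  obtain \<tau> where \<tau>: "nat_iso C C (G \<odot>\<^sub>F F) id_ftor \<tau>"
    using G unfolding naturally_isomorphic_def by blast
  have nat: "h \<cdot>\<^bsub>C\<^esub> \<tau> X = \<tau> Y \<cdot>\<^bsub>C\<^esub> farr G (farr F h)" if "h \<in> Hom C X Y" for h
    using \<tau> dom.dom_cod[OF that] unfolding nat_iso_def nat_trans_def by fastforce
  note X = dom.hom_objects(1)[OF f]
  have t: "\<tau> X \<in> Hom C (fobj G (fobj F X)) X"
    using nat_iso_component(1)[OF \<tau> X] by simp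
  obtain \<sigma> where s: "\<sigma> \<in> Hom C X (fobj G (fobj F X))" "\<tau> X \<cdot>\<^bsub>C\<^esub> \<sigma> = Ident C X"
    using dom.is_isoE[OF nat_iso_component(2)[OF \<tau> X] t] by metis
  have "h = (h \<cdot>\<^bsub>C\<^esub> \<tau> X) \<cdot>\<^bsub>C\<^esub> \<sigma>" if "h \<in> Hom C X Y" for h
    using dom.comp_assoc[OF s(1) t that] dom.ident_right[OF that] s(2) by simp
  from this[OF f] this[OF g] show ?thesis
    using nat[OF f] nat[OF g] eq by simp
qed

lemma full:
  assumes G: "linear_functor K D C G" "quasi_inverse C D F G"
    and X: "X \<in> Ob C" and Y: "Y \<in> Ob C" and k: "k \<in> Hom D (fobj F X) (fobj F Y)"
  obtains f where "f \<in> Hom C X Y" "farr F f = k"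
proof -
  interpret G: functor_between K D C G
    by unfold_locales (fact G(1))
  obtain \<tau> where \<tau>: "nat_iso C C (G \<odot>\<^sub>F F) id_ftor \<tau>"
    using G(2) unfolding naturally_isomorphic_def quasi_inverse_def by blast
  have tX: "\<tau> X \<in> Hom C (fobj G (fobj F X)) X" and tY: "\<tau> Y \<in> Hom C (fobj G (fobj F Y)) Y"
    using nat_iso_component(1)[OF \<tau> X] nat_iso_component(1)[OF \<tau> Y] by simp_all
  obtain s where s: "s \<in> Hom C X (fobj G (fobj F X))" "s \<cdot>\<^bsub>C\<^esub> \<tau> X = Ident C (fobj G (fobj F X))"
    using dom.is_isoE[OF nat_iso_component(2)[OF \<tau> X] tX] by metis
  obtain s' where s': "s' \<in> Hom C Y (fobj G (fobj F Y))" "s' \<cdot>\<^bsub>C\<^esub> \<tau> Y = Ident C (fobj G (fobj F Y))"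
    using dom.is_isoE[OF nat_iso_component(2)[OF \<tau> Y] tY] by metis
  note Gk = G.map_hom[OF k]
  \<comment> \<open>Forced by naturality of \<open>\<tau>\<close>: a preimage of \<open>k\<close>
    has to be this conjugate of \<open>farr G k\<close>, where \<open>s\<close> inverts
    \<open>\<tau> X\<close>.\<close>
  define f where "f = (\<tau> Y \<cdot>\<^bsub>C\<^esub> farr G k) \<cdot>\<^bsub>C\<^esub> s"
  have tGk: "\<tau> Y \<cdot>\<^bsub>C\<^esub> farr G k \<in> Hom C (fobj G (fobj F X)) Y"
    by (rule dom.comp_hom[OF Gk tY])
  have f: "f \<in> Hom C X Y"
    unfolding f_def by (rule dom.comp_hom[OF s(1) tGk])
  note GFf = G.map_hom[OF map_hom[OF f]]
  have "\<tau> Y \<cdot>\<^bsub>C\<^esub> farr G (farr F f) = f \<cdot>\<^bsub>C\<^esub> \<tau> X"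
    using \<tau> dom.dom_cod[OF f] unfolding nat_iso_def nat_trans_def by fastforce
  also have "\<dots> = \<tau> Y \<cdot>\<^bsub>C\<^esub> farr G k"
    unfolding f_def using dom.comp_assoc[OF tX s(1) tGk] s(2) dom.ident_right[OF tGk] by simp
  finally have "s' \<cdot>\<^bsub>C\<^esub> (\<tau> Y \<cdot>\<^bsub>C\<^esub> farr G (farr F f)) = s' \<cdot>\<^bsub>C\<^esub> (\<tau> Y \<cdot>\<^bsub>C\<^esub> farr G k)"
    by simp
  then have "farr G (farr F f) = farr G k"
    using dom.comp_assoc[OF GFf tY s'(1)] dom.comp_assoc[OF Gk tY s'(1)] s'(2)
      dom.ident_left[OF GFf] dom.ident_left[OF Gk] by simp
  \<comment> \<open>\<open>G\<close> is itself faithful, by the other half of the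
    quasi-inverse.\<close>
  then have "farr F f = k"
    using G.faithful[of F, OF _ map_hom[OF f] k] G(2) unfolding quasi_inverse_def by blast
  then show ?thesis
    using f that by blast
qed

end

context triangulated_category
begin

sublocale shift: functor_between K D D "Shift D"
  by unfold_locales (rule shift_functor)

sublocale unshift: functor_between K D D "Unshift D"
  by unfold_locales (rule unshift_functor)

lemma shift_faithful:
  "f \<in> Hom D X Y \<Longrightarrow> g \<in> Hom D X Y \<Longrightarrow> farr (Shift D) f = farr (Shift D) g \<Longrightarrow> f = g"
  using shift.faithful[of "Unshift D"] shift_unshift unfolding quasi_inverse_def by blast

text \<open>The shift is only an autoequivalence. Undoing a rotation, or using TR3 on rotated
  triangles, produces a morphism between shifts that has to be lifted to the objects
  themselves.\<close>

lemma shift_full: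
  assumes "X \<in> Ob D" "Y \<in> Ob D" "k \<in> Hom D (fobj (Shift D) X) (fobj (Shift D) Y)"
  obtains f where "f \<in> Hom D X Y" "farr (Shift D) f = k"
  using shift.full[OF unshift_functor shift_unshift assms] by blast

lemma shift_unshift_iso: "X \<in> Ob D \<Longrightarrow> isomorphic D (fobj (Shift D) (fobj (Unshift D) X)) X"
  using naturally_isomorphic_objects[of D D "Shift D \<odot>\<^sub>F Unshift D" id_ftor X] shift_unshift
  unfolding quasi_inverse_def by simp

lemma unshift_shift_iso: "X \<in> Ob D \<Longrightarrow> isomorphic D (fobj (Unshift D) (fobj (Shift D) X)) X"
  using naturally_isomorphic_objects[of D D "Unshift D \<odot>\<^sub>F Shift D" id_ftor X] shift_unshift
  unfolding quasi_inverse_def by simp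

lemma shift_reflects_iso:
  assumes "X \<in> Ob D" "Y \<in> Ob D" "isomorphic D (fobj (Shift D) X) (fobj (Shift D) Y)"
  shows "isomorphic D X Y"
  using unshift.map_isomorphic[OF assms(3)] unshift_shift_iso[OF assms(1)] unshift_shift_iso[OF assms(2)]
    isomorphic_sym isomorphic_trans by blast

end


section \<open>Distinguished triangles on objects\<close>

text \<open>Forgets the morphisms, and with them the sign introduced by each rotation, since
  complexity only asks that some triangle exists.\<close>

definition distinguished :: "('o, 'm, 'k) tri_cat \<Rightarrow> 'o \<Rightarrow> 'o \<Rightarrow> 'o \<Rightarrow> bool" where
  "distinguished D X Y Z \<longleftrightarrow> (\<exists>f g h. exact_triangle D f g h X Y Z)"

context triangulated_category
begin

lemma exact_triangleD:
  assumes "exact_triangle D f g h X Y Z"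
  shows "f \<in> Hom D X Y" "g \<in> Hom D Y Z" "h \<in> Hom D Z (fobj (Shift D) X)"
    "X \<in> Ob D" "Y \<in> Ob D" "Z \<in> Ob D"
  using assms unfolding exact_triangle_def triangle_shape_def by auto

lemma triangle_rotate:
  "exact_triangle D f g h X Y Z \<Longrightarrow>
   exact_triangle D g h (neg D (farr (Shift D) f)) Y Z (fobj (Shift D) X)"
  using TR2 unfolding exact_triangle_def by blast

lemma triangle_mapI:
  assumes "triangle_shape D f g h X Y Z" "triangle_shape D f' g' h' X' Y' Z'"
    "u \<in> Hom D X X'" "v \<in> Hom D Y Y'" "w \<in> Hom D Z Z'"
    "v \<cdot>\<^bsub>D\<^esub> f = f' \<cdot>\<^bsub>D\<^esub> u" "w \<cdot>\<^bsub>D\<^esub> g = g' \<cdot>\<^bsub>D\<^esub> v" "farr (Shift D) u \<cdot>\<^bsub>D\<^esub> h = h' \<cdot>\<^bsub>D\<^esub> w"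
  shows "triangle_map D (f, g, h) (f', g', h') u v w"
  using assms unfolding triangle_map_def triangle_shape_def Hom_def by auto

lemma complete_map:
  assumes "exact_triangle D f g h X Y Z" "exact_triangle D f' g' h' X' Y' Z'"
    "u \<in> Hom D X X'" "v \<in> Hom D Y Y'" "v \<cdot>\<^bsub>D\<^esub> f = f' \<cdot>\<^bsub>D\<^esub> u"
  obtains w where "w \<in> Hom D Z Z'" "w \<cdot>\<^bsub>D\<^esub> g = g' \<cdot>\<^bsub>D\<^esub> v" "farr (Shift D) u \<cdot>\<^bsub>D\<^esub> h = h' \<cdot>\<^bsub>D\<^esub> w"
proof -
  obtain w where "triangle_map D (f, g, h) (f', g', h') u v w"
    using TR3[OF assms] by blast
  then show ?thesis
    using that dom_cod(1)[OF exact_triangleD(3)[OF assms(1)]] dom_cod(1)[OF exact_triangleD(3)[OF assms(2)]]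
    unfolding triangle_map_def by auto
qed

text \<open>The pair \<open>Ident D X\<close>, \<open>f\<close> maps the identity triangle
  \<open>X, X, N\<close> to the given one; its completion makes the composite factor through the
  zero object \<open>N\<close>.\<close>

lemma triangle_comp_null:
  assumes "exact_triangle D f g h X Y Z"
  shows "g \<cdot>\<^bsub>D\<^esub> f = Null D X Z"
proof -
  note t = exact_triangleD[OF assms]
  obtain N where N: "is_zero D N"
    using zero_exists by blast
  obtain w where w: "w \<in> Hom D N Z" "w \<cdot>\<^bsub>D\<^esub> Null D X N = g \<cdot>\<^bsub>D\<^esub> f"
    using complete_map[OF TR1_ident[OF t(4) N] assms ident_hom[OF t(4)] t(1)] by blast
  then show ?thesis
    using comp_null[OF w(1) t(4)] by simp
qed

text \<open>Exactness of Hom from \<open>P\<close> at the middle vertex. TR3 completes maps given on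
  the first two vertices, so both triangles are rotated: the identity triangle of \<open>P\<close>
  becomes \<open>P, N, P[1]\<close>, mapped by \<open>x\<close> and zero, and the completion
  \<open>P[1] \<rightarrow> X[1]\<close> is desuspended.\<close>

lemma triangle_lift:
  assumes T: "exact_triangle D f g h X Y Z" and x: "x \<in> Hom D P Y" and null: "g \<cdot>\<^bsub>D\<^esub> x = Null D P Z"
  obtains y where "y \<in> Hom D P X" "f \<cdot>\<^bsub>D\<^esub> y = x"
proof -
  note t = exact_triangleD[OF T] and P = hom_objects(1)[OF x]
  obtain N where N: "is_zero D N"
    using zero_exists by blast
  note NO = zero_object[OF N]
  have "Null D N Z \<cdot>\<^bsub>D\<^esub> Null D P N = g \<cdot>\<^bsub>D\<^esub> x"
    using null comp_null[OF null_hom[OF NO t(6)] P] by simp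
  then obtain w where w: "w \<in> Hom D (fobj (Shift D) P) (fobj (Shift D) X)"
      "farr (Shift D) x \<cdot>\<^bsub>D\<^esub> neg D (farr (Shift D) (Ident D P)) = neg D (farr (Shift D) f) \<cdot>\<^bsub>D\<^esub> w"
    using complete_map[OF triangle_rotate[OF TR1_ident[OF P N]] triangle_rotate[OF T] x null_hom[OF NO t(6)]]
    by blast
  obtain y where y: "y \<in> Hom D P X" "farr (Shift D) y = w"
    using shift_full[OF P t(4) w(1)] by blast
  note sx = shift.map_hom[OF x] and sf = shift.map_hom[OF t(1)]
  \<comment> \<open>Each of the two rotations brings in a sign, and the signs cancel.\<close>
  have "neg D (farr (Shift D) x) = neg D (farr (Shift D) f \<cdot>\<^bsub>D\<^esub> w)"
    using w(2) comp_neg[OF ident_hom[OF shift.map_object[OF P]] sx] ident_right[OF sx]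
      neg_comp[OF w(1) sf] shift.map_ident[OF P] by simp
  then have "farr (Shift D) x = farr (Shift D) f \<cdot>\<^bsub>D\<^esub> w"
    using neg_neg[OF sx] neg_neg[OF comp_hom[OF w(1) sf]] by metis
  also have "\<dots> = farr (Shift D) (f \<cdot>\<^bsub>D\<^esub> y)"
    using shift.map_comp[OF y(1) t(1)] y(2) by simp
  finally have "x = f \<cdot>\<^bsub>D\<^esub> y"
    by (rule shift_faithful[OF x comp_hom[OF y(1) t(1)]])
  then show ?thesis
    using that y(1) by blast
qed

text \<open>Exactness of Hom into \<open>P\<close> at the middle vertex. The comparison triangle is
  \<open>N, P, P\<close>, obtained by rotating the identity triangle \<open>P, P, N[1]\<close>
  backwards.\<close>

lemma triangle_extend:
  assumes T: "exact_triangle D f g h X Y Z" and y: "y \<in> Hom D Y P" and null: "y \<cdot>\<^bsub>D\<^esub> f = Null D X P"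
  obtains z where "z \<in> Hom D Z P" "z \<cdot>\<^bsub>D\<^esub> g = y"
proof -
  note t = exact_triangleD[OF T] and P = hom_objects(2)[OF y]
  obtain N where N: "is_zero D N"
    using zero_exists by blast
  note NO = zero_object[OF N]
  note N1 = shift.map_zero[OF N]
  note NO1 = zero_object[OF N1]
  have "triangle_shape D (Null D N P) (Ident D P) (Null D P (fobj (Shift D) N)) N P P"
    unfolding triangle_shape_def using NO P NO1 null_hom ident_hom by blast
  moreover have "neg D (farr (Shift D) (Null D N P)) = Null D (fobj (Shift D) N) (fobj (Shift D) P)"
    using shift.map_null[OF NO P] neg_null[OF NO1 shift.map_object[OF P]] by simp
  ultimately have N': "exact_triangle D (Null D N P) (Ident D P) (Null D P (fobj (Shift D) N)) N P P"
    using TR2 TR1_ident[OF P N1] by simp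
  have "y \<cdot>\<^bsub>D\<^esub> f = Null D N P \<cdot>\<^bsub>D\<^esub> Null D X N"
    using null comp_null[OF null_hom[OF NO P] t(4)] by simp
  then obtain z where "z \<in> Hom D Z P" "z \<cdot>\<^bsub>D\<^esub> g = Ident D P \<cdot>\<^bsub>D\<^esub> y"
    using complete_map[OF T N' null_hom[OF t(4) NO] y] by metis
  then show ?thesis
    using that ident_left[OF y] by simp
qed

lemma distinguished_objects:
  assumes "distinguished D X Y Z"
  shows "X \<in> Ob D" "Y \<in> Ob D" "Z \<in> Ob D"
  using assms exact_triangleD(4-6) unfolding distinguished_def by metis+

lemma distinguished_rotate:
  "distinguished D X Y Z \<Longrightarrow> distinguished D Y Z (fobj (Shift D) X)"
  unfolding distinguished_def using triangle_rotate by blast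

lemma distinguished_unrotate:
  assumes "distinguished D Y Z (fobj (Shift D) X)" "X \<in> Ob D"
  shows "distinguished D X Y Z"
proof -
  obtain g h k where T: "exact_triangle D g h k Y Z (fobj (Shift D) X)"
    using assms(1) unfolding distinguished_def by blast
  note t = exact_triangleD[OF T]
  \<comment> \<open>Minus the third morphism is lifted, because TR2 puts \<open>neg D\<close> on the
    shifted first one.\<close>
  obtain f where f: "f \<in> Hom D X Y" "farr (Shift D) f = neg D k"
    using shift_full[OF assms(2) t(4) neg_hom[OF t(3)]] by blast
  have "triangle_shape D f g h X Y Z"
    unfolding triangle_shape_def using f(1) t assms(2) by blast
  then have "exact_triangle D f g h X Y Z"
    using TR2 T f(2) neg_neg[OF t(3)] by simp
  then show ?thesis
    unfolding distinguished_def by blast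
qed

text \<open>Three rotations; the signs they leave on the morphisms are invisible here.\<close>

lemma distinguished_shift:
  "distinguished D X Y Z \<Longrightarrow>
   distinguished D (fobj (Shift D) X) (fobj (Shift D) Y) (fobj (Shift D) Z)"
  using distinguished_rotate by blast

lemma distinguished_shift_cancel:
  assumes "distinguished D (fobj (Shift D) X) (fobj (Shift D) Y) (fobj (Shift D) Z)"
    "X \<in> Ob D" "Y \<in> Ob D" "Z \<in> Ob D"
  shows "distinguished D X Y Z"
  using assms distinguished_unrotate by blast

lemma conjugate_square:
  assumes "f \<in> Hom D X Y" "u \<in> Hom D X X'" "u' \<in> Hom D X' X" "u' \<cdot>\<^bsub>D\<^esub> u = Ident D X" "v \<in> Hom D Y Y'"
  shows "v \<cdot>\<^bsub>D\<^esub> f = (v \<cdot>\<^bsub>D\<^esub> f \<cdot>\<^bsub>D\<^esub> u') \<cdot>\<^bsub>D\<^esub> u" "v \<cdot>\<^bsub>D\<^esub> f \<cdot>\<^bsub>D\<^esub> u' \<in> Hom D X' Y'"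
proof -
  have "(f \<cdot>\<^bsub>D\<^esub> u') \<cdot>\<^bsub>D\<^esub> u = f"
    using comp_assoc[OF assms(2,3,1)] assms(4) ident_right[OF assms(1)] by simp
  then show "v \<cdot>\<^bsub>D\<^esub> f = (v \<cdot>\<^bsub>D\<^esub> f \<cdot>\<^bsub>D\<^esub> u') \<cdot>\<^bsub>D\<^esub> u"
    using comp_assoc[OF assms(2) comp_hom[OF assms(3,1)] assms(5)] by simp
  show "v \<cdot>\<^bsub>D\<^esub> f \<cdot>\<^bsub>D\<^esub> u' \<in> Hom D X' Y'"
    using comp_hom assms by blast
qed

lemma distinguished_iso:
  assumes "distinguished D X Y Z" "isomorphic D X X'" "isomorphic D Y Y'" "isomorphic D Z Z'"
  shows "distinguished D X' Y' Z'"
proof -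
  obtain f g h where T: "exact_triangle D f g h X Y Z"
    using assms(1) unfolding distinguished_def by blast
  note t = exact_triangleD[OF T]
  obtain u u' where u: "u \<in> Hom D X X'" "u' \<in> Hom D X' X" "u' \<cdot>\<^bsub>D\<^esub> u = Ident D X" "u \<cdot>\<^bsub>D\<^esub> u' = Ident D X'"
    using assms(2) unfolding isomorphic_iff by blast
  obtain v v' where v: "v \<in> Hom D Y Y'" "v' \<in> Hom D Y' Y" "v' \<cdot>\<^bsub>D\<^esub> v = Ident D Y" "v \<cdot>\<^bsub>D\<^esub> v' = Ident D Y'"
    using assms(3) unfolding isomorphic_iff by blast
  obtain w w' where w: "w \<in> Hom D Z Z'" "w' \<in> Hom D Z' Z" "w' \<cdot>\<^bsub>D\<^esub> w = Ident D Z" "w \<cdot>\<^bsub>D\<^esub> w' = Ident D Z'"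
    using assms(4) unfolding isomorphic_iff by blast
  define f' g' h' where "f' = v \<cdot>\<^bsub>D\<^esub> f \<cdot>\<^bsub>D\<^esub> u'" and "g' = w \<cdot>\<^bsub>D\<^esub> g \<cdot>\<^bsub>D\<^esub> v'"
    and "h' = farr (Shift D) u \<cdot>\<^bsub>D\<^esub> h \<cdot>\<^bsub>D\<^esub> w'"
  note F = conjugate_square[OF t(1) u(1-3) v(1), folded f'_def]
    and G = conjugate_square[OF t(2) v(1-3) w(1), folded g'_def]
    and H = conjugate_square[OF t(3) w(1-3) shift.map_hom[OF u(1)], folded h'_def]
  have shape: "triangle_shape D f' g' h' X' Y' Z'"
    unfolding triangle_shape_def using F(2) G(2) H(2) hom_objects[OF u(1)] hom_objects[OF v(1)] hom_objects[OF w(1)]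
    by blast
  have "triangle_map D (f, g, h) (f', g', h') u v w"
    using triangle_mapI[OF _ shape u(1) v(1) w(1) F(1) G(1) H(1)] T unfolding exact_triangle_def by blast
  moreover have "is_iso D u" "is_iso D v" "is_iso D w"
    using is_isoI[OF u] is_isoI[OF v] is_isoI[OF w] .
  moreover have "(f, g, h) \<in> Triangles D"
    using T unfolding exact_triangle_def by blast
  ultimately have "(f', g', h') \<in> iso_closure D (Triangles D)"
    unfolding iso_closure_def using shape by blast
  then have "exact_triangle D f' g' h' X' Y' Z'"
    using TR1_iso shape unfolding exact_triangle_def by blast
  then show ?thesis
    unfolding distinguished_def by blast
qed

lemma distinguished_unshift:
  assumes "distinguished D X Y Z"
  shows "distinguished D (fobj (Unshift D) X) (fobj (Unshift D) Y) (fobj (Unshift D) Z)"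
proof -
  note ob = distinguished_objects[OF assms]
  have "distinguished D (fobj (Shift D) (fobj (Unshift D) X)) (fobj (Shift D) (fobj (Unshift D) Y))
    (fobj (Shift D) (fobj (Unshift D) Z))"
    using distinguished_iso[OF assms] shift_unshift_iso[OF ob(1)] shift_unshift_iso[OF ob(2)]
      shift_unshift_iso[OF ob(3)] isomorphic_sym by blast
  then show ?thesis
    using distinguished_shift_cancel unshift.map_object ob by blast
qed

section \<open>Triangles with a zero vertex, split triangles, and triangles enlarged by a
  summand\<close>

lemma distinguished_ident: "X \<in> Ob D \<Longrightarrow> is_zero D N \<Longrightarrow> distinguished D X X N"
  unfolding distinguished_def using TR1_ident by blast

text \<open>The first and last morphisms vanish, so the middle one has a left inverse, by extending
  the identity of \<open>Y\<close>, and a right inverse, by lifting that of \<open>Z\<close>; the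
  two agree.\<close>

lemma distinguished_zero_first:
  assumes "distinguished D N Y Z" "is_zero D N"
  shows "isomorphic D Y Z"
proof -
  obtain f g h where T: "exact_triangle D f g h N Y Z"
    using assms(1) unfolding distinguished_def by blast
  note t = exact_triangleD[OF T]
  note N1 = shift.map_zero[OF assms(2)]
  have f: "f = Null D N Y" and h: "h = Null D Z (fobj (Shift D) N)"
    using hom_from_zero[OF assms(2) t(1)] hom_to_zero[OF N1 t(3)] .
  obtain z where z: "z \<in> Hom D Z Y" "z \<cdot>\<^bsub>D\<^esub> g = Ident D Y"
    using triangle_extend[OF T ident_hom[OF t(5)]] comp_null[OF ident_hom[OF t(5)] t(4)] f by metis
  have "h \<cdot>\<^bsub>D\<^esub> Ident D Z = Null D Z (fobj (Shift D) N)"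
    using h ident_right[OF t(3)] by simp
  then obtain s where s: "s \<in> Hom D Z Y" "g \<cdot>\<^bsub>D\<^esub> s = Ident D Z"
    using triangle_lift[OF triangle_rotate[OF T] ident_hom[OF t(6)]] by blast
  have "z = s"
    using comp_assoc[OF s(1) t(2) z(1)] z(2) s(2) ident_right[OF z(1)] ident_left[OF s(1)] by simp
  then show ?thesis
    unfolding isomorphic_iff using t(2) z s(2) by blast
qed

lemma distinguished_zero_last:
  assumes "distinguished D X Y N" "is_zero D N"
  shows "isomorphic D X Y"
  using distinguished_zero_first[OF distinguished_rotate[OF distinguished_rotate[OF assms(1)]] assms(2)]
    shift_reflects_iso distinguished_objects[OF assms(1)] by blast

text \<open>A vanishing connecting morphism lets the identity of \<open>W\<close> lift to a section
  \<open>s\<close> of \<open>v\<close>. The complementary endomorphism \<open>1 - s v\<close> of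
  \<open>E\<close> is killed by \<open>v\<close>, so it factors through \<open>u\<close>, which
  gives the projection to \<open>Z\<close>.\<close>

lemma split_triangle:
  assumes T: "exact_triangle D u v (Null D W (fobj (Shift D) Z)) Z E W"
  shows "is_direct_sum D Z W E"
proof -
  note t = exact_triangleD[OF T]
  note Z1 = shift.map_object[OF t(4)]
  note vu = triangle_comp_null[OF T]
  have "Null D W (fobj (Shift D) Z) \<cdot>\<^bsub>D\<^esub> Ident D W = Null D W (fobj (Shift D) Z)"
    using ident_right[OF t(3)] .
  then obtain s where s: "s \<in> Hom D W E" "v \<cdot>\<^bsub>D\<^esub> s = Ident D W"
    using triangle_lift[OF triangle_rotate[OF T] ident_hom[OF t(6)]] by blast
  note sv = comp_hom[OF t(2) s(1)]
  have v_sv: "v \<cdot>\<^bsub>D\<^esub> (s \<cdot>\<^bsub>D\<^esub> v) = v"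
    using comp_assoc[OF t(2) s(1) t(2)] s(2) ident_left[OF t(2)] by simp
  define x where "x = Plus D (Ident D E) (neg D (s \<cdot>\<^bsub>D\<^esub> v))"
  have x: "x \<in> Hom D E E"
    unfolding x_def using plus_hom ident_hom t neg_hom sv by blast
  have "v \<cdot>\<^bsub>D\<^esub> x = Null D E W"
    unfolding x_def using comp_plus_right[OF ident_hom[OF t(5)] neg_hom[OF sv] t(2)] comp_neg[OF sv t(2)]
      v_sv ident_right[OF t(2)] plus_neg[OF t(2)] by simp
  then obtain r where r: "r \<in> Hom D E Z" "u \<cdot>\<^bsub>D\<^esub> r = x"
    using triangle_lift[OF T x] by blast
  \<comment> \<open>\<open>u\<close> is a monomorphism: a shifted morphism killed by
    \<open>u[1]\<close> factors through the connecting morphism, which is zero.\<close>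
  have mono: "d = Null D P Z" if d: "d \<in> Hom D P Z" "u \<cdot>\<^bsub>D\<^esub> d = Null D P E" for d P
  proof -
    note P = hom_objects(1)[OF d(1)]
    have "neg D (farr (Shift D) u) \<cdot>\<^bsub>D\<^esub> farr (Shift D) d = Null D (fobj (Shift D) P) (fobj (Shift D) E)"
      using neg_comp[OF shift.map_hom[OF d(1)] shift.map_hom[OF t(1)]] shift.map_comp[OF d(1) t(1)] d(2)
        shift.map_null[OF P t(5)] neg_null[OF shift.map_object[OF P] shift.map_object[OF t(5)]] by metis
    then obtain y where y: "y \<in> Hom D (fobj (Shift D) P) W"
      "Null D W (fobj (Shift D) Z) \<cdot>\<^bsub>D\<^esub> y = farr (Shift D) d"
      using triangle_lift[OF triangle_rotate[OF triangle_rotate[OF T]] shift.map_hom[OF d(1)]] by blast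
    then have "farr (Shift D) d = farr (Shift D) (Null D P Z)"
      using null_comp[OF y(1) Z1] shift.map_null[OF P t(4)] by simp
    then show ?thesis
      using shift_faithful[OF d(1) null_hom[OF P t(4)]] by blast
  qed
  have xu: "x \<cdot>\<^bsub>D\<^esub> u = u"
  proof -
    have "(s \<cdot>\<^bsub>D\<^esub> v) \<cdot>\<^bsub>D\<^esub> u = Null D Z E"
      using comp_assoc[OF t(1,2) s(1)] vu comp_null[OF s(1) t(4)] by simp
    then show ?thesis
      unfolding x_def using comp_plus_left[OF t(1) ident_hom[OF t(5)] neg_hom[OF sv]] neg_comp[OF t(1) sv]
        ident_left[OF t(1)] neg_null[OF t(4,5)] plus_null[OF t(1)] by simp
  qed
  have xs: "x \<cdot>\<^bsub>D\<^esub> s = Null D W E"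
  proof -
    have "(s \<cdot>\<^bsub>D\<^esub> v) \<cdot>\<^bsub>D\<^esub> s = s"
      using comp_assoc[OF s(1) t(2) s(1)] s(2) ident_right[OF s(1)] by simp
    then show ?thesis
      unfolding x_def using comp_plus_left[OF s(1) ident_hom[OF t(5)] neg_hom[OF sv]] neg_comp[OF s(1) sv]
        ident_left[OF s(1)] plus_neg[OF s(1)] by simp
  qed
  note ru = comp_hom[OF t(1) r(1)]
  have "r \<cdot>\<^bsub>D\<^esub> u = Ident D Z"
  proof (rule eq_if_plus_neg_null[OF ru ident_hom[OF t(4)]])
    have "u \<cdot>\<^bsub>D\<^esub> Plus D (r \<cdot>\<^bsub>D\<^esub> u) (neg D (Ident D Z)) = Null D Z E"
      using comp_plus_right[OF ru neg_hom[OF ident_hom[OF t(4)]] t(1)] comp_neg[OF ident_hom[OF t(4)] t(1)]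
        comp_assoc[OF t(1) r(1) t(1)] r(2) xu ident_right[OF t(1)] plus_neg[OF t(1)] by simp
    then show "Plus D (r \<cdot>\<^bsub>D\<^esub> u) (neg D (Ident D Z)) = Null D Z Z"
      using mono plus_hom[OF ru neg_hom[OF ident_hom[OF t(4)]]] by blast
  qed
  moreover have "r \<cdot>\<^bsub>D\<^esub> s = Null D W Z"
    using mono[OF comp_hom[OF s(1) r(1)]] comp_assoc[OF s(1) r(1) t(1)] r(2) xs by simp
  moreover have "Plus D (u \<cdot>\<^bsub>D\<^esub> r) (s \<cdot>\<^bsub>D\<^esub> v) = Ident D E"
  proof -
    have "Plus D (neg D (s \<cdot>\<^bsub>D\<^esub> v)) (s \<cdot>\<^bsub>D\<^esub> v) = Null D E E"
      using plus_commute[OF neg_hom[OF sv] sv] plus_neg[OF sv] by simp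
    then show ?thesis
      using r(2) plus_assoc[OF ident_hom[OF t(5)] neg_hom[OF sv] sv] plus_null[OF ident_hom[OF t(5)]]
      unfolding x_def by simp
  qed
  ultimately show ?thesis
    using direct_sumI[OF t(1) s(1) r(1) t(2)] s(2) vu by simp
qed

text \<open>Consecutive morphisms compose to zero, so \<open>i[1]\<close> kills \<open>h\<close>;
  applying \<open>p[1]\<close> leaves \<open>h\<close> itself.\<close>

lemma split_mono_connecting_null:
  assumes T: "exact_triangle D i g h X Y Z" and p: "p \<in> Hom D Y X" "p \<cdot>\<^bsub>D\<^esub> i = Ident D X"
  shows "h = Null D Z (fobj (Shift D) X)"
proof -
  note t = exact_triangleD[OF T]
  note si = shift.map_hom[OF t(1)] and sp = shift.map_hom[OF p(1)]
  have "neg D (farr (Shift D) i) \<cdot>\<^bsub>D\<^esub> h = Null D Z (fobj (Shift D) Y)"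
    by (rule triangle_comp_null[OF triangle_rotate[OF triangle_rotate[OF T]]])
  then have "farr (Shift D) i \<cdot>\<^bsub>D\<^esub> h = Null D Z (fobj (Shift D) Y)"
    using neg_comp[OF t(3) si] neg_neg[OF comp_hom[OF t(3) si]] neg_null[OF t(6) shift.map_object[OF t(5)]]
    by simp
  then have "(farr (Shift D) p \<cdot>\<^bsub>D\<^esub> farr (Shift D) i) \<cdot>\<^bsub>D\<^esub> h = Null D Z (fobj (Shift D) X)"
    using comp_assoc[OF t(3) si sp] comp_null[OF sp t(6)] by simp
  then show ?thesis
    using shift.map_comp[OF t(1) p(1)] p(2) shift.map_ident[OF t(4)] ident_left[OF t(3)] by simp
qed

text \<open>The complement is the cone of the inclusion. This allows the proof to work with
  retracts, which composition and functors visibly preserve, in place of direct sums.\<close>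

lemma retract_complement:
  assumes "retract_of D X Y"
  obtains Z where "is_direct_sum D X Z Y"
proof -
  obtain i p where ip: "i \<in> Hom D X Y" "p \<in> Hom D Y X" "p \<cdot>\<^bsub>D\<^esub> i = Ident D X"
    using assms unfolding retract_of_def by blast
  obtain g h Z where T: "exact_triangle D i g h X Y Z"
    using TR1_complete[OF hom_objects[OF ip(1)] ip(1)] by blast
  then have "is_direct_sum D X Z Y"
    using split_triangle split_mono_connecting_null[OF T ip(2,3)] by blast
  then show ?thesis
    using that by blast
qed

text \<open>The octahedral axiom takes a triangle on the inclusion \<open>i\<close> itself. TR1
  supplies one with an unknown cone \<open>V\<close>; the morphism \<open>q'\<close> induced by
  \<open>q\<close> and the composite of \<open>j\<close> with \<open>g\<close> identify
  \<open>V\<close> with \<open>W\<close>.\<close>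

lemma direct_sum_triangle:
  assumes i: "i \<in> Hom D Y Y'" "j \<in> Hom D W Y'" "p \<in> Hom D Y' Y" "q \<in> Hom D Y' W"
    "p \<cdot>\<^bsub>D\<^esub> i = Ident D Y" "q \<cdot>\<^bsub>D\<^esub> j = Ident D W" "q \<cdot>\<^bsub>D\<^esub> i = Null D Y W"
    "Plus D (i \<cdot>\<^bsub>D\<^esub> p) (j \<cdot>\<^bsub>D\<^esub> q) = Ident D Y'"
  obtains g V where "exact_triangle D i g (Null D V (fobj (Shift D) Y)) Y Y' V" "isomorphic D V W"
proof -
  obtain g h V where T: "exact_triangle D i g h Y Y' V"
    using TR1_complete[OF hom_objects[OF i(1)] i(1)] by blast
  note t = exact_triangleD[OF T]
  have h: "h = Null D V (fobj (Shift D) Y)"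
    using split_mono_connecting_null[OF T i(3,5)] .
  obtain q' where q': "q' \<in> Hom D V W" "q' \<cdot>\<^bsub>D\<^esub> g = q"
    using triangle_extend[OF T i(4,7)] by blast
  note gj = comp_hom[OF i(2) t(2)]
  have 1: "q' \<cdot>\<^bsub>D\<^esub> (g \<cdot>\<^bsub>D\<^esub> j) = Ident D W"
    using comp_assoc[OF i(2) t(2) q'(1)] q'(2) i(6) by simp
  obtain s where s: "s \<in> Hom D V Y'" "g \<cdot>\<^bsub>D\<^esub> s = Ident D V"
    using triangle_lift[OF triangle_rotate[OF T] ident_hom[OF t(6)]] h ident_right[OF t(3)] by blast
  have "g \<cdot>\<^bsub>D\<^esub> (i \<cdot>\<^bsub>D\<^esub> p) = Null D Y' V"
    using comp_assoc[OF i(3) t(1,2)] triangle_comp_null[OF T] null_comp[OF i(3) t(6)] by simp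
  then have g: "(g \<cdot>\<^bsub>D\<^esub> j) \<cdot>\<^bsub>D\<^esub> q = g"
    using comp_plus_right[OF comp_hom[OF i(3,1)] comp_hom[OF i(4,2)] t(2)] i(8) ident_right[OF t(2)]
      comp_assoc[OF i(4,2) t(2)] null_plus[OF comp_hom[OF comp_hom[OF i(4,2)] t(2)]] by simp
  \<comment> \<open>This composite fixes \<open>g\<close>, and \<open>g\<close> has the right
    inverse \<open>s\<close>, so it is the identity of \<open>V\<close>.\<close>
  have "((g \<cdot>\<^bsub>D\<^esub> j) \<cdot>\<^bsub>D\<^esub> q') \<cdot>\<^bsub>D\<^esub> g = g"
    using comp_assoc[OF t(2) q'(1) gj] q'(2) g by simp
  then have "((g \<cdot>\<^bsub>D\<^esub> j) \<cdot>\<^bsub>D\<^esub> q') \<cdot>\<^bsub>D\<^esub> (g \<cdot>\<^bsub>D\<^esub> s) = g \<cdot>\<^bsub>D\<^esub> s"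
    using comp_assoc[OF s(1) t(2) comp_hom[OF q'(1) gj]] by simp
  then have "(g \<cdot>\<^bsub>D\<^esub> j) \<cdot>\<^bsub>D\<^esub> q' = Ident D V"
    using s(2) ident_right[OF comp_hom[OF q'(1) gj]] by simp
  then have "isomorphic D V W"
    unfolding isomorphic_iff using 1 q'(1) gj by blast
  then show ?thesis
    using that T h by blast
qed

text \<open>Octahedron on \<open>X \<rightarrow> Y \<rightarrow> Y'\<close>: the cone
  \<open>E\<close> of the composite is an extension of \<open>V\<close>, a copy of \<open>W\<close>,
  by \<open>Z\<close>. Its connecting morphism factors through the zero one of the split triangle,
  so \<open>E\<close> is the direct sum.\<close>

lemma distinguished_add_last:
  assumes T: "distinguished D X Y Z" and Y': "is_direct_sum D Y W Y'" and Z': "is_direct_sum D Z W Z'"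
  shows "distinguished D X Y' Z'"
proof -
  obtain f g h where T: "exact_triangle D f g h X Y Z"
    using T unfolding distinguished_def by blast
  note t = exact_triangleD[OF T]
  obtain i j p q where s: "i \<in> Hom D Y Y'" "j \<in> Hom D W Y'" "p \<in> Hom D Y' Y" "q \<in> Hom D Y' W"
    "p \<cdot>\<^bsub>D\<^esub> i = Ident D Y" "q \<cdot>\<^bsub>D\<^esub> j = Ident D W" "q \<cdot>\<^bsub>D\<^esub> i = Null D Y W"
    "Plus D (i \<cdot>\<^bsub>D\<^esub> p) (j \<cdot>\<^bsub>D\<^esub> q) = Ident D Y'"
    using Y' direct_sumE by metis
  obtain k V where k: "exact_triangle D i k (Null D V (fobj (Shift D) Y)) Y Y' V" "isomorphic D V W"
    using direct_sum_triangle[OF s] by blast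
  note tk = exact_triangleD[OF k(1)]
  obtain l l' E where E: "exact_triangle D (i \<cdot>\<^bsub>D\<^esub> f) l l' X Y' E"
    using TR1_complete[OF t(4) tk(5) comp_hom[OF t(1) s(1)]] by blast
  obtain u v where "exact_triangle D u v (farr (Shift D) g \<cdot>\<^bsub>D\<^esub> Null D V (fobj (Shift D) Y)) Z E V"
    using TR4[OF T k(1) E] by blast
  then have "is_direct_sum D Z V E"
    using split_triangle comp_null[OF shift.map_hom[OF t(2)] tk(6)] by simp
  then have "isomorphic D E Z'"
    using direct_sum_iso_right[OF _ k(2)] direct_sum_unique Z' by blast
  moreover have "distinguished D X Y' E"
    using E unfolding distinguished_def by blast
  ultimately show ?thesis
    using distinguished_iso isomorphic_refl[OF t(4)] isomorphic_refl[OF tk(5)] by blast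
qed

text \<open>Two rotations move \<open>X\<close> and \<open>Y\<close>, shifted, to the last two
  places, where \<open>distinguished_add_last\<close> applies.\<close>

lemma distinguished_add_first:
  assumes T: "distinguished D X Y Z" and X': "is_direct_sum D X W X'" and Y': "is_direct_sum D Y W Y'"
  shows "distinguished D X' Y' Z"
proof -
  have "distinguished D Z (fobj (Shift D) X') (fobj (Shift D) Y')"
    by (rule distinguished_add_last[OF distinguished_rotate[OF distinguished_rotate[OF T]]
          shift.map_direct_sum[OF X'] shift.map_direct_sum[OF Y']])
  then show ?thesis
    using distinguished_unrotate direct_sum_objects[OF X'] direct_sum_objects[OF Y'] by blast
qed

text \<open>The octahedral axiom as a pullback of extensions.\<close>

lemma distinguished_pullback:
  assumes A: "distinguished D A X Y" and P: "distinguished D P Y Q"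
  obtains M where "distinguished D M X Q" "distinguished D A M P"
proof -
  obtain f a a' where T: "exact_triangle D f a a' X Y (fobj (Shift D) A)"
    using distinguished_rotate[OF A] unfolding distinguished_def by blast
  obtain g b b' where T': "exact_triangle D g b b' Y Q (fobj (Shift D) P)"
    using distinguished_rotate[OF P] unfolding distinguished_def by blast
  note t = exact_triangleD[OF T] and t' = exact_triangleD[OF T']
  note ob = distinguished_objects[OF A] distinguished_objects[OF P]
  obtain l l' E where E: "exact_triangle D (g \<cdot>\<^bsub>D\<^esub> f) l l' X Q E"
    using TR1_complete[OF t(4) t'(5) comp_hom[OF t(1) t'(1)]] by blast
  note EO = exact_triangleD(6)[OF E]
  \<comment> \<open>The desuspended cone of \<open>X \<rightarrow> Y \<rightarrow> Q\<close>, to be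
    thought of as the preimage in \<open>X\<close> of the part \<open>P\<close> of
    \<open>Y\<close>.\<close>
  let ?M = "fobj (Unshift D) E"
  have M: "?M \<in> Ob D" "isomorphic D E (fobj (Shift D) ?M)"
    using unshift.map_object[OF EO] shift_unshift_iso[OF EO] isomorphic_sym by blast+
  have "distinguished D X Q E"
    using E unfolding distinguished_def by blast
  then have "distinguished D ?M X Q"
    using distinguished_iso isomorphic_refl M t(4) t'(5) distinguished_unrotate by blast
  moreover have "distinguished D (fobj (Shift D) A) E (fobj (Shift D) P)"
    using TR4[OF T T' E] unfolding distinguished_def by blast
  then have "distinguished D (fobj (Shift D) A) (fobj (Shift D) ?M) (fobj (Shift D) P)"
    using distinguished_iso isomorphic_refl M(2) t(6) t'(6) by blast
  then have "distinguished D A ?M P"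
    using distinguished_shift_cancel M(1) ob by blast
  ultimately show ?thesis
    using that by blast
qed

end


section \<open>Towers and split-generators\<close>

lemma fobj_shift_by:
  "fobj (shift_by D n) X =
    (if 0 \<le> n then (fobj (Shift D) ^^ nat n) X else (fobj (Unshift D) ^^ nat (- n)) X)"
proof -
  have "fobj (((\<lambda>F. G \<odot>\<^sub>F F) ^^ k) id_ftor) X = (fobj G ^^ k) X" for k and G :: "('a, 'b, 'a, 'b) ftor" and X
    by (induction k) simp_all
  then show ?thesis
    unfolding shift_by_def by simp
qed

lemma shift_by_0 [simp]: "fobj (shift_by D 0) X = X"
  by (simp add: fobj_shift_by)

text \<open>The sequence in \<open>built_from\<close> without the final passage to a summand, as an
  inductive predicate so that towers can be rebuilt step by step.\<close>

inductive tower :: "('o, 'm, 'k) tri_cat \<Rightarrow> 'o \<Rightarrow> 'o \<Rightarrow> int list \<Rightarrow> bool"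
  for D :: "('o, 'm, 'k) tri_cat" and E :: 'o where
  tower_Nil: "is_zero D X \<Longrightarrow> tower D E X []"
| tower_snoc: "tower D E X ns \<Longrightarrow> distinguished D X Y (fobj (shift_by D n) E)
    \<Longrightarrow> tower D E Y (ns @ [n])"

section \<open>Shifts, concatenation of towers, and extensions of built objects\<close>

context triangulated_category
begin

lemma shift_by_object: "X \<in> Ob D \<Longrightarrow> fobj (shift_by D n) X \<in> Ob D"
proof -
  assume X: "X \<in> Ob D"
  have "(fobj (Shift D) ^^ k) X \<in> Ob D" "(fobj (Unshift D) ^^ k) X \<in> Ob D" for k
    using X by (induction k) (simp_all add: shift.map_object unshift.map_object)
  then show ?thesis
    unfolding fobj_shift_by by simp
qed

lemma shift_by_succ:
  assumes "X \<in> Ob D"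
  shows "isomorphic D (fobj (Shift D) (fobj (shift_by D n) X)) (fobj (shift_by D (n + 1)) X)"
proof (cases "0 \<le> n")
  case True
  then have "fobj (Shift D) (fobj (shift_by D n) X) = fobj (shift_by D (n + 1)) X"
    by (simp add: fobj_shift_by nat_add_distrib)
  then show ?thesis
    using isomorphic_refl[OF shift_by_object[OF assms]] by simp
next
  case False
  define k where "k = nat (- (n + 1))"
  have n: "n = - int (Suc k)"
    using False unfolding k_def by simp
  have "fobj (shift_by D n) X = fobj (Unshift D) ((fobj (Unshift D) ^^ k) X)"
    unfolding n fobj_shift_by by (simp add: nat_add_distrib)
  moreover have "fobj (shift_by D (n + 1)) X = (fobj (Unshift D) ^^ k) X"
    unfolding n fobj_shift_by by simp
  ultimately show ?thesis
    using shift_unshift_iso shift_by_object[OF assms, of "n + 1"] by simp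
qed

lemma shift_by_pred:
  assumes "X \<in> Ob D"
  shows "isomorphic D (fobj (Unshift D) (fobj (shift_by D n) X)) (fobj (shift_by D (n - 1)) X)"
proof -
  let ?Y = "fobj (shift_by D (n - 1)) X"
  have "isomorphic D (fobj (Shift D) ?Y) (fobj (shift_by D n) X)"
    using shift_by_succ[OF assms, of "n - 1"] by simp
  then have "isomorphic D (fobj (Unshift D) (fobj (Shift D) ?Y)) (fobj (Unshift D) (fobj (shift_by D n) X))"
    by (rule unshift.map_isomorphic)
  then show ?thesis
    using unshift_shift_iso[OF shift_by_object[OF assms]] isomorphic_sym isomorphic_trans by blast
qed

lemma tower_iso:
  assumes "tower D E X ns" "isomorphic D X Y"
  shows "tower D E Y ns"
  using assms(1)
proof cases
  case tower_Nil
  then show ?thesis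
    using tower.tower_Nil retract_zero[OF isomorphic_retract[OF isomorphic_sym[OF assms(2)]]] by simp
next
  case (tower_snoc P ms n)
  then have "distinguished D P Y (fobj (shift_by D n) E)"
    using distinguished_iso assms(2) isomorphic_refl distinguished_objects by blast
  then show ?thesis
    using tower_snoc tower.tower_snoc[of D E P ms Y n] by simp
qed

text \<open>Pulling the tower of \<open>Z\<close> back along \<open>Y \<rightarrow> Z\<close> gives
  a filtration of \<open>Y\<close> that starts at \<open>X\<close> and has the same pieces.
  \<open>Y\<close> varies in the induction because each stage replaces it by the preimage
  \<open>M\<close>.\<close>

lemma tower_append:
  assumes "tower D E Z ls" "tower D E X ks" "distinguished D X Y Z"
  shows "tower D E Y (ks @ ls)"
  using assms(1,3)
proof (induction arbitrary: Y rule: tower.induct)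
  case (tower_Nil Z)
  then show ?case
    using tower_iso[OF assms(2)] distinguished_zero_last by simp
next
  case (tower_snoc P ls Z l)
  obtain M where M: "distinguished D M Y (fobj (shift_by D l) E)" "distinguished D X M P"
    using distinguished_pullback[OF tower_snoc.prems tower_snoc.hyps(2)] by blast
  show ?case
    using tower.tower_snoc[OF tower_snoc.IH[OF M(2)] M(1)] by simp
qed

text \<open>A sequence becomes a tower by induction over initial segments; conversely, the summand
  \<open>F'\<close> is the complement of the retract.\<close>

lemma built_from_iff: "built_from D E F ns \<longleftrightarrow> (\<exists>X. retract_of D F X \<and> tower D E X ns)"
proof
  assume "built_from D E F ns"
  then obtain F' A where A: "is_zero D (A 0)" "is_direct_sum D F F' (A (length ns))"
    "\<And>i. i < length ns \<Longrightarrow> distinguished D (A i) (A (Suc i)) (fobj (shift_by D (ns ! i)) E)"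
    unfolding built_from_def distinguished_def by blast
  have "i \<le> length ns \<Longrightarrow> tower D E (A i) (take i ns)" for i
  proof (induction i)
    case 0
    then show ?case
      using tower_Nil A(1) by simp
  next
    case (Suc i)
    then show ?case
      using tower_snoc[OF _ A(3)[of i]] take_Suc_conv_app_nth[of i ns] by simp
  qed
  from this[of "length ns"] show "\<exists>X. retract_of D F X \<and> tower D E X ns"
    using direct_sum_retract[OF A(2)] by auto
next
  have chain: "\<exists>A. is_zero D (A 0) \<and> A (length ns) = X \<and> (\<forall>i < length ns. \<exists>f g h.
        exact_triangle D f g h (A i) (A (Suc i)) (fobj (shift_by D (ns ! i)) E))"
    if "tower D E X ns" for X
    using that
  proof induction
    case (tower_Nil X)
    then show ?case
      by auto
  next
    case (tower_snoc X ns Y n)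
    then obtain A where A: "is_zero D (A 0)" "A (length ns) = X" "\<forall>i < length ns. \<exists>f g h.
        exact_triangle D f g h (A i) (A (Suc i)) (fobj (shift_by D (ns ! i)) E)"
      by blast
    show ?case
    proof (intro exI[where x = "A(Suc (length ns) := Y)"] conjI allI impI)
      let ?A = "A(Suc (length ns) := Y)"
      show "is_zero D (?A 0)" "?A (length (ns @ [n])) = Y"
        using A(1) by simp_all
      show "\<exists>f g h. exact_triangle D f g h (?A i) (?A (Suc i)) (fobj (shift_by D ((ns @ [n]) ! i)) E)"
        if "i < length (ns @ [n])" for i
        using that A(2,3) tower_snoc.hyps(2) unfolding distinguished_def
        by (cases "i = length ns") (auto simp: nth_append)
    qed
  qed
  assume "\<exists>X. retract_of D F X \<and> tower D E X ns"
  then show "built_from D E F ns"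
    using chain retract_complement unfolding built_from_def by metis
qed

lemma built_from_retract: "built_from D E F' ns \<Longrightarrow> retract_of D F F' \<Longrightarrow> built_from D E F ns"
  using retract_trans unfolding built_from_iff by blast

lemma built_from_object: "built_from D E F ns \<Longrightarrow> F \<in> Ob D"
  using retract_objects unfolding built_from_iff by blast

lemma built_from_zero: "is_zero D F \<Longrightarrow> built_from D E F []"
  using tower_Nil[of D F] isomorphic_retract[OF isomorphic_refl[OF zero_object]] unfolding built_from_iff by auto

lemma built_from_self:
  assumes "E \<in> Ob D"
  shows "built_from D E E [0]"
proof -
  obtain N where N: "is_zero D N"
    using zero_exists by blast
  \<comment> \<open>The one-step tower \<open>N, E\<close> is the identity triangle
    \<open>E, E, N[1]\<close> rotated backwards.\<close>
  have "distinguished D N E (fobj (shift_by D 0) E)"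
    using distinguished_unrotate[OF distinguished_ident[OF assms shift.map_zero[OF N]] zero_object[OF N]]
    by simp
  then show ?thesis
    using tower_snoc[OF tower_Nil[OF N]] isomorphic_retract[OF isomorphic_refl[OF assms]]
    unfolding built_from_iff by force
qed

text \<open>\<open>X\<close> and \<open>Z\<close> are only retracts of the towers \<open>X1\<close>
  and \<open>Z1\<close>. Adding the complement \<open>X'\<close> to the first two vertices and
  \<open>Z'\<close> to the last two gives a triangle \<open>X1, Y2, Z1\<close> between towers, with
  \<open>Y\<close> a retract of \<open>Y2\<close>.\<close>

lemma built_from_extension:
  assumes "distinguished D X Y Z" "built_from D E X ks" "built_from D E Z ls"
  shows "built_from D E Y (ks @ ls)"
proof -
  obtain X1 Z1 where X1: "retract_of D X X1" "tower D E X1 ks" and Z1: "retract_of D Z Z1" "tower D E Z1 ls"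
    using assms(2,3) unfolding built_from_iff by blast
  obtain X' where X': "is_direct_sum D X X' X1"
    using X1(1) retract_complement by blast
  obtain Z' where Z': "is_direct_sum D Z Z' Z1"
    using Z1(1) retract_complement by blast
  obtain Y1 where Y1: "is_direct_sum D Y X' Y1"
    using direct_sum_exists distinguished_objects[OF assms(1)] direct_sum_objects[OF X'] by blast
  obtain Y2 where Y2: "is_direct_sum D Y1 Z' Y2"
    using direct_sum_exists direct_sum_objects[OF Y1] direct_sum_objects[OF Z'] by blast
  have "distinguished D X1 Y2 Z1"
    using distinguished_add_last[OF distinguished_add_first[OF assms(1) X' Y1] Y2 Z'] .
  then have "tower D E Y2 (ks @ ls)"
    using tower_append X1(2) Z1(2) by blast
  moreover have "retract_of D Y Y2"
    using direct_sum_retract Y1 Y2 retract_trans by blast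
  ultimately show ?thesis
    unfolding built_from_iff by blast
qed

end

text \<open>Exactness of a functor seen on objects only: complexity and entropy depend on nothing else.\<close>

locale exact_on_objects = dom: triangulated_category K C + cod: triangulated_category K D
  for K :: "('k, 'r) ring_scheme"
    and C :: "('o, 'm, 'k) tri_cat" and D :: "('p, 'n, 'k) tri_cat" +
  fixes \<phi> :: "'o \<Rightarrow> 'p"
  assumes map_zero: "is_zero C X \<Longrightarrow> is_zero D (\<phi> X)"
    and map_retract: "retract_of C X Y \<Longrightarrow> retract_of D (\<phi> X) (\<phi> Y)"
    and map_isomorphic: "isomorphic C X Y \<Longrightarrow> isomorphic D (\<phi> X) (\<phi> Y)"
    and map_distinguished: "distinguished C X Y Z \<Longrightarrow> distinguished D (\<phi> X) (\<phi> Y) (\<phi> Z)"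
    and map_shift: "X \<in> Ob C \<Longrightarrow> isomorphic D (\<phi> (fobj (Shift C) X)) (fobj (Shift D) (\<phi> X))"
begin

lemma map_object: "X \<in> Ob C \<Longrightarrow> \<phi> X \<in> Ob D"
  using dom.isomorphic_refl map_isomorphic cod.isomorphic_objects by blast

lemma map_unshift:
  assumes X: "X \<in> Ob C"
  shows "isomorphic D (\<phi> (fobj (Unshift C) X)) (fobj (Unshift D) (\<phi> X))"
proof -
  note UX = dom.unshift.map_object[OF X]
  have "isomorphic D (fobj (Shift D) (\<phi> (fobj (Unshift C) X))) (\<phi> X)"
    by (rule cod.isomorphic_trans[OF cod.isomorphic_sym[OF map_shift[OF UX]]
          map_isomorphic[OF dom.shift_unshift_iso[OF X]]])
  from cod.unshift.map_isomorphic[OF this] show ?thesis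
    by (rule cod.isomorphic_trans[OF cod.isomorphic_sym[OF cod.unshift_shift_iso[OF map_object[OF UX]]]])
qed

lemma map_shift_by:
  assumes X: "X \<in> Ob C"
  shows "isomorphic D (\<phi> (fobj (shift_by C n) X)) (fobj (shift_by D n) (\<phi> X))"
proof (induction n rule: int_induct[where k = 0])
  case base
  then show ?case
    using cod.isomorphic_refl[OF map_object[OF X]] by simp
next
  case (step1 n)
  have "isomorphic D (\<phi> (fobj (Shift C) (fobj (shift_by C n) X))) (fobj (Shift D) (fobj (shift_by D n) (\<phi> X)))"
    by (rule cod.isomorphic_trans[OF map_shift[OF dom.shift_by_object[OF X]]
          cod.shift.map_isomorphic[OF step1(2)]])
  from cod.isomorphic_trans[OF this cod.shift_by_succ[OF map_object[OF X]]] show ?case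
    by (rule cod.isomorphic_trans[OF cod.isomorphic_sym[OF map_isomorphic[OF dom.shift_by_succ[OF X]]]])
next
  case (step2 n)
  have "isomorphic D (\<phi> (fobj (Unshift C) (fobj (shift_by C n) X))) (fobj (Unshift D) (fobj (shift_by D n) (\<phi> X)))"
    by (rule cod.isomorphic_trans[OF map_unshift[OF dom.shift_by_object[OF X]]
          cod.unshift.map_isomorphic[OF step2(2)]])
  from cod.isomorphic_trans[OF this cod.shift_by_pred[OF map_object[OF X]]] show ?case
    by (rule cod.isomorphic_trans[OF cod.isomorphic_sym[OF map_isomorphic[OF dom.shift_by_pred[OF X]]]])
qed

lemma map_tower:
  assumes "E \<in> Ob C" "tower C E X ns"
  shows "tower D (\<phi> E) (\<phi> X) ns"
  using assms(2)
proof induction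
  case (tower_Nil X)
  then show ?case
    by (rule tower.tower_Nil[OF map_zero])
next
  case (tower_snoc X ns Y n)
  note T = tower_snoc.hyps(2)
  have "distinguished D (\<phi> X) (\<phi> Y) (fobj (shift_by D n) (\<phi> E))"
    using cod.distinguished_iso[OF map_distinguished[OF T] _ _ map_shift_by[OF assms(1)]]
      cod.isomorphic_refl map_object dom.distinguished_objects(1,2)[OF T] by simp
  then show ?case
    by (rule tower.tower_snoc[OF tower_snoc.IH])
qed

lemma map_built_from: "E \<in> Ob C \<Longrightarrow> built_from C E F ns \<Longrightarrow> built_from D (\<phi> E) (\<phi> F) ns"
  using map_tower map_retract unfolding dom.built_from_iff cod.built_from_iff by blast

end

lemma exact_on_objects_comp:
  assumes "exact_on_objects K C D \<phi>" "exact_on_objects K D E \<psi>"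
  shows "exact_on_objects K C E (\<lambda>X. \<psi> (\<phi> X))"
proof -
  interpret F: exact_on_objects K C D \<phi> by fact
  interpret G: exact_on_objects K D E \<psi> by fact
  show ?thesis
  proof unfold_locales
    show "isomorphic E (\<psi> (\<phi> (fobj (Shift C) X))) (fobj (Shift E) (\<psi> (\<phi> X)))" if "X \<in> Ob C" for X
      by (rule G.cod.isomorphic_trans[OF G.map_isomorphic[OF F.map_shift[OF that]]
            G.map_shift[OF F.map_object[OF that]]])
  qed (simp_all add: F.map_zero G.map_zero F.map_retract G.map_retract F.map_isomorphic G.map_isomorphic
      F.map_distinguished G.map_distinguished)
qed

text \<open>Stated with only the target triangulated, so that \<open>C\<close> may also be the
  homotopy category \<open>H0 A\<close>; what is asked of \<open>C\<close> is the single object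
  condition on the shifted vertex.\<close>

lemma (in triangulated_category) exact_functor_distinguished:
  assumes F: "exact_functor K C D F" and T: "exact_triangle C f g h X Y Z"
    and SX: "fobj (Shift C) X \<in> Ob C"
  shows "distinguished D (fobj F X) (fobj F Y) (fobj F Z)"
proof -
  obtain \<theta> where \<theta>: "nat_iso C D (F \<odot>\<^sub>F Shift C) (Shift D \<odot>\<^sub>F F) \<theta>"
    and ex: "\<And>f g h. (f, g, h) \<in> Triangles C
      \<Longrightarrow> (farr F f, farr F g, \<theta> (Dom C f) \<cdot>\<^bsub>D\<^esub> farr F h) \<in> Triangles D"
    using F unfolding exact_functor_def by blast
  have t: "X \<in> Ob C" "Y \<in> Ob C" "Z \<in> Ob C" "f \<in> Hom C X Y" "g \<in> Hom C Y Z"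
    "h \<in> Hom C Z (fobj (Shift C) X)" "(f, g, h) \<in> Triangles C"
    using T unfolding exact_triangle_def triangle_shape_def by auto
  have \<theta>X: "\<theta> X \<in> Hom D (fobj F (fobj (Shift C) X)) (fobj (Shift D) (fobj F X))"
    using nat_iso_component(1)[OF \<theta> t(1)] by simp
  have lin: "\<And>X. X \<in> Ob C \<Longrightarrow> fobj F X \<in> Ob D"
    "\<And>X Y f. \<lbrakk>X \<in> Ob C; Y \<in> Ob C; f \<in> Hom C X Y\<rbrakk> \<Longrightarrow> farr F f \<in> Hom D (fobj F X) (fobj F Y)"
    using F unfolding exact_functor_def linear_functor_def by blast+
  have "farr F f \<in> Hom D (fobj F X) (fobj F Y)" "farr F g \<in> Hom D (fobj F Y) (fobj F Z)"
    "\<theta> X \<cdot>\<^bsub>D\<^esub> farr F h \<in> Hom D (fobj F Z) (fobj (Shift D) (fobj F X))"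
    using lin(2)[OF t(1,2,4)] lin(2)[OF t(2,3,5)] comp_hom[OF lin(2)[OF t(3) SX t(6)] \<theta>X] .
  moreover have "(farr F f, farr F g, \<theta> X \<cdot>\<^bsub>D\<^esub> farr F h) \<in> Triangles D"
    using ex[OF t(7)] t(4) unfolding Hom_def by simp
  ultimately show ?thesis
    using lin(1) t(1-3) unfolding distinguished_def exact_triangle_def triangle_shape_def by blast
qed

lemma exact_functor_on_objects:
  assumes "triangulated_category K C" "triangulated_category K D" "exact_functor K C D F"
  shows "exact_on_objects K C D (fobj F)"
proof -
  interpret C: triangulated_category K C by fact
  interpret D: triangulated_category K D by fact
  interpret F: functor_between K C D F
    using assms(3) unfolding exact_functor_def by unfold_locales blast
  obtain \<theta> where \<theta>: "nat_iso C D (F \<odot>\<^sub>F Shift C) (Shift D \<odot>\<^sub>F F) \<theta>"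
    using assms(3) unfolding exact_functor_def by blast
  show ?thesis
  proof unfold_locales
    show "isomorphic D (fobj F (fobj (Shift C) X)) (fobj (Shift D) (fobj F X))" if "X \<in> Ob C" for X
      using naturally_isomorphic_objects[of C D "F \<odot>\<^sub>F Shift C" "Shift D \<odot>\<^sub>F F" X] \<theta> that
      unfolding naturally_isomorphic_def by auto
    show "distinguished D (fobj F X) (fobj F Y) (fobj F Z)" if "distinguished C X Y Z" for X Y Z
      using D.exact_functor_distinguished[OF assms(3)] C.shift.map_object[OF C.distinguished_objects(1)[OF that]]
        that unfolding distinguished_def[of C] by blast
  qed (simp_all add: F.map_zero F.map_retract F.map_isomorphic)
qed

section \<open>Substitution of towers, thick subcategories and split-generators\<close>

context triangulated_category
begin

lemma identity_on_objects: "exact_on_objects K D D (\<lambda>X. X)"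
  by unfold_locales (simp_all add: isomorphic_refl shift.map_object)

lemma shift_on_objects: "exact_on_objects K D D (fobj (Shift D))"
  by unfold_locales (simp_all add: shift.map_zero shift.map_retract shift.map_isomorphic
      distinguished_shift isomorphic_refl shift.map_object)

lemma unshift_on_objects: "exact_on_objects K D D (fobj (Unshift D))"
proof unfold_locales
  show "isomorphic D (fobj (Unshift D) (fobj (Shift D) X)) (fobj (Shift D) (fobj (Unshift D) X))"
    if "X \<in> Ob D" for X
    by (rule isomorphic_trans[OF unshift_shift_iso[OF that] isomorphic_sym[OF shift_unshift_iso[OF that]]])
qed (simp_all add: unshift.map_zero unshift.map_retract unshift.map_isomorphic distinguished_unshift)

lemma iterate_on_objects:
  assumes "exact_on_objects K D D \<phi>"
  shows "exact_on_objects K D D (\<phi> ^^ n)"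
proof (induction n)
  case 0
  then show ?case
    using identity_on_objects by (simp add: id_def)
next
  case (Suc n)
  then show ?case
    using exact_on_objects_comp[OF Suc assms] by (simp add: comp_def)
qed

lemma shift_by_on_objects: "exact_on_objects K D D (fobj (shift_by D n))"
proof -
  have "fobj (shift_by D n) = (if 0 \<le> n then fobj (Shift D) ^^ nat n else fobj (Unshift D) ^^ nat (- n))"
    by (rule ext) (simp add: fobj_shift_by)
  then show ?thesis
    using iterate_on_objects[OF shift_on_objects] iterate_on_objects[OF unshift_on_objects] by simp
qed

text \<open>For \<open>m\<close> and \<open>n\<close> of opposite signs this rests on
  \<open>Unshift\<close> being a quasi-inverse, hence an isomorphism only, and an induction on
  \<open>m\<close> in both directions from 0.\<close>

lemma shift_by_add:
  assumes "X \<in> Ob D"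
  shows "isomorphic D (fobj (shift_by D m) (fobj (shift_by D n) X)) (fobj (shift_by D (m + n)) X)"
proof (induction m rule: int_induct[where k = 0])
  case base
  then show ?case
    using isomorphic_refl[OF shift_by_object[OF assms]] by simp
next
  case (step1 m)
  have "isomorphic D (fobj (Shift D) (fobj (shift_by D m) (fobj (shift_by D n) X))) (fobj (shift_by D (m + n + 1)) X)"
    by (rule isomorphic_trans[OF shift.map_isomorphic[OF step1(2)] shift_by_succ[OF assms]])
  from isomorphic_trans[OF isomorphic_sym[OF shift_by_succ[OF shift_by_object[OF assms]]] this]
  show ?case
    by (simp add: ac_simps)
next
  case (step2 m)
  have "isomorphic D (fobj (Unshift D) (fobj (shift_by D m) (fobj (shift_by D n) X))) (fobj (shift_by D (m + n - 1)) X)"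
    by (rule isomorphic_trans[OF unshift.map_isomorphic[OF step2(2)] shift_by_pred[OF assms]])
  from isomorphic_trans[OF isomorphic_sym[OF shift_by_pred[OF shift_by_object[OF assms]]] this]
  show ?case
    by (simp add: algebra_simps)
qed

lemma tower_shift_by:
  assumes E: "E \<in> Ob D" and X: "tower D E X ns"
  shows "tower D E (fobj (shift_by D k) X) (map ((+) k) ns)"
proof -
  interpret S: exact_on_objects K D D "fobj (shift_by D k)"
    by (rule shift_by_on_objects)
  show ?thesis
    using X
  proof induction
    case (tower_Nil X)
    then show ?case
      using tower.tower_Nil[OF S.map_zero[OF tower_Nil]] by simp
  next
    case (tower_snoc X ns Y n)
    note T = tower_snoc.hyps(2)
    have "distinguished D (fobj (shift_by D k) X) (fobj (shift_by D k) Y) (fobj (shift_by D (k + n)) E)"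
      using distinguished_iso[OF S.map_distinguished[OF T] _ _ shift_by_add[OF E]] isomorphic_refl
        distinguished_objects(1,2)[OF T] shift_by_object by simp
    then show ?case
      using tower.tower_snoc[OF tower_snoc.IH] by simp
  qed
qed

lemma built_from_shift_by:
  assumes "E \<in> Ob D" "built_from D E F ns"
  shows "built_from D E (fobj (shift_by D k) F) (map ((+) k) ns)"
  using assms tower_shift_by exact_on_objects.map_retract[OF shift_by_on_objects]
  unfolding built_from_iff by blast

text \<open>Each piece \<open>F[m]\<close> of a tower for \<open>G\<close> is replaced by the pieces
  of \<open>F\<close> shifted by \<open>m\<close>, so the new list consists of all sums
  \<open>m + n\<close>.\<close>

lemma built_from_trans:
  assumes E: "E \<in> Ob D" and F: "built_from D E F ns" and G: "built_from D F G ms"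
  shows "built_from D E G (concat (map (\<lambda>m. map ((+) m) ns) ms))"
proof -
  have "built_from D E X (concat (map (\<lambda>m. map ((+) m) ns) ms))" if "tower D F X ms" for X
    using that
  proof induction
    case (tower_Nil X)
    then show ?case
      using built_from_zero by simp
  next
    case (tower_snoc X ms Y m)
    then show ?case
      using built_from_extension[OF tower_snoc.hyps(2) tower_snoc.IH built_from_shift_by[OF E F, of m]] by simp
  qed
  then show ?thesis
    using G built_from_retract unfolding built_from_iff[of F] by blast
qed

text \<open>Closure under cones follows by rotation: \<open>Z\<close> is an extension of
  \<open>X[1]\<close> by \<open>Y\<close>. Thickness turns the abstract notion of a split-generator
  into actual towers.\<close>

lemma thick_built_from:
  assumes E: "E \<in> Ob D"
  shows "thick_subcategory D {F. \<exists>ns. built_from D E F ns}"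
  unfolding thick_subcategory_def
proof (intro conjI ballI allI impI subsetI)
  fix X
  assume "X \<in> {F. \<exists>ns. built_from D E F ns}"
  then obtain ns where ns: "built_from D E X ns"
    by blast
  then show "X \<in> Ob D"
    by (rule built_from_object)
  show "fobj (Shift D) X \<in> {F. \<exists>ns. built_from D E F ns}"
    using built_from_shift_by[OF E ns, of 1] by (auto simp: fobj_shift_by)
  show "fobj (Unshift D) X \<in> {F. \<exists>ns. built_from D E F ns}"
    using built_from_shift_by[OF E ns, of "-1"] by (auto simp: fobj_shift_by)
next
  fix X
  assume "X \<in> {X. is_zero D X}"
  then show "X \<in> {F. \<exists>ns. built_from D E F ns}"
    using built_from_zero by blast
next
  fix f g h X Y Z
  assume T: "exact_triangle D f g h X Y Z \<and> X \<in> {F. \<exists>ns. built_from D E F ns} \<and>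
    Y \<in> {F. \<exists>ns. built_from D E F ns}"
  then obtain ks ls where "built_from D E X ks" "built_from D E Y ls"
    by blast
  moreover have "distinguished D Y Z (fobj (Shift D) X)"
    using T distinguished_rotate unfolding distinguished_def by blast
  ultimately have "built_from D E Z (ls @ map ((+) 1) ks)"
    using built_from_extension built_from_shift_by[OF E, of X ks 1] by (simp add: fobj_shift_by)
  then show "Z \<in> {F. \<exists>ns. built_from D E F ns}"
    by blast
next
  fix X Y Z
  assume "is_direct_sum D X Y Z \<and> Z \<in> {F. \<exists>ns. built_from D E F ns}"
  then show "X \<in> {F. \<exists>ns. built_from D E F ns}"
    using built_from_retract direct_sum_retract by blast
qed

lemma split_generator_object: "split_generator D G \<Longrightarrow> G \<in> Ob D"
  unfolding split_generator_def by blast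

lemma split_generator_builds:
  assumes "split_generator D G" "F \<in> Ob D"
  shows "\<exists>ns. built_from D G F ns"
  using assms thick_built_from[OF split_generator_object[OF assms(1)]]
    built_from_self[OF split_generator_object[OF assms(1)]]
  unfolding split_generator_def by blast

lemma split_generator_retract:
  assumes G: "split_generator D G" and r: "retract_of D G G'"
  shows "split_generator D G'"
proof -
  obtain H where "is_direct_sum D G H G'"
    using r retract_complement by blast
  then have "G \<in> P" if "thick_subcategory D P" "G' \<in> P" for P
    using that unfolding thick_subcategory_def by blast
  \<comment> \<open>Bounds the intersection in \<open>split_generator\<close> from above.\<close>
  moreover have "thick_subcategory D (Ob D)"
    unfolding thick_subcategory_def
    using zero_object shift.map_object unshift.map_object exact_triangleD(6) direct_sum_objects by blast
  ultimately show ?thesis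
    using G retract_objects(2)[OF r] unfolding split_generator_def by blast
qed

end


section \<open>Complexity and entropy\<close>

abbreviation weight :: "real \<Rightarrow> int list \<Rightarrow> real" where
  "weight t ns \<equiv> (\<Sum>n\<leftarrow>ns. exp (real_of_int n * t))"

lemma weight_nonneg: "0 \<le> weight t ns"
  by (induction ns) simp_all

lemma weight_translate: "weight t (map ((+) m) ns) = exp (real_of_int m * t) * weight t ns"
  by (induction ns) (simp_all add: exp_add algebra_simps)

text \<open>The sum over all \<open>m + n\<close> factors into the two weights; this identity is the
  source of submultiplicativity.\<close>

lemma weight_concat: "weight t (concat (map (\<lambda>m. map ((+) m) ns) ms)) = weight t ns * weight t ms"
proof (induction ms)
  case (Cons m ms)
  have "weight t (concat (map (\<lambda>m. map ((+) m) ns) (m # ms))) =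
      weight t (map ((+) m) ns) + weight t (concat (map (\<lambda>m. map ((+) m) ns) ms))"
    by simp
  then show ?case
    unfolding weight_translate Cons by (simp add: algebra_simps)
qed simp

text \<open>Dividing by \<open>c\<close> reduces the claim to the defining property of the infimum,
  but in \<open>ennreal\<close> multiplication undoes division only for
  \<open>0 < c < \<infinity>\<close>. For \<open>c = 0\<close> any member of \<open>A\<close> forces
  \<open>x = 0\<close>.\<close>

lemma ennreal_le_Inf_mult:
  fixes x c :: ennreal
  assumes "A \<noteq> {}" "c < \<infinity>" "\<And>a. a \<in> A \<Longrightarrow> x \<le> a * c"
  shows "x \<le> Inf A * c"
proof (cases "c = 0")
  case True
  then show ?thesis
    using assms by fastforce
next
  case False
  then have "x / c \<le> a" if "a \<in> A" for a
    using divide_le_posI_ennreal[of c x a] assms(3)[OF that] by (simp add: mult.commute zero_less_iff_neq_zero)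
  then have "x / c * c \<le> Inf A * c"
    by (intro mult_right_mono Inf_greatest) auto
  moreover have "x / c * c = x"
    using ennreal_times_divide[of c x c] mult_divide_eq_ennreal[of c x] False assms(2) by (simp add: mult.commute)
  ultimately show ?thesis
    by simp
qed

context triangulated_category
begin

text \<open>The clause for \<open>F \<cong> 0\<close> is redundant: the empty tower has weight \<open>0\<close>.\<close>

lemma complexity_Inf: "complexity D t E F = Inf {ennreal (weight t ns) | ns. built_from D E F ns}"
proof (cases "is_zero D F")
  case True
  then have "0 \<in> {ennreal (weight t ns) | ns. built_from D E F ns}"
    using built_from_zero[OF True] by (auto intro!: exI[of _ "[]"])
  then have "Inf {ennreal (weight t ns) | ns. built_from D E F ns} = 0"
    by (meson Inf_lower le_zero_eq)
  then show ?thesis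
    unfolding complexity_def using True by simp
next
  case False
  then show ?thesis
    unfolding complexity_def by simp
qed

lemma complexity_le: "built_from D E F ns \<Longrightarrow> complexity D t E F \<le> ennreal (weight t ns)"
  unfolding complexity_Inf by (rule Inf_lower) blast

lemma complexity_finite:
  assumes "built_from D E F ns"
  shows "complexity D t E F < \<infinity>"
proof -
  have "complexity D t E F \<le> ennreal (weight t ns)"
    by (rule complexity_le[OF assms])
  also have "\<dots> < \<infinity>"
    by simp
  finally show ?thesis .
qed

text \<open>Substituting towers bounds the left side by a product of weights. The two infima are
  then taken one after the other, and each time the fixed factor has to be finite.\<close>

lemma complexity_submultiplicative:
  assumes E: "E \<in> Ob D" and F: "built_from D E F ns" and G: "built_from D F G ms"
  shows "complexity D t E G \<le> complexity D t E F * complexity D t F G"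
proof -
  have le: "complexity D t E G \<le> ennreal (weight t ks) * ennreal (weight t ls)"
    if "built_from D E F ks" "built_from D F G ls" for ks ls
    using complexity_le[OF built_from_trans[OF E that], of t]
    by (simp add: weight_concat ennreal_mult weight_nonneg)
  have left: "complexity D t E G \<le> complexity D t E F * ennreal (weight t ls)"
    if "built_from D F G ls" for ls
    unfolding complexity_Inf[of t E F]
    by (rule ennreal_le_Inf_mult) (use F le[OF _ that] in auto)
  have "complexity D t E G \<le> complexity D t F G * complexity D t E F"
    unfolding complexity_Inf[of t F G]
    by (rule ennreal_le_Inf_mult) (use G left complexity_finite[OF F] in \<open>auto simp: mult.commute\<close>)
  then show ?thesis
    by (simp add: mult.commute)
qed

lemma complexity_retract: "retract_of D F F' \<Longrightarrow> complexity D t E F \<le> complexity D t E F'"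
  unfolding complexity_Inf by (rule Inf_superset_mono) (use built_from_retract in blast)

lemma complexity_iso: "isomorphic D F F' \<Longrightarrow> complexity D t E F = complexity D t E F'"
  by (intro antisym complexity_retract isomorphic_retract) (auto intro: isomorphic_sym)

end

lemma (in exact_on_objects) complexity_map:
  assumes "E \<in> Ob C"
  shows "complexity D t (\<phi> E) (\<phi> F) \<le> complexity C t E F"
  unfolding dom.complexity_Inf cod.complexity_Inf
  by (rule Inf_superset_mono) (use map_built_from[OF assms] in blast)

text \<open>The sequence in the definition of \<open>entropy\<close>, for arbitrary
  \<open>a\<close>. At \<open>n = 0\<close> it is 0, as division by zero gives 0; the limit is not
  affected.\<close>

definition growth :: "(nat \<Rightarrow> ennreal) \<Rightarrow> nat \<Rightarrow> ereal" where
  "growth a n = ereal (1 / real n) * log_ennreal (a n)"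

text \<open>For fixed \<open>m\<close>, division with remainder \<open>n = q m + r\<close> compares
  \<open>u n / n\<close> with \<open>u m / m\<close>. The infimum is taken in \<open>ereal\<close>,
  where it may be \<open>- \<infinity>\<close>, and leaves out the index 0, where the quotient would
  be 0.\<close>

lemma Fekete:
  fixes u :: "nat \<Rightarrow> real"
  assumes sub: "\<And>m n. u (m + n) \<le> u m + u n"
  shows "(\<lambda>n. ereal (u n / real n)) \<longlonglongrightarrow> (INF n\<in>{1..}. ereal (u n / real n))"
proof (rule order_tendstoI)
  fix l assume l: "l < (INF n\<in>{1..}. ereal (u n / real n))"
  have "l < ereal (u n / real n)" if "1 \<le> n" for n
    using l INF_lower[of n "{1..}" "\<lambda>n. ereal (u n / real n)"] that by (auto intro: less_le_trans)
  then show "\<forall>\<^sub>F n in sequentially. l < ereal (u n / real n)"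
    using eventually_ge_at_top[of 1] by (rule eventually_mono[rotated]) auto
next
  fix l assume "(INF n\<in>{1..}. ereal (u n / real n)) < l"
  then obtain m where m: "1 \<le> m" "ereal (u m / real m) < l"
    by (auto simp: INF_less_iff)
  have mult: "u (q * m + r) \<le> real q * u m + u r" for q r
  proof (induction q)
    case (Suc q)
    have "u (Suc q * m + r) \<le> u m + u (q * m + r)"
      using sub[of m "q * m + r"] by (simp add: algebra_simps)
    then show ?case
      using Suc by (simp add: algebra_simps)
  qed simp
  define M where "M = Max ((\<lambda>r. \<bar>u r\<bar>) ` {..<m})"
  have M: "u r \<le> M" if "r < m" for r
  proof -
    have "\<bar>u r\<bar> \<le> M"
      unfolding M_def by (rule Max_ge) (use that in auto)
    then show ?thesis by simp
  qed
  \<comment> \<open>\<open>M\<close> bounds the remainder term \<open>u r\<close>, and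
    \<open>\<bar>u m\<bar>\<close> absorbs the error of replacing \<open>q\<close> by
    \<open>n / m\<close>; after division by \<open>n\<close> both errors tend to 0.\<close>
  have bound: "u n / real n \<le> u m / real m + (\<bar>u m\<bar> + M) / real n" if n: "1 \<le> n" for n
  proof -
    define q r where "q = n div m" and "r = n mod m"
    have nqr: "n = q * m + r" "r < m"
      using m(1) unfolding q_def r_def by (simp_all add: div_mult_mod_eq)
    have "real n = real q * real m + real r"
      using nqr(1) by simp
    then have q: "real q = (real n - real r) / real m"
      using m(1) by (simp add: field_simps)
    have "u n \<le> real q * u m + M"
      using mult[of q r] M[OF nqr(2)] nqr(1) by simp
    also have "real q * u m = real n * (u m / real m) - real r / real m * u m"
      unfolding q by (simp add: field_simps diff_divide_distrib)
    finally have "u n \<le> real n * (u m / real m) - real r / real m * u m + M" .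
    moreover have "- (real r / real m * u m) \<le> \<bar>u m\<bar>"
    proof -
      have "- (real r / real m * u m) \<le> real r / real m * \<bar>u m\<bar>"
        using mult_left_mono[of "- u m" "\<bar>u m\<bar>" "real r / real m"] by simp
      also have "\<dots> \<le> 1 * \<bar>u m\<bar>"
        using nqr(2) by (intro mult_right_mono) auto
      finally show ?thesis by simp
    qed
    ultimately have "u n \<le> real n * (u m / real m) + (\<bar>u m\<bar> + M)"
      by linarith
    from divide_right_mono[OF this, of "real n"] show ?thesis
      using n by (simp add: add_divide_distrib)
  qed
  have "(\<lambda>n. u m / real m + (\<bar>u m\<bar> + M) / real n) \<longlonglongrightarrow> u m / real m + 0"
    by (intro tendsto_intros lim_const_over_n)
  then have "(\<lambda>n. ereal (u m / real m + (\<bar>u m\<bar> + M) / real n)) \<longlonglongrightarrow> ereal (u m / real m)"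
    by simp
  from order_tendstoD(2)[OF this m(2)]
  have "\<forall>\<^sub>F n in sequentially. ereal (u m / real m + (\<bar>u m\<bar> + M) / real n) < l" .
  then show "\<forall>\<^sub>F n in sequentially. ereal (u n / real n) < l"
    using eventually_ge_at_top[of 1]
  proof eventually_elim
    case (elim n)
    then show ?case
      using bound[of n] by (meson ereal_less_eq(3) le_less_trans)
  qed
qed

lemma log_ennreal_pos: "0 < x \<Longrightarrow> log_ennreal (ennreal x) = ereal (ln x)"
  unfolding log_ennreal_def by simp

lemma growth_converges:
  assumes fin: "\<And>n. a n < \<infinity>" and sub: "\<And>m n. a (m + n) \<le> a m * a n"
  shows "\<exists>L. growth a \<longlonglongrightarrow> L"
proof (cases "\<exists>k. a k = 0")
  case True
  then obtain k where k: "a k = 0"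
    by blast
  have "a n = 0" if "k \<le> n" for n
    using sub[of k "n - k"] k that by simp
  then have "growth a n = -\<infinity>" if "max k 1 \<le> n" for n
    using that unfolding growth_def log_ennreal_def by simp
  then have "\<forall>\<^sub>F n in sequentially. growth a n = -\<infinity>"
    using eventually_ge_at_top[of "max k 1"] by (rule eventually_mono[rotated]) auto
  then show ?thesis
    using tendsto_eventually by blast
next
  case False
  define u where "u n = ln (enn2real (a n))" for n
  have pos: "0 < enn2real (a n)" for n
    using False fin[of n] by (simp add: enn2real_positive_iff zero_less_iff_neq_zero)
  have "log_ennreal (a n) = ereal (u n)" for n
    using log_ennreal_pos[OF pos[of n]] fin[of n] unfolding u_def by simp
  then have "growth a = (\<lambda>n. ereal (u n / real n))"
    unfolding growth_def by simp
  moreover have "u (m + n) \<le> u m + u n" for m n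
  proof -
    have "enn2real (a (m + n)) \<le> enn2real (a m * a n)"
      using sub fin[of m] fin[of n] by (intro enn2real_mono) (simp_all add: ennreal_mult_less_top)
    also have "\<dots> = enn2real (a m) * enn2real (a n)"
      by (simp add: enn2real_mult)
    finally have "u (m + n) \<le> ln (enn2real (a m) * enn2real (a n))"
      unfolding u_def using pos ln_mono by blast
    then show ?thesis
      unfolding u_def using ln_mult_pos[OF pos[of m] pos[of n]] by simp
  qed
  ultimately have "growth a \<longlonglongrightarrow> (INF n\<in>{1..}. ereal (u n / real n))"
    using Fekete[of u] by simp
  then show ?thesis
    by blast
qed

lemma growth_const:
  assumes "0 < c" "c < \<infinity>"
  shows "growth (\<lambda>_. c) \<longlonglongrightarrow> 0"
proof -
  obtain r where r: "c = ennreal r" "0 < r"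
    using assms by (cases c) auto
  have "growth (\<lambda>_. c) = (\<lambda>n. ereal (ln r / real n))"
    unfolding growth_def r(1) log_ennreal_pos[OF r(2)] by simp
  moreover have "(\<lambda>n. ereal (ln r / real n)) \<longlonglongrightarrow> ereal 0"
    using lim_const_over_n by simp
  ultimately show ?thesis
    by (simp add: zero_ereal_def)
qed

lemma growth_le:
  assumes le: "b n \<le> ennreal r * a n" and r: "1 \<le> r" and a: "a n < \<infinity>" and n: "1 \<le> n"
  shows "growth b n \<le> ereal (ln r / real n) + growth a n"
proof (cases "b n = 0")
  case True
  then have "growth b n = -\<infinity>"
    using n unfolding growth_def log_ennreal_def by simp
  then show ?thesis
    by simp
next
  case False
  obtain x where x: "a n = ennreal x" "0 \<le> x"
    using a by (cases "a n") auto
  have le': "b n \<le> ennreal (r * x)"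
    using le x r by (simp add: ennreal_mult)
  obtain y where y: "b n = ennreal y" "0 < y"
    using False le' by (cases "b n") (auto simp: top_unique)
  have yx: "y \<le> r * x"
    using le' y(1) ennreal_le_iff[of "r * x" y] r x(2) by simp
  then have "0 < x"
    using y(2) x(2) by (cases "x = 0") simp_all
  moreover have "ln y \<le> ln r + ln x"
    using ln_mono[OF yx y(2)] ln_mult_pos[of r x] r \<open>0 < x\<close> by simp
  ultimately show ?thesis
    using n unfolding growth_def x(1) y(1) log_ennreal_pos[OF y(2)]
    by (simp add: log_ennreal_pos add_divide_distrib[symmetric] divide_right_mono)
qed

text \<open>The factor \<open>c\<close> contributes \<open>ln r / n\<close>, which tends to 0. As
  the limits may be infinite, the comparison goes through two reals \<open>q < s\<close> strictly
  between \<open>L\<close> and a supposedly larger \<open>L'\<close>.\<close>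

lemma growth_limit_mono:
  assumes le: "\<And>n. b n \<le> c * a n" and c: "c < \<infinity>" and a: "\<And>n. a n < \<infinity>"
    and L: "growth a \<longlonglongrightarrow> L" and L': "growth b \<longlonglongrightarrow> L'"
  shows "L' \<le> L"
proof (rule ccontr)
  assume "\<not> L' \<le> L"
  then obtain q where q: "L < ereal q" "ereal q < L'"
    using ereal_dense2[of L L'] by (auto simp: not_le)
  then obtain s where s: "q < s" "ereal s < L'"
    using ereal_dense2[of "ereal q" L'] by auto
  \<comment> \<open>Raising the factor to at least 1 keeps its logarithm finite and nonnegative even
    when \<open>c = 0\<close>.\<close>
  define r where "r = max 1 (enn2real c)"
  have r: "1 \<le> r" "c \<le> ennreal r"
    using c unfolding r_def by (cases c; simp add: max_def)+
  have "(\<lambda>n. ln r / real n) \<longlonglongrightarrow> 0"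
    by (rule lim_const_over_n)
  from order_tendstoD(2)[OF this, of "s - q"]
  have "\<forall>\<^sub>F n in sequentially. ln r / real n < s - q"
    using s(1) by simp
  moreover note order_tendstoD(2)[OF L q(1)] order_tendstoD(1)[OF L' s(2)] eventually_ge_at_top[of 1]
  ultimately have "\<forall>\<^sub>F n in sequentially. False"
  proof eventually_elim
    case (elim n)
    have "b n \<le> ennreal r * a n"
      using le[of n] r(2) by (meson mult_right_mono order_trans zero_le)
    then have "growth b n \<le> ereal (ln r / real n) + growth a n"
      using growth_le[of b n r a] r(1) a elim(4) by blast
    also have "\<dots> \<le> ereal (s - q) + ereal q"
      using elim(1,2) by (intro add_mono) auto
    finally show False
      using elim(3) by simp
  qed
  then show False
    by simp
qed

section \<open>Entropy as the limit for any split-generator\<close>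

context triangulated_category
begin

text \<open>\<open>entropy\<close> is a definite description over all split-generators, so it can be
  evaluated only once convergence and independence of the generator are both known.\<close>

lemma entropy_limit:
  assumes \<Phi>: "exact_on_objects K D D (fobj \<Phi>)" and G: "split_generator D G"
  shows "growth (\<lambda>n. complexity D t G ((fobj \<Phi> ^^ n) G)) \<longlonglongrightarrow> entropy D t \<Phi>"
proof -
  let ?a = "\<lambda>G n. complexity D t G ((fobj \<Phi> ^^ n) G)"
  have iter: "exact_on_objects K D D (fobj \<Phi> ^^ n)" for n
    by (rule iterate_on_objects[OF \<Phi>])
  have built: "\<exists>ns. built_from D G ((fobj \<Phi> ^^ n) H) ns" if "split_generator D G" "H \<in> Ob D" for G H n
    using split_generator_builds[OF that(1)] exact_on_objects.map_object[OF iter that(2)] .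
  have fin: "?a G n < \<infinity>" if "split_generator D G" for G n
    using built[OF that split_generator_object[OF that]] complexity_finite by blast
  have conv: "\<exists>L. growth (?a G) \<longlonglongrightarrow> L" if G: "split_generator D G" for G
  proof (rule growth_converges[OF fin[OF G]])
    fix m n
    note GO = split_generator_object[OF G]
    interpret I: exact_on_objects K D D "fobj \<Phi> ^^ m"
      by (rule iter)
    obtain ks where ks: "built_from D G ((fobj \<Phi> ^^ m) G) ks"
      using built[OF G GO] by blast
    obtain ls where ls: "built_from D G ((fobj \<Phi> ^^ n) G) ls"
      using built[OF G GO] by blast
    have "?a G (m + n) = complexity D t G ((fobj \<Phi> ^^ m) ((fobj \<Phi> ^^ n) G))"
      by (simp add: funpow_add)
    also have "\<dots> \<le> ?a G m * complexity D t ((fobj \<Phi> ^^ m) G) ((fobj \<Phi> ^^ m) ((fobj \<Phi> ^^ n) G))"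
      by (rule complexity_submultiplicative[OF GO ks I.map_built_from[OF GO ls]])
    also have "\<dots> \<le> ?a G m * ?a G n"
      by (intro mult_left_mono I.complexity_map GO) simp
    finally show "?a G (m + n) \<le> ?a G m * ?a G n" .
  qed
  \<comment> \<open>Comparison along the chain \<open>G'\<close>, \<open>G\<close>,
    \<open>\<Phi>^n G\<close>, \<open>\<Phi>^n G'\<close>: the two outer factors are bounded
    independently of \<open>n\<close>, since \<open>\<Phi>^n\<close> does not increase complexity.
    Exchanging the generators gives equality of the limits.\<close>
  have le: "L' \<le> L" if G: "split_generator D G" "split_generator D G'"
    and L: "growth (?a G) \<longlonglongrightarrow> L" "growth (?a G') \<longlonglongrightarrow> L'" for G G' L L'
  proof (rule growth_limit_mono[OF _ _ fin[OF G(1)] L])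
    note GO = split_generator_object[OF G(1)] and GO' = split_generator_object[OF G(2)]
    obtain ks where ks: "built_from D G' G ks"
      using split_generator_builds[OF G(2) GO] by blast
    obtain ls where ls: "built_from D G G' ls"
      using split_generator_builds[OF G(1) GO'] by blast
    show "complexity D t G' G * complexity D t G G' < \<infinity>"
      using complexity_finite[OF ks] complexity_finite[OF ls] by (simp add: ennreal_mult_less_top)
    fix n
    interpret I: exact_on_objects K D D "fobj \<Phi> ^^ n"
      by (rule iter)
    obtain ms where ms: "built_from D G ((fobj \<Phi> ^^ n) G) ms"
      using built[OF G(1) GO] by blast
    have "?a G' n \<le> complexity D t G' ((fobj \<Phi> ^^ n) G) * complexity D t ((fobj \<Phi> ^^ n) G) ((fobj \<Phi> ^^ n) G')"
      by (rule complexity_submultiplicative[OF GO' built_from_trans[OF GO' ks ms] I.map_built_from[OF GO ls]])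
    also have "\<dots> \<le> (complexity D t G' G * ?a G n) * complexity D t G G'"
      by (intro mult_mono complexity_submultiplicative[OF GO' ks ms] I.complexity_map GO) simp_all
    finally show "?a G' n \<le> complexity D t G' G * complexity D t G G' * ?a G n"
      by (simp add: ac_simps)
  qed
  obtain L where L: "growth (?a G) \<longlonglongrightarrow> L"
    using conv[OF G] by blast
  have all: "growth (?a G') \<longlonglongrightarrow> L" if G': "split_generator D G'" for G'
  proof -
    obtain L' where L': "growth (?a G') \<longlonglongrightarrow> L'"
      using conv[OF G'] by blast
    then have "L' = L"
      using le[OF G G' L L'] le[OF G' G L' L] by simp
    then show ?thesis
      using L' by simp
  qed
  have "entropy D t \<Phi> = L"
    unfolding entropy_def
  proof (rule the_equality)
    show "\<forall>G. split_generator D G \<longrightarrow>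
     (\<lambda>n. ereal (1 / real n) * log_ennreal (complexity D t G ((fobj \<Phi> ^^ n) G))) \<longlonglongrightarrow> L"
      using all unfolding growth_def by blast
    \<comment> \<open>The condition on \<open>h\<close> is not vacuous, because \<open>G\<close> is
      a split-generator.\<close>
    show "h = L" if "\<forall>G. split_generator D G \<longrightarrow>
     (\<lambda>n. ereal (1 / real n) * log_ennreal (complexity D t G ((fobj \<Phi> ^^ n) G))) \<longlonglongrightarrow> h" for h
      using that G L unfolding growth_def by (blast intro: LIMSEQ_unique)
  qed
  then show ?thesis
    using L by simp
qed

end


section \<open>Cones in the homotopy category of a dg category\<close>

context dg_category
begin

lemma dhom_objects:
  assumes "f \<in> dHom A X Y n"
  shows "X \<in> dOb A" "Y \<in> dOb A"
  using assms dg_arrow_ends unfolding dHom_def by auto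

lemma dom_cod_deg:
  assumes "f \<in> dHom A X Y n"
  shows "dDom A f = X" "dCod A f = Y" "dDeg A f = n"
  using assms unfolding dHom_def by auto

lemma dhom_group: "X \<in> dOb A \<Longrightarrow> Y \<in> dOb A \<Longrightarrow> abelian_group (dhom_space A X Y n)"
  by (rule Module.module.axioms(2)[OF dg_hom_module])

lemma dnull_hom: "X \<in> dOb A \<Longrightarrow> Y \<in> dOb A \<Longrightarrow> dNull A X Y n \<in> dHom A X Y n"
  using abelian_monoid.zero_closed[OF abelian_group.axioms(1)[OF dhom_group[of X Y n]]]
  by (simp add: dhom_space_def)

lemma dplus_hom: "f \<in> dHom A X Y n \<Longrightarrow> g \<in> dHom A X Y n \<Longrightarrow> dPlus A f g \<in> dHom A X Y n"
  using abelian_monoid.a_closed[OF abelian_group.axioms(1)[OF dhom_group[of X Y n]], of f g]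
    dhom_objects[of f X Y n] by (simp add: dhom_space_def)

lemma dplus_assoc: "f \<in> dHom A X Y n \<Longrightarrow> g \<in> dHom A X Y n \<Longrightarrow> h \<in> dHom A X Y n
   \<Longrightarrow> dPlus A (dPlus A f g) h = dPlus A f (dPlus A g h)"
  using abelian_monoid.a_assoc[OF abelian_group.axioms(1)[OF dhom_group[of X Y n]], of f g h]
    dhom_objects[of f X Y n] by (simp add: dhom_space_def)

lemma dplus_commute: "f \<in> dHom A X Y n \<Longrightarrow> g \<in> dHom A X Y n \<Longrightarrow> dPlus A f g = dPlus A g f"
  using abelian_monoid.a_comm[OF abelian_group.axioms(1)[OF dhom_group[of X Y n]], of f g]
    dhom_objects[of f X Y n] by (simp add: dhom_space_def)

lemma dnull_plus: "f \<in> dHom A X Y n \<Longrightarrow> dPlus A (dNull A X Y n) f = f"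
  using abelian_monoid.l_zero[OF abelian_group.axioms(1)[OF dhom_group[of X Y n]], of f]
    dhom_objects[of f X Y n] by (simp add: dhom_space_def)

lemma dplus_null: "f \<in> dHom A X Y n \<Longrightarrow> dPlus A f (dNull A X Y n) = f"
  using dnull_plus[of f X Y n] dplus_commute[OF _ dnull_hom, of f X Y n] dhom_objects[of f X Y n] by simp

text \<open>With an odd exponent this is negation in every degree; below, \<open>sgn_pow A 1\<close>
  serves as the minus sign.\<close>

lemma sgn_pow_odd: "f \<in> dHom A X Y m \<Longrightarrow> odd n \<Longrightarrow> sgn_pow A n f \<in> dHom A X Y m \<and>
    dPlus A f (sgn_pow A n f) = dNull A X Y m"
  using abelian_group.a_inv_closed[OF dhom_group[of X Y m], of f] abelian_group.r_neg[OF dhom_group[of X Y m], of f]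
    dhom_objects[of f X Y m] dom_cod_deg[of f X Y m] by (simp add: sgn_pow_def dhom_space_def)

lemma dplus_left_cancel:
  assumes f: "f \<in> dHom A X Y n" and g: "g \<in> dHom A X Y n" and h: "h \<in> dHom A X Y n"
    and eq: "dPlus A f g = dPlus A f h"
  shows "g = h"
proof -
  define f' where "f' = sgn_pow A 1 f"
  have f': "f' \<in> dHom A X Y n" "dPlus A f f' = dNull A X Y n"
    using sgn_pow_odd[OF f, of 1] unfolding f'_def by auto
  have "k = dPlus A f' (dPlus A f k)" if k: "k \<in> dHom A X Y n" for k
    using dplus_assoc[OF f'(1) f k] dplus_commute[OF f f'(1)] f'(2) dnull_plus[OF k] by simp
  from this[OF g] this[OF h] eq show ?thesis
    by simp
qed

lemma didem_null:
  assumes "f \<in> dHom A X Y n" "dPlus A f f = f"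
  shows "f = dNull A X Y n"
  using dplus_left_cancel[OF assms(1,1) dnull_hom] dplus_null[OF assms(1)] dhom_objects[OF assms(1)] assms(2)
  by simp

lemma sgn_pow_null:
  assumes "X \<in> dOb A" "Y \<in> dOb A"
  shows "sgn_pow A n (dNull A X Y m) = dNull A X Y m"
proof (cases "even n")
  case False
  then show ?thesis
    using sgn_pow_odd[OF dnull_hom[OF assms, of m] False] dnull_plus[of _ X Y m] by metis
qed (simp add: sgn_pow_def)

lemma dcomp_null:
  assumes "g \<in> dHom A Y Z n" "X \<in> dOb A"
  shows "g \<bullet>\<^bsub>A\<^esub> dNull A X Y m = dNull A X Z (m + n)"
proof -
  note z = dnull_hom[OF assms(2) dhom_objects(1)[OF assms(1)]]
  show ?thesis
    using didem_null[OF dg_comp_hom[OF z assms(1)]] dg_comp_plus_right[OF z z assms(1)] dnull_plus[OF z] by metis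
qed

lemma dnull_comp:
  assumes "f \<in> dHom A X Y m" "Z \<in> dOb A"
  shows "dNull A Y Z n \<bullet>\<^bsub>A\<^esub> f = dNull A X Z (m + n)"
proof -
  note z = dnull_hom[OF dhom_objects(2)[OF assms(1)] assms(2)]
  show ?thesis
    using didem_null[OF dg_comp_hom[OF assms(1) z]] dg_comp_plus_left[OF assms(1) z z] dnull_plus[OF z] by metis
qed

lemma diff_null:
  assumes "X \<in> dOb A" "Y \<in> dOb A"
  shows "Diff A (dNull A X Y n) = dNull A X Y (n + 1)"
  using didem_null[OF diff_hom[OF dnull_hom[OF assms]]] diff_plus[OF dnull_hom[OF assms] dnull_hom[OF assms]]
    dnull_plus[OF dnull_hom[OF assms]] by metis

lemma diff_comp_closed_right:
  assumes f: "f \<in> dHom A X Y m" "Diff A f = dNull A X Y (m + 1)" and g: "g \<in> dHom A Y Z n"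
  shows "Diff A (g \<bullet>\<^bsub>A\<^esub> f) = Diff A g \<bullet>\<^bsub>A\<^esub> f"
proof -
  have "sgn_pow A n (g \<bullet>\<^bsub>A\<^esub> Diff A f) = dNull A X Z (m + (n + 1))"
    using dcomp_null[OF g dhom_objects(1)[OF f(1)], of "m + 1"] f(2)
      sgn_pow_null dhom_objects[OF f(1)] dhom_objects[OF g] by (simp add: algebra_simps)
  then show ?thesis
    using leibniz[OF f(1) g] dplus_null[OF dg_comp_hom[OF f(1) diff_hom[OF g]]] by simp
qed

lemma diff_comp_closed_left:
  assumes g: "g \<in> dHom A Y Z n" "Diff A g = dNull A Y Z (n + 1)" and f: "f \<in> dHom A X Y m"
  shows "Diff A (g \<bullet>\<^bsub>A\<^esub> f) = sgn_pow A n (g \<bullet>\<^bsub>A\<^esub> Diff A f)"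
proof -
  have gdf: "g \<bullet>\<^bsub>A\<^esub> Diff A f \<in> dHom A X Z (m + (n + 1))"
    using dg_comp_hom[OF diff_hom[OF f] g(1)] by (simp add: algebra_simps)
  then have "sgn_pow A n (g \<bullet>\<^bsub>A\<^esub> Diff A f) \<in> dHom A X Z (m + (n + 1))"
    using sgn_pow_odd[OF gdf] by (cases "even n") (auto simp: sgn_pow_def)
  then show ?thesis
    using leibniz[OF f g(1)] dnull_comp[OF f dhom_objects(2)[OF g(1)], of "n + 1"] g(2) dnull_plus by simp
qed

section \<open>Cosets modulo boundaries and their composition\<close>

lemma cls_eq: "f \<in> dHom A X Y 0 \<Longrightarrow> cls A f = (\<lambda>h. dPlus A f (Diff A h)) ` dHom A X Y (-1)"
  unfolding cls_def using dom_cod_deg[of f X Y 0] by simp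

lemma diff_hom0: "h \<in> dHom A X Y (-1) \<Longrightarrow> Diff A h \<in> dHom A X Y 0"
  using diff_hom[of h X Y "-1"] by simp

lemma rep_cls:
  assumes f: "f \<in> dHom A X Y 0"
  obtains h where "h \<in> dHom A X Y (-1)" "rep (cls A f) = dPlus A f (Diff A h)"
proof -
  have "dNull A X Y (-1) \<in> dHom A X Y (-1)"
    using dnull_hom dhom_objects[OF f] .
  then have "\<exists>x. x \<in> cls A f"
    unfolding cls_eq[OF f] by blast
  then have "rep (cls A f) \<in> cls A f"
    unfolding rep_def by (rule someI_ex)
  then show ?thesis
    using that unfolding cls_eq[OF f] by blast
qed

lemma rep_hom:
  assumes "f \<in> dHom A X Y 0"
  shows "rep (cls A f) \<in> dHom A X Y 0"
  using rep_cls[OF assms] dplus_hom[OF assms diff_hom0] by metis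

text \<open>The boundary only reparametrises the coset: \<open>k\<close> is replaced by
  \<open>h + k\<close> in one direction and by \<open>k - h\<close> in the other.\<close>

lemma cls_add_boundary:
  assumes f: "f \<in> dHom A X Y 0" and h: "h \<in> dHom A X Y (-1)"
  shows "cls A (dPlus A f (Diff A h)) = cls A f"
proof -
  note dh = diff_hom0[OF h]
  define h' where "h' = sgn_pow A 1 h"
  have h': "h' \<in> dHom A X Y (-1)" "dPlus A h h' = dNull A X Y (-1)"
    using sgn_pow_odd[OF h, of 1] unfolding h'_def by auto
  have sum: "dPlus A (dPlus A f (Diff A h)) (Diff A k) = dPlus A f (Diff A (dPlus A h k))"
    if k: "k \<in> dHom A X Y (-1)" for k
    using dplus_assoc[OF f dh diff_hom0[OF k]] diff_plus[OF h k] by simp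
  have eqk: "dPlus A f (Diff A k) = dPlus A (dPlus A f (Diff A h)) (Diff A (dPlus A h' k))"
    if k: "k \<in> dHom A X Y (-1)" for k
  proof -
    have "dPlus A h (dPlus A h' k) = k"
      using dplus_assoc[OF h h'(1) k] h'(2) dnull_plus[OF k] by simp
    then show ?thesis
      using sum[OF dplus_hom[OF h'(1) k]] by simp
  qed
  show ?thesis
    unfolding cls_eq[OF f] cls_eq[OF dplus_hom[OF f dh]]
  proof (intro equalityI image_subsetI)
    fix k assume k: "k \<in> dHom A X Y (-1)"
    show "dPlus A (dPlus A f (Diff A h)) (Diff A k) \<in> (\<lambda>h. dPlus A f (Diff A h)) ` dHom A X Y (-1)"
      unfolding sum[OF k] using dplus_hom[OF h k] by (rule imageI)
    show "dPlus A f (Diff A k) \<in> (\<lambda>k. dPlus A (dPlus A f (Diff A h)) (Diff A k)) ` dHom A X Y (-1)"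
      unfolding eqk[OF k] using dplus_hom[OF h'(1) k] by (rule imageI)
  qed
qed

lemma closed0_hom: "f \<in> closed0 A X Y \<Longrightarrow> f \<in> dHom A X Y 0"
  unfolding closed0_def by simp

lemma closed0_diff: "f \<in> closed0 A X Y \<Longrightarrow> Diff A f = dNull A X Y (0 + 1)"
  unfolding closed0_def by simp

text \<open>Composition in \<open>H0 A\<close> uses the representatives picked by
  \<open>rep\<close>, here \<open>f' = f + d h\<close> and \<open>g + d k\<close>. By the Leibniz
  rule and closedness their composite differs from \<open>g f\<close> by
  \<open>d (g h) + d (k f')\<close>.\<close>

lemma cls_comp:
  assumes f: "f \<in> closed0 A X Y" and g: "g \<in> closed0 A Y Z"
  shows "cls A (rep (cls A g) \<bullet>\<^bsub>A\<^esub> rep (cls A f)) = cls A (g \<bullet>\<^bsub>A\<^esub> f)"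
proof -
  note F = closed0_hom[OF f] and G = closed0_hom[OF g]
  note ob = dhom_objects[OF F] dhom_objects[OF G]
  obtain h where h: "h \<in> dHom A X Y (-1)" "rep (cls A f) = dPlus A f (Diff A h)"
    using rep_cls[OF F] by blast
  obtain k where k: "k \<in> dHom A Y Z (-1)" "rep (cls A g) = dPlus A g (Diff A k)"
    using rep_cls[OF G] by blast
  define f' where "f' = dPlus A f (Diff A h)"
  note dh = diff_hom0[OF h(1)] and dk = diff_hom0[OF k(1)]
  have F': "f' \<in> dHom A X Y 0"
    unfolding f'_def by (rule dplus_hom[OF F dh])
  have "Diff A f' = dPlus A (dNull A X Y 1) (dNull A X Y 1)"
    unfolding f'_def using diff_plus[OF F dh] closed0_diff[OF f] diff_diff[OF h(1)] by simp
  then have dF': "Diff A f' = dNull A X Y (0 + 1)"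
    using dnull_plus[OF dnull_hom[OF ob(1,2)]] by simp
  have gh: "g \<bullet>\<^bsub>A\<^esub> h \<in> dHom A X Z (-1)" and kf: "k \<bullet>\<^bsub>A\<^esub> f' \<in> dHom A X Z (-1)"
    and gf: "g \<bullet>\<^bsub>A\<^esub> f \<in> dHom A X Z 0"
    using dg_comp_hom[OF h(1) G] dg_comp_hom[OF F' k(1)] dg_comp_hom[OF F G] by simp_all
  have "Diff A (g \<bullet>\<^bsub>A\<^esub> h) = g \<bullet>\<^bsub>A\<^esub> Diff A h"
    using diff_comp_closed_left[OF G closed0_diff[OF g] h(1)] by (simp add: sgn_pow_def)
  moreover have "Diff A (k \<bullet>\<^bsub>A\<^esub> f') = Diff A k \<bullet>\<^bsub>A\<^esub> f'"
    by (rule diff_comp_closed_right[OF F' dF' k(1)])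
  moreover have "rep (cls A g) \<bullet>\<^bsub>A\<^esub> rep (cls A f) = dPlus A (g \<bullet>\<^bsub>A\<^esub> f') (Diff A k \<bullet>\<^bsub>A\<^esub> f')"
    unfolding h(2) k(2) f'_def[symmetric] by (rule dg_comp_plus_left[OF F' G dk])
  moreover have "g \<bullet>\<^bsub>A\<^esub> f' = dPlus A (g \<bullet>\<^bsub>A\<^esub> f) (g \<bullet>\<^bsub>A\<^esub> Diff A h)"
    unfolding f'_def by (rule dg_comp_plus_right[OF F dh G])
  ultimately show ?thesis
    using cls_add_boundary[OF gf gh] cls_add_boundary[OF dplus_hom[OF gf diff_hom0[OF gh]] kf] by simp
qed

text \<open>The Leibniz rule for the identity composed with itself reads
  \<open>d 1 = d 1 + d 1\<close>.\<close>

lemma ident_closed0: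
  assumes X: "X \<in> dOb A"
  shows "dIdent A X \<in> closed0 A X X"
proof -
  note I = dg_ident_hom[OF X] and dI = diff_hom[OF dg_ident_hom[OF X]]
  have "Diff A (dIdent A X) = dPlus A (Diff A (dIdent A X)) (Diff A (dIdent A X))"
    using leibniz[OF I I] dg_ident_left[OF I] dg_ident_right[OF dI] dg_ident_left[OF dI]
    by (simp add: sgn_pow_def)
  then show ?thesis
    using didem_null[OF dI] I unfolding closed0_def by simp
qed

text \<open>The shift on \<open>H0 A\<close> conjugates a picked representative
  \<open>1 + d h\<close> of the identity class. Since \<open>s\<close> and \<open>s'\<close> are
  closed and \<open>s\<close> has odd degree, \<open>s (d h) s'\<close> is minus the boundary of
  \<open>s h s'\<close>, so the class stays that of an identity.\<close>

lemma conjugate_boundary: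
  assumes s: "is_dg_shift A X Y s s'" and h: "h \<in> dHom A X X (-1)"
  shows "cls A (s \<bullet>\<^bsub>A\<^esub> dPlus A (dIdent A X) (Diff A h) \<bullet>\<^bsub>A\<^esub> s') = cls A (dIdent A Y)"
proof -
  have s: "X \<in> dOb A" "Y \<in> dOb A" "s \<in> dHom A X Y (-1)" "s' \<in> dHom A Y X 1"
    "Diff A s = dNull A X Y (-1 + 1)" "Diff A s' = dNull A Y X (1 + 1)" "s \<bullet>\<^bsub>A\<^esub> s' = dIdent A Y"
    using s unfolding is_dg_shift_def by simp_all
  define k where "k = h \<bullet>\<^bsub>A\<^esub> s'"
  have k: "k \<in> dHom A Y X 0"
    using dg_comp_hom[OF s(4) h] unfolding k_def by simp
  have dk: "Diff A k = Diff A h \<bullet>\<^bsub>A\<^esub> s'" "Diff A k \<in> dHom A Y X 1"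
    using diff_comp_closed_right[OF s(4,6) h] diff_hom[OF k] unfolding k_def by simp_all
  have sdk: "s \<bullet>\<^bsub>A\<^esub> Diff A k \<in> dHom A Y Y 0"
    using dg_comp_hom[OF dk(2) s(3)] by simp
  define m where "m = s \<bullet>\<^bsub>A\<^esub> k"
  have m: "m \<in> dHom A Y Y (-1)"
    using dg_comp_hom[OF k s(3)] unfolding m_def by simp
  define m' where "m' = sgn_pow A 1 m"
  have m': "m' \<in> dHom A Y Y (-1)" "dPlus A m m' = dNull A Y Y (-1)"
    using sgn_pow_odd[OF m, of 1] unfolding m'_def by auto
  have "dPlus A (s \<bullet>\<^bsub>A\<^esub> Diff A k) (Diff A m) = dNull A Y Y 0"
    using diff_comp_closed_left[OF s(3,5) k] sgn_pow_odd[OF sdk, of "-1"] unfolding m_def by simp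
  moreover have "dPlus A (Diff A m) (Diff A m') = dNull A Y Y 0"
    using diff_plus[OF m m'(1)] m'(2) diff_null[OF s(2,2), of "-1"] by simp
  ultimately have dm': "s \<bullet>\<^bsub>A\<^esub> Diff A k = Diff A m'"
    using dplus_left_cancel[OF diff_hom0[OF m] sdk diff_hom0[OF m'(1)]]
      dplus_commute[OF sdk diff_hom0[OF m]] by simp
  have "dPlus A (dIdent A X) (Diff A h) \<bullet>\<^bsub>A\<^esub> s' = dPlus A s' (Diff A k)"
    using dg_comp_plus_left[OF s(4) dg_ident_hom[OF s(1)] diff_hom0[OF h]] dg_ident_left[OF s(4)] dk(1) by simp
  then have "s \<bullet>\<^bsub>A\<^esub> dPlus A (dIdent A X) (Diff A h) \<bullet>\<^bsub>A\<^esub> s' = dPlus A (dIdent A Y) (Diff A m')"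
    using dg_comp_plus_right[OF s(4) dk(2) s(3)] s(7) dm' by simp
  then show ?thesis
    using cls_add_boundary[OF dg_ident_hom[OF s(2)] m'(1)] by simp
qed

lemma cls_Hom: "f \<in> closed0 A X Y \<Longrightarrow> cls A f \<in> Hom (H0_pre A) X Y"
  using rep_hom[OF closed0_hom] dom_cod_deg[OF rep_hom[OF closed0_hom], of f X Y] dhom_objects[OF closed0_hom, of f X Y]
  unfolding Hom_def H0_pre_def by auto

lemma H0_pre_comp:
  "f \<in> closed0 A X Y \<Longrightarrow> g \<in> closed0 A Y Z \<Longrightarrow> cls A g \<cdot>\<^bsub>H0_pre A\<^esub> cls A f = cls A (g \<bullet>\<^bsub>A\<^esub> f)"
  using cls_comp unfolding H0_pre_def by simp

lemma H0_pre_ident_comp: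
  assumes "f \<in> closed0 A X Y"
  shows "cls A (dIdent A Y) \<cdot>\<^bsub>H0_pre A\<^esub> cls A f = cls A f" "cls A f \<cdot>\<^bsub>H0_pre A\<^esub> cls A (dIdent A X) = cls A f"
  using H0_pre_comp[OF assms ident_closed0] H0_pre_comp[OF ident_closed0 assms] dg_ident_left[OF closed0_hom[OF assms]]
    dg_ident_right[OF closed0_hom[OF assms]] dhom_objects[OF closed0_hom[OF assms]] by simp_all

lemma H0_pre_ident_iso:
  assumes "X \<in> dOb A"
  shows "is_iso (H0_pre A) (cls A (dIdent A X))"
proof -
  note I = ident_closed0[OF assms]
  have "Ident (H0_pre A) X = cls A (dIdent A X)"
    by (simp add: H0_pre_def)
  then show ?thesis
    using cls_Hom[OF I] H0_pre_ident_comp(1)[OF I] unfolding is_iso_def Hom_def by auto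
qed

end

section \<open>Standard triangles of the homotopy category\<close>

context pretriangulated_dg_category
begin

lemma dg_shift_of:
  assumes "X \<in> dOb A"
  obtains s s' where "is_dg_shift A X (fst (dg_shift_of A X)) s s'"
    "dg_shift_of A X = (fst (dg_shift_of A X), s, s')"
proof -
  have "\<exists>y. case y of (Y, s, s') \<Rightarrow> is_dg_shift A X Y s s'"
    using dg_shift_exists[OF assms] by auto
  then have "case dg_shift_of A X of (Y, s, s') \<Rightarrow> is_dg_shift A X Y s s'"
    unfolding dg_shift_of_def by (rule someI_ex)
  then show ?thesis
    using that by (cases "dg_shift_of A X") auto
qed

lemma H0_shift_ident:
  assumes "X \<in> dOb A"
  shows "farr (H0_shift A) (cls A (dIdent A X)) = cls A (dIdent A (fst (dg_shift_of A X)))"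
proof -
  note I = dg_ident_hom[OF assms]
  obtain s s' where s: "is_dg_shift A X (fst (dg_shift_of A X)) s s'"
    "dg_shift_of A X = (fst (dg_shift_of A X), s, s')"
    using dg_shift_of[OF assms] by blast
  obtain h where h: "h \<in> dHom A X X (-1)" "rep (cls A (dIdent A X)) = dPlus A (dIdent A X) (Diff A h)"
    using rep_cls[OF I] by blast
  have "farr (H0_shift A) (cls A (dIdent A X)) = cls A (s \<bullet>\<^bsub>A\<^esub> rep (cls A (dIdent A X)) \<bullet>\<^bsub>A\<^esub> s')"
    using dom_cod_deg(1,2)[OF rep_hom[OF I]] s(2) unfolding H0_shift_def by (simp add: Let_def) (metis fst_conv snd_conv)
  then show ?thesis
    using conjugate_boundary[OF s(1) h(1)] h(2) by simp
qed

text \<open>The triangles of \<open>H0 A\<close> form an isomorphism closure, so membership is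
  witnessed by the identity map of the standard triangle; for this the shift of an identity has to
  be known. The second conclusion is the side condition of
  \<open>exact_functor_distinguished\<close>.\<close>

lemma H0_cone_triangle:
  assumes cone: "is_dg_cone A X Y f Z i j p q"
  shows "\<exists>u v w. exact_triangle (H0 A) u v w X Y Z" "fobj (Shift (H0 A)) X \<in> Ob (H0 A)"
proof -
  have c: "X \<in> dOb A" "Y \<in> dOb A" "Z \<in> dOb A" "f \<in> closed0 A X Y" "j \<in> closed0 A Y Z"
    "p \<in> dHom A Z X 1" "Diff A p = dNull A Z X (1 + 1)"
    using cone unfolding is_dg_cone_def closed0_def by simp_all
  let ?X1 = "fst (dg_shift_of A X)"
  obtain s s' where s: "is_dg_shift A X ?X1 s s'" "dg_shift_of A X = (?X1, s, s')"
    using dg_shift_of[OF c(1)] by blast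
  have s1: "s \<in> dHom A X ?X1 (-1)" "Diff A s = dNull A X ?X1 (-1 + 1)" "?X1 \<in> dOb A"
    using s(1) unfolding is_dg_shift_def by simp_all
  \<comment> \<open>Both factors are closed and their degrees 1 and -1 cancel.\<close>
  have sp: "s \<bullet>\<^bsub>A\<^esub> p \<in> closed0 A Z ?X1"
    using dg_comp_hom[OF c(6) s1(1)] diff_comp_closed_right[OF c(6,7) s1(1)] s1(2)
      dnull_comp[OF c(6) s1(3), of 0] unfolding closed0_def by simp
  let ?u = "cls A f" and ?v = "cls A j" and ?w = "cls A (s \<bullet>\<^bsub>A\<^esub> p)"
  have S: "fobj (Shift (H0_pre A)) X = ?X1" "Ob (H0_pre A) = dOb A"
    by (simp_all add: H0_pre_def H0_shift_def)
  have shape: "triangle_shape (H0_pre A) ?u ?v ?w X Y Z"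
    unfolding triangle_shape_def S using c s1 cls_Hom c(4,5) sp by simp
  have dom: "Dom (H0_pre A) ?u = X" "Dom (H0_pre A) ?v = Y" "Dom (H0_pre A) ?w = Z"
    using cls_Hom[OF c(4)] cls_Hom[OF c(5)] cls_Hom[OF sp] unfolding Hom_def by auto
  have I: "cls A (dIdent A X) \<in> Hom (H0_pre A) X X" if "X \<in> dOb A" for X
    using cls_Hom ident_closed0 that by blast
  have "farr (Shift (H0_pre A)) (cls A (dIdent A X)) = cls A (dIdent A ?X1)"
    using H0_shift_ident[OF c(1)] by (simp add: H0_pre_def)
  then have "triangle_map (H0_pre A) (?u, ?v, ?w) (?u, ?v, ?w)
    (cls A (dIdent A X)) (cls A (dIdent A Y)) (cls A (dIdent A Z))"
    unfolding triangle_map_def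
    using dom I c(1-3) H0_pre_ident_comp[OF c(4)] H0_pre_ident_comp[OF c(5)] H0_pre_ident_comp[OF sp] by simp
  moreover have "(?u, ?v, ?w) \<in> cone_triangles A"
    unfolding cone_triangles_def using cone s(2) by (auto simp: prod_eq_iff) (metis fst_conv snd_conv)
  ultimately have "(?u, ?v, ?w) \<in> iso_closure (H0_pre A) (cone_triangles A)"
    unfolding iso_closure_def using shape H0_pre_ident_iso c(1-3) by blast
  moreover have "triangle_shape (H0 A) ?u ?v ?w X Y Z"
    using shape unfolding triangle_shape_def H0_def Hom_def by simp
  ultimately show "\<exists>u v w. exact_triangle (H0 A) u v w X Y Z"
    unfolding exact_triangle_def by (auto simp: H0_def)
  show "fobj (Shift (H0 A)) X \<in> Ob (H0 A)"
    using S s1(3) by (simp add: H0_def)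
qed

end

section \<open>From functorial cones to triangles\<close>

context enhanced_triangulated_category
begin

lemma dg_lift_component:
  assumes "is_dg_lift K A e D A e \<Phi> F \<theta>" "X \<in> dOb A"
  shows "isomorphic D (fobj e (fobj F X)) (fobj \<Phi> (fobj e X))"
  using assms naturally_isomorphic_objects[of "H0 A" D "e \<odot>\<^sub>F H0_ftor A F" "\<Phi> \<odot>\<^sub>F e" X]
  unfolding is_dg_lift_def naturally_isomorphic_def by (auto simp: H0_def H0_pre_def H0_ftor_def)

text \<open>Choose \<open>Y\<close> in the enhancement with \<open>e Y\<close> isomorphic to
  \<open>X\<close>. The dg cone at \<open>Y\<close> gives a standard triangle, \<open>e\<close>
  carries it to \<open>D\<close>, and the lifts identify its vertices with the values at
  \<open>X\<close>.\<close>

lemma functorial_cone_distinguished: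
  assumes T: "is_functorial_cone K D A e \<Phi> \<Psi> \<tau> T" and X: "X \<in> Ob D"
    and lin: "linear_functor K D D \<Phi>" "linear_functor K D D \<Psi>" "linear_functor K D D T"
  shows "distinguished D (fobj \<Phi> X) (fobj \<Psi> X) (fobj T X)"
proof -
  obtain F \<theta>\<^sub>F G \<theta>\<^sub>G \<alpha> Q \<theta>\<^sub>Q where lift: "is_dg_lift K A e D A e \<Phi> F \<theta>\<^sub>F"
    "is_dg_lift K A e D A e \<Psi> G \<theta>\<^sub>G" "is_dg_lift K A e D A e T Q \<theta>\<^sub>Q"
    and Q: "is_dg_cone_functor A A F G \<alpha> Q"
    using T unfolding is_functorial_cone_def by blast
  have e: "exact_functor K (H0 A) D e"
    using enhancement unfolding exact_equivalence_def by blast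
  obtain H where H: "linear_functor K D (H0 A) H" "naturally_isomorphic D D (e \<odot>\<^sub>F H) id_ftor"
    using enhancement unfolding exact_equivalence_def is_equivalence_def quasi_inverse_def by blast
  define Y where "Y = fobj H X"
  have Y: "Y \<in> dOb A"
    using H(1) X unfolding Y_def linear_functor_def by (auto simp: H0_def H0_pre_def)
  have YX: "isomorphic D (fobj e Y) X"
    using naturally_isomorphic_objects[OF H(2) X] unfolding Y_def by simp
  obtain i j p q where cone: "is_dg_cone A (fobj F Y) (fobj G Y) (\<alpha> Y) (fobj Q Y) i j p q"
    using Q Y unfolding is_dg_cone_functor_def by blast
  have "distinguished D (fobj e (fobj F Y)) (fobj e (fobj G Y)) (fobj e (fobj Q Y))"
    using exact_functor_distinguished[OF e] H0_cone_triangle[OF cone] by blast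
  moreover have "isomorphic D (fobj e (fobj P Y)) (fobj \<Theta> X)"
    if "is_dg_lift K A e D A e \<Theta> P \<theta>" "linear_functor K D D \<Theta>" for \<Theta> P \<theta>
  proof -
    interpret functor_between K D D \<Theta>
      by unfold_locales (fact that(2))
    show ?thesis
      by (rule isomorphic_trans[OF dg_lift_component[OF that(1) Y] map_isomorphic[OF YX]])
  qed
  ultimately show ?thesis
    using distinguished_iso lift lin by blast
qed

end


section \<open>Spherical functors\<close>

lemma linear_functor_comp:
  assumes "functor_between K C D F" "functor_between K D E G"
  shows "linear_functor K C E (G \<odot>\<^sub>F F)"
proof -
  interpret F: functor_between K C D F by fact
  interpret G: functor_between K D E G by fact
  have "farr G (farr F (Scal C k f)) = Scal E k (farr G (farr F f))"
    if "X \<in> Ob C" "Y \<in> Ob C" "k \<in> carrier K" "f \<in> Hom C X Y" for X Y k f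
  proof -
    have "farr F (Scal C k f) = Scal D k (farr F f)"
      using F.linear that unfolding linear_functor_def by blast
    moreover have "farr G (Scal D k (farr F f)) = Scal E k (farr G (farr F f))"
      using G.linear F.map_object[OF that(1)] F.map_object[OF that(2)] that(3) F.map_hom[OF that(4)]
      unfolding linear_functor_def by blast
    ultimately show ?thesis
      by simp
  qed
  then show ?thesis
    unfolding linear_functor_def fobj_comp farr_comp
    using F.map_object G.map_object F.map_ident G.map_ident F.map_hom G.map_hom
      F.map_comp G.map_comp[OF F.map_hom F.map_hom] F.map_plus G.map_plus[OF F.map_hom F.map_hom]
    by (intro conjI ballI) simp_all
qed

section \<open>The intertwining property of \<open>R\<close> and the two entropy bounds\<close>

context spherical_functor
begin

lemma spherical_linear: "linear_functor K C D S" "linear_functor K D C R" "linear_functor K D C L"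
    "linear_functor K D D T" "linear_functor K C C W"
  using S_exact R_exact L_exact twist_equivalence cotwist_equivalence
  unfolding exact_functor_def exact_equivalence_def by blast+

lemma R_on_objects: "exact_on_objects K D C (fobj R)"
  by (rule exact_functor_on_objects[OF cod_cat.triangulated_category_axioms dom_cat.triangulated_category_axioms R_exact])

lemma T_on_objects: "exact_on_objects K D D (fobj T)"
  using exact_functor_on_objects[OF cod_cat.triangulated_category_axioms cod_cat.triangulated_category_axioms]
    twist_equivalence unfolding exact_equivalence_def by blast

lemma W_on_objects: "exact_on_objects K C C (fobj W)"
  using exact_functor_on_objects[OF dom_cat.triangulated_category_axioms dom_cat.triangulated_category_axioms]
    cotwist_equivalence unfolding exact_equivalence_def by blast

lemma W2_on_objects: "exact_on_objects K C C (fobj (ftor_shift C W 2))"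
proof -
  have "fobj (ftor_shift C W 2) = (\<lambda>X. fobj (shift_by C 2) (fobj W X))"
    by (rule ext) (simp add: ftor_shift_def)
  then show ?thesis
    using exact_on_objects_comp[OF W_on_objects dom_cat.shift_by_on_objects] by simp
qed

text \<open>\<open>R[1] \<cong> L T\<close>, hence \<open>R T \<cong> W L T [1] \<cong> W R [2]\<close>.\<close>

lemma R_twist:
  assumes X: "X \<in> Ob D"
  shows "isomorphic C (fobj R (fobj T X)) (fobj (ftor_shift C W 2) (fobj R X))"
proof -
  interpret T: exact_on_objects K D D "fobj T"
    by (rule T_on_objects)
  interpret W: exact_on_objects K C C "fobj W"
    by (rule W_on_objects)
  interpret L: functor_between K D C L
    by unfold_locales (rule spherical_linear)
  interpret R: functor_between K D C R
    by unfold_locales (rule spherical_linear)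
  note TX = T.map_object[OF X]
  note LTX = L.map_object[OF TX]
  have "isomorphic C (fobj R X) (fobj (Unshift C) (fobj L (fobj T X)))"
    using naturally_isomorphic_objects[OF R_iso_L_twist X] by (simp add: ftor_shift_def fobj_shift_by)
  from dom_cat.isomorphic_trans[OF dom_cat.shift.map_isomorphic[OF this] dom_cat.shift_unshift_iso[OF LTX]]
  have 1: "isomorphic C (fobj (Shift C) (fobj R X)) (fobj L (fobj T X))" .
  have 2: "isomorphic C (fobj R (fobj T X)) (fobj (Shift C) (fobj W (fobj L (fobj T X))))"
    using naturally_isomorphic_objects[OF R_iso_cotwist_L TX] by (simp add: ftor_shift_def fobj_shift_by)
  \<comment> \<open>\<open>W\<close> commutes with the shift up to isomorphism; the shift pulled out
    here joins the one already outside, which gives \<open>W[2]\<close>.\<close>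
  have "isomorphic C (fobj W (fobj L (fobj T X))) (fobj (Shift C) (fobj W (fobj R X)))"
    by (rule dom_cat.isomorphic_trans[OF dom_cat.isomorphic_sym[OF W.map_isomorphic[OF 1]]
          W.map_shift[OF R.map_object[OF X]]])
  from dom_cat.isomorphic_trans[OF 2 dom_cat.shift.map_isomorphic[OF this]] show ?thesis
    by (simp add: ftor_shift_def fobj_shift_by numeral_2_eq_2)
qed

lemma R_twist_iterate:
  assumes X: "X \<in> Ob D"
  shows "isomorphic C (fobj R ((fobj T ^^ n) X)) ((fobj (ftor_shift C W 2) ^^ n) (fobj R X))"
proof (induction n)
  case 0
  then show ?case
    using dom_cat.isomorphic_refl[OF exact_on_objects.map_object[OF R_on_objects X]] by simp
next
  case (Suc n)
  have "(fobj T ^^ n) X \<in> Ob D"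
    by (rule exact_on_objects.map_object[OF cod_cat.iterate_on_objects[OF T_on_objects] X])
  from dom_cat.isomorphic_trans[OF R_twist[OF this] exact_on_objects.map_isomorphic[OF W2_on_objects Suc]]
  show ?case
    by simp
qed

text \<open>At \<open>E\<close> the cone of the counit is a triangle \<open>S R E, E, T E\<close>
  with zero first vertex.\<close>

lemma twist_fixes_kernel:
  assumes E: "E \<in> Ob D" and zero: "is_zero D (fobj (S \<odot>\<^sub>F R) E)"
  shows "isomorphic D ((fobj T ^^ n) E) E"
proof (induction n)
  case 0
  then show ?case
    using cod_cat.isomorphic_refl[OF E] by simp
next
  case (Suc n)
  have "linear_functor K D D (S \<odot>\<^sub>F R)"
    by (rule linear_functor_comp[where D = C]) (unfold_locales, (rule spherical_linear)+)
  moreover have "linear_functor K D D id_ftor"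
    unfolding linear_functor_def by simp
  ultimately have "distinguished D (fobj (S \<odot>\<^sub>F R) E) E (fobj T E)"
    using cod_cat.functorial_cone_distinguished[OF twist E _ _ spherical_linear(4)] by simp
  then have "isomorphic D (fobj T E) E"
    using cod_cat.distinguished_zero_first zero cod_cat.isomorphic_sym by blast
  with exact_on_objects.map_isomorphic[OF T_on_objects Suc] show ?case
    using cod_cat.isomorphic_trans by auto
qed

lemma entropy_twist_ge_cotwist:
  assumes D: "split_generator D G\<^sub>D" and C: "split_generator C G\<^sub>C" "in_essential_image D C R G\<^sub>C"
  shows "entropy C t (ftor_shift C W 2) \<le> entropy D t T"
proof -
  interpret R: exact_on_objects K D C "fobj R"
    by (rule R_on_objects)
  obtain H where H: "H \<in> Ob D" "isomorphic C (fobj R H) G\<^sub>C"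
    using C(2) unfolding in_essential_image_def by blast
  \<comment> \<open>Adding \<open>H\<close> makes \<open>R H\<close>, hence
    \<open>G\<^sub>C\<close>, a retract of \<open>R G\<close>, so one object \<open>G\<close> yields
    split-generators of both categories.\<close>
  obtain G where G: "is_direct_sum D G\<^sub>D H G"
    using cod_cat.direct_sum_exists[OF cod_cat.split_generator_object[OF D] H(1)] by blast
  have gen: "split_generator D G"
    using cod_cat.split_generator_retract[OF D cod_cat.direct_sum_retract[OF G]] .
  have "retract_of C (fobj R H) (fobj R G)"
    using R.map_retract cod_cat.direct_sum_retract cod_cat.direct_sum_commute[OF G] by blast
  then have genR: "split_generator C (fobj R G)"
    using dom_cat.split_generator_retract[OF C(1)] dom_cat.retract_trans
      dom_cat.isomorphic_retract[OF dom_cat.isomorphic_sym[OF H(2)]] by blast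
  note GO = cod_cat.split_generator_object[OF gen]
  show ?thesis
  proof (rule growth_limit_mono[where c = 1, OF _ _ _ cod_cat.entropy_limit[OF T_on_objects gen, of t]
        dom_cat.entropy_limit[OF W2_on_objects genR, of t]])
    fix n
    let ?X = "(fobj T ^^ n) G"
    have X: "?X \<in> Ob D"
      by (rule exact_on_objects.map_object[OF cod_cat.iterate_on_objects[OF T_on_objects] GO])
    show "complexity D t G ?X < \<infinity>"
      using cod_cat.split_generator_builds[OF gen X] cod_cat.complexity_finite by blast
    show "complexity C t (fobj R G) ((fobj (ftor_shift C W 2) ^^ n) (fobj R G)) \<le> 1 * complexity D t G ?X"
      using R.complexity_map[OF GO, of t ?X] dom_cat.complexity_iso[OF R_twist_iterate[OF GO]] by simp
  qed simp
qed

text \<open>Nonzero complexity makes the constant comparison sequence grow at rate 0; with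
  complexity 0 its rate would be \<open>- \<infinity>\<close>. This can happen for nonzero
  \<open>E\<close>: if \<open>E\<close> is isomorphic to \<open>E[2]\<close> and \<open>t\<close> is
  nonzero, pieces can be shifted until their weight is arbitrarily small.\<close>

lemma entropy_twist_nonneg:
  assumes E: "E \<in> Ob D" "is_zero D (fobj (S \<odot>\<^sub>F R) E)"
    and G: "split_generator D G" "complexity D t G E \<noteq> 0"
  shows "0 \<le> entropy D t T"
proof -
  obtain G' where G': "is_direct_sum D G E G'"
    using cod_cat.direct_sum_exists[OF cod_cat.split_generator_object[OF G(1)] E(1)] by blast
  have gen: "split_generator D G'"
    using cod_cat.split_generator_retract[OF G(1) cod_cat.direct_sum_retract[OF G']] .
  note GO = cod_cat.split_generator_object[OF G(1)] and GO' = cod_cat.split_generator_object[OF gen]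
  obtain ks where ks: "built_from D G G' ks"
    using cod_cat.split_generator_builds[OF G(1) GO'] by blast
  obtain ls where ls: "built_from D G' E ls"
    using cod_cat.split_generator_builds[OF gen E(1)] by blast
  have "complexity D t G E \<le> complexity D t G G' * complexity D t G' E"
    by (rule cod_cat.complexity_submultiplicative[OF GO ks ls])
  \<comment> \<open>The generator must contain \<open>E\<close> as a retract, so nonvanishing is
    transferred from \<open>G\<close> to the enlarged \<open>G'\<close>.\<close>
  then have "0 < complexity D t G' E"
    using G(2) by (cases "complexity D t G' E = 0") (auto simp: zero_less_iff_neq_zero)
  moreover have "complexity D t G' E < \<infinity>"
    by (rule cod_cat.complexity_finite[OF ls])
  ultimately have const: "growth (\<lambda>_. complexity D t G' E) \<longlonglongrightarrow> 0"
    by (rule growth_const)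
  show ?thesis
  proof (rule growth_limit_mono[where c = 1, OF _ _ _ cod_cat.entropy_limit[OF T_on_objects gen, of t] const])
    fix n
    interpret I: exact_on_objects K D D "fobj T ^^ n"
      by (rule cod_cat.iterate_on_objects[OF T_on_objects])
    show "complexity D t G' ((fobj T ^^ n) G') < \<infinity>"
      using cod_cat.split_generator_builds[OF gen I.map_object[OF GO']] cod_cat.complexity_finite by blast
    have "retract_of D E G'"
      using cod_cat.direct_sum_retract cod_cat.direct_sum_commute[OF G'] by blast
    from cod_cat.complexity_retract[OF I.map_retract[OF this], of t G']
    show "complexity D t G' E \<le> 1 * complexity D t G' ((fobj T ^^ n) G')"
      using cod_cat.complexity_iso[OF twist_fixes_kernel[OF E]] by simp
  qed simp
qed

end

text \<open>In the second part the kernel object has, beyond being nonzero, nonzero complexity from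
  some split-generator, as \<open>entropy_twist_nonneg\<close> requires.\<close>

theorem theorem1p7:
  fixes K :: "('k, 'r) ring_scheme"
    and C :: "('o, 'm, 'k) tri_cat"
    and A :: "('a1, 'a2, 'k) dg_cat" and a :: "('a1, 'a2 set, 'o, 'm) ftor"
    and D :: "('p, 'n, 'k) tri_cat"
    and B :: "('b1, 'b2, 'k) dg_cat" and b :: "('b1, 'b2 set, 'p, 'n) ftor"
    and S :: "('o, 'm, 'p, 'n) ftor" and R L :: "('p, 'n, 'o, 'm) ftor"
    and \<eta> :: "'o \<Rightarrow> 'm" and \<epsilon> :: "'p \<Rightarrow> 'n"
    and T :: "('p, 'n, 'p, 'n) ftor" and W :: "('o, 'm, 'o, 'm) ftor"
    and t :: real
  assumes spherical: "spherical_functor K C A a D B b S R L \<eta> \<epsilon> T W"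
    and D_split_generated: "\<exists>G. split_generator D G"
  shows "((\<exists>G. split_generator C G \<and> in_essential_image D C R G)
            \<longrightarrow> entropy D t T \<ge> entropy C t (ftor_shift C W 2)) \<and>
         ((\<exists>E \<in> Ob D. \<not> is_zero D E \<and> is_zero D (fobj (S \<odot>\<^sub>F R) E) \<and>
                    (\<exists>G. split_generator D G \<and> complexity D t G E \<noteq> 0))
            \<longrightarrow> entropy D t T \<ge> 0)"
proof -
  interpret spherical_functor K C A a D B b S R L \<eta> \<epsilon> T W
    by (rule spherical)
  show ?thesis
    using D_split_generated entropy_twist_ge_cotwist entropy_twist_nonneg by blast
qed

end
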